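(* The maps $m_{\mathcal M}\colon\mathcal A\otimes\mathcal M\to\mathcal M$ and $\delta_{\mathcal M}=(Pr_{\mathcal M}\otimes \mathrm{id})\circ\Delta_{\mathcal M}\colon \mathcal M\to\mathcal A\otimes\mathcal M$ endow $\mathcal M$ with the structure of a (left) $\mathcal A$-Hopf module.
   Context: $\mathbb K$ is a field of characteristic $0$; tensor products are over $\mathbb K$. Chord diagrams. For $n\ge 0$, an order $n$ chord diagram is a collection of $n$ chords, i.e. $n$ pairs of points on an oriented circle (all $2n$ points pairwise distinct), considered up to orientation preserving diffeomorphisms of the circle. An order $n$ framed chord diagram is a chord diagram together with a framing, i.e. a map from the set of chords to $\mathbb Z/2\mathbb Z$; chords of framing $0$ are called oriented, chords of framing $1$ are called disorienting. A framed chord diagram is black if all its chords are oriented. Ordinary chord diagrams are identified with black framed ones. Framed 4T-relations. Take any collection of framed chords on the oriented circle, containing a distinguished chord $v$ with endpoints $p,q$, and a further point $r$ on the circle distinct from all endpoints. Let $p^-,p^+$ (resp. $q^-,q^+$) be points immediately before and immediately after $p$ (resp. $q$) with respect to the orientation, with no other chord endpoint and not $r$ in between. For $x\in\{p^\pm,q^\pm\}$ and $\varphi\in\mathbb Z/2\mathbb Z$ let $D^{\varphi}(x)$ be the framed chord diagram obtained by adding one more chord $u$ (the jumping chord) with endpoints $r$ and $x$ and framing $\varphi$. The relations are, for each $\varphi$: if $v$ is oriented, $D^{\varphi}(p^-)-D^{\varphi}(p^+)=D^{\varphi}(q^+)-D^{\varphi}(q^-)$; if $v$ is disorienting, $D^{\varphi}(p^-)-D^{\varphi}(p^+)=D^{\varphi+1}(q^-)-D^{\varphi+1}(q^+)$.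 $\mathcal M$ is the $\mathbb K$-vector space spanned by all framed chord diagrams modulo all framed 4T-relations. $\mathcal A$ is the $\mathbb K$-vector space spanned by ordinary chord diagrams modulo the ordinary 4T-relations, i.e. the relations $D^{0}(p^-)-D^{0}(p^+)=D^{0}(q^+)-D^{0}(q^-)$ for collections of chords all of which (including $v$) are oriented. $\mathcal A$ is a commutative cocommutative graded Hopf algebra: the product is glueing of two diagrams (cut both circles at points that are not endpoints and glue them into one oriented circle), the coproduct is $\Delta_{\mathcal A}(d)=\sum d_I\otimes d_J$ over all ordered decompositions of the chord set into two complementary subsets $I,J$ (where $d_I$ is the subdiagram formed by the chords in $I$), the unit is the empty diagram, and the counit $\epsilon_{\mathcal A}$ is $1$ on the empty diagram and $0$ on all other diagrams. $m_{\mathcal M}\colon\mathcal A\otimes\mathcal M\to\mathcal M$ is the bilinear extension of the product $c\otimes d\mapsto cd$ of a black diagram $c$ and a framed chord diagram $d$, defined by the same cutting and glueing of the two circles (its class in $\mathcal M$ is independent of the cut points). $\Delta_{\mathcal M}\colon\mathcal M\to\mathcal M\otimes\mathcal M$ is the (well-defined) linear map $d\mapsto\sum d_I\otimes d_J$, the sum over all ways to decompose the set of chords of $d$ into two disjoint subsets $I$ and $J$. $Pr_{\mathcal M}\colon\mathcal M\to\mathcal A$ is the (well-defined) linear map with $Pr_{\mathcal M}(d)=d$ if $d$ is a black diagram and $Pr_{\mathcal M}(d)=0$ otherwise. For a Hopf algebra $H$ over $\mathbb K$ with product $m_H$, coproduct $\Delta_H$, counit $\epsilon_H$: a left $H$-comodule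 is a vector space $V$ with a linear map $\delta_V\colon V\to H\otimes V$ such that $(\mathrm{id}\otimes\delta_V)\circ\delta_V=(\Delta_H\otimes\mathrm{id})\circ\delta_V$ and $\iota\circ(\epsilon_H\otimes\mathrm{id})\circ\delta_V=\mathrm{id}$, where $\iota\colon\mathbb K\otimes V\to V$ is canonical. A left $H$-Hopf module is a vector space $V$ with a left $H$-module structure $m_V\colon H\otimes V\to V$ and a left $H$-comodule structure $\delta_V\colon V\to H\otimes V$ such that $\delta_V$ is a morphism of $H$-modules, where $H\otimes V$ has the $H$-module structure $m_{H\otimes V}=(m_H\otimes m_V)\circ(\mathrm{id}\otimes s\otimes\mathrm{id})\circ(\Delta_H\otimes(\mathrm{id}\otimes\mathrm{id}))\colon H\otimes(H\otimes V)\to H\otimes V$, with $s\colon H\otimes H\to H\otimes H$ the permutation of the tensor factors. *)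

theory Defs
  imports "HOL-Algebra.Module" "HOL-Algebra.AbelCoset" "HOL-Library.Z2"
begin

section \<open>Vector spaces and tensor products\<close>

text \<open>
  A vector space over a field \<open>K\<close> is a \<^locale>\<open>module\<close> over \<open>K\<close>; the ring fields \<open>mult\<close> and \<open>one\<close>
  of the \<open>module\<close> record play no role and are left \<open>undefined\<close>. A linear map is represented as an
  extensional function on the carrier, so that a linear map specified by its values on a
  spanning set is unique as a HOL function.
\<close>

definition linear_maps ::
  "('k, 'm) ring_scheme \<Rightarrow> ('k, 'v) module \<Rightarrow> ('k, 'w) module \<Rightarrow> ('v \<Rightarrow> 'w) set" where
  "linear_maps K V W = {f \<in> carrier V \<rightarrow>\<^sub>E carrier W.
     (\<forall>x \<in> carrier V. \<forall>y \<in> carrier V. f (x \<oplus>\<^bsub>V\<^esub> y) = f x \<oplus>\<^bsub>W\<^esub> f y) \<and>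
     (\<forall>a \<in> carrier K. \<forall>x \<in> carrier V. f (a \<odot>\<^bsub>V\<^esub> x) = a \<odot>\<^bsub>W\<^esub> f x)}"

definition the_linear ::
  "('k, 'm) ring_scheme \<Rightarrow> ('k, 'v) module \<Rightarrow> ('k, 'w) module \<Rightarrow> (('v \<Rightarrow> 'w) \<Rightarrow> bool) \<Rightarrow> 'v \<Rightarrow> 'w" where
  "the_linear K V W P = (THE f. f \<in> linear_maps K V W \<and> P f)"

definition id_map :: "('k, 'v) module \<Rightarrow> 'v \<Rightarrow> 'v" where
  "id_map V = (\<lambda>v \<in> carrier V. v)"

definition ground_space :: "('k, 'm) ring_scheme \<Rightarrow> ('k, 'k) module" where
  "ground_space K = \<lparr>carrier = carrier K, mult = undefined, one = undefined,
     zero = \<zero>\<^bsub>K\<^esub>, add = (\<lambda>x y. x \<oplus>\<^bsub>K\<^esub> y), smult = (\<lambda>a x. a \<otimes>\<^bsub>K\<^esub> x)\<rparr>"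

definition free_space :: "('k, 'm) ring_scheme \<Rightarrow> 'x set \<Rightarrow> ('k, 'x \<Rightarrow> 'k) module" where
  "free_space K X = \<lparr>
     carrier = {f. (\<forall>x. f x \<in> carrier K) \<and> (\<forall>x. x \<notin> X \<longrightarrow> f x = \<zero>\<^bsub>K\<^esub>) \<and> finite {x. f x \<noteq> \<zero>\<^bsub>K\<^esub>}},
     mult = undefined, one = undefined,
     zero = (\<lambda>x. \<zero>\<^bsub>K\<^esub>),
     add = (\<lambda>f g x. f x \<oplus>\<^bsub>K\<^esub> g x),
     smult = (\<lambda>a f x. a \<otimes>\<^bsub>K\<^esub> f x)\<rparr>"

definition basis_vec :: "('k, 'm) ring_scheme \<Rightarrow> 'x \<Rightarrow> 'x \<Rightarrow> 'k" where
  "basis_vec K x = (\<lambda>y. if y = x then \<one>\<^bsub>K\<^esub> else \<zero>\<^bsub>K\<^esub>)"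

definition subspace_generated ::
  "('k, 'm) ring_scheme \<Rightarrow> ('k, 'v) module \<Rightarrow> 'v set \<Rightarrow> 'v set" where
  "subspace_generated K V S = \<Inter>{N. submodule N K V \<and> S \<subseteq> N}"

definition quotient_space :: "('k, 'v) module \<Rightarrow> 'v set \<Rightarrow> ('k, 'v set) module" where
  "quotient_space V N = \<lparr>
     carrier = a_rcosets\<^bsub>V\<^esub> N,
     mult = undefined, one = undefined,
     zero = N,
     add = (\<lambda>X Y. X <+>\<^bsub>V\<^esub> Y),
     smult = (\<lambda>a X. \<Union>x \<in> X. N +>\<^bsub>V\<^esub> (a \<odot>\<^bsub>V\<^esub> x))\<rparr>"

definition tensor_free ::
  "('k, 'm) ring_scheme \<Rightarrow> ('k, 'v) module \<Rightarrow> ('k, 'w) module \<Rightarrow> ('k, 'v \<times> 'w \<Rightarrow> 'k) module" where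
  "tensor_free K V W = free_space K (carrier V \<times> carrier W)"

definition bilinearity_relators ::
  "('k, 'm) ring_scheme \<Rightarrow> ('k, 'v) module \<Rightarrow> ('k, 'w) module \<Rightarrow> ('v \<times> 'w \<Rightarrow> 'k) set" where
  "bilinearity_relators K V W = (let F = tensor_free K V W; e = basis_vec K in
     {e (x \<oplus>\<^bsub>V\<^esub> y, w) \<ominus>\<^bsub>F\<^esub> (e (x, w) \<oplus>\<^bsub>F\<^esub> e (y, w)) | x y w.
        x \<in> carrier V \<and> y \<in> carrier V \<and> w \<in> carrier W} \<union>
     {e (v, x \<oplus>\<^bsub>W\<^esub> y) \<ominus>\<^bsub>F\<^esub> (e (v, x) \<oplus>\<^bsub>F\<^esub> e (v, y)) | v x y.
        v \<in> carrier V \<and> x \<in> carrier W \<and> y \<in> carrier W} \<union>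
     {e (a \<odot>\<^bsub>V\<^esub> v, w) \<ominus>\<^bsub>F\<^esub> (a \<odot>\<^bsub>F\<^esub> e (v, w)) | a v w.
        a \<in> carrier K \<and> v \<in> carrier V \<and> w \<in> carrier W} \<union>
     {e (v, a \<odot>\<^bsub>W\<^esub> w) \<ominus>\<^bsub>F\<^esub> (a \<odot>\<^bsub>F\<^esub> e (v, w)) | a v w.
        a \<in> carrier K \<and> v \<in> carrier V \<and> w \<in> carrier W})"

definition tensor_null ::
  "('k, 'm) ring_scheme \<Rightarrow> ('k, 'v) module \<Rightarrow> ('k, 'w) module \<Rightarrow> ('v \<times> 'w \<Rightarrow> 'k) set" where
  "tensor_null K V W = subspace_generated K (tensor_free K V W) (bilinearity_relators K V W)"

type_synonym ('k, 'v, 'w) tensor = "('v \<times> 'w \<Rightarrow> 'k) set"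

definition tensor_space ::
  "('k, 'm) ring_scheme \<Rightarrow> ('k, 'v) module \<Rightarrow> ('k, 'w) module \<Rightarrow> ('k, ('k, 'v, 'w) tensor) module" where
  "tensor_space K V W = quotient_space (tensor_free K V W) (tensor_null K V W)"

definition tens ::
  "('k, 'm) ring_scheme \<Rightarrow> ('k, 'v) module \<Rightarrow> ('k, 'w) module \<Rightarrow> 'v \<Rightarrow> 'w \<Rightarrow> ('k, 'v, 'w) tensor" where
  "tens K V W v w = tensor_null K V W +>\<^bsub>tensor_free K V W\<^esub> basis_vec K (v, w)"

text \<open>\<open>tensor_map K V V' W W' f g\<close> is \<open>f \<otimes> g : V \<otimes> W \<rightarrow> V' \<otimes> W'\<close>.\<close>

definition tensor_map ::
  "('k, 'm) ring_scheme \<Rightarrow> ('k, 'v) module \<Rightarrow> ('k, 'v1) module \<Rightarrow> ('k, 'w) module \<Rightarrow> ('k, 'w1) module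
    \<Rightarrow> ('v \<Rightarrow> 'v1) \<Rightarrow> ('w \<Rightarrow> 'w1) \<Rightarrow> ('k, 'v, 'w) tensor \<Rightarrow> ('k, 'v1, 'w1) tensor" where
  "tensor_map K V V' W W' f g = the_linear K (tensor_space K V W) (tensor_space K V' W')
     (\<lambda>h. \<forall>v \<in> carrier V. \<forall>w \<in> carrier W. h (tens K V W v w) = tens K V' W' (f v) (g w))"

text \<open>The canonical map \<open>K \<otimes> V \<rightarrow> V\<close>.\<close>

definition tensor_lunit ::
  "('k, 'm) ring_scheme \<Rightarrow> ('k, 'v) module \<Rightarrow> ('k, 'k, 'v) tensor \<Rightarrow> 'v" where
  "tensor_lunit K V = the_linear K (tensor_space K (ground_space K) V) V
     (\<lambda>h. \<forall>a \<in> carrier K. \<forall>v \<in> carrier V. h (tens K (ground_space K) V a v) = a \<odot>\<^bsub>V\<^esub> v)"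

text \<open>The canonical map \<open>(U \<otimes> V) \<otimes> W \<rightarrow> U \<otimes> (V \<otimes> W)\<close>.\<close>

definition tensor_assoc ::
  "('k, 'm) ring_scheme \<Rightarrow> ('k, 'u) module \<Rightarrow> ('k, 'v) module \<Rightarrow> ('k, 'w) module
    \<Rightarrow> ('k, ('k, 'u, 'v) tensor, 'w) tensor \<Rightarrow> ('k, 'u, ('k, 'v, 'w) tensor) tensor" where
  "tensor_assoc K U V W =
     the_linear K (tensor_space K (tensor_space K U V) W) (tensor_space K U (tensor_space K V W))
       (\<lambda>h. \<forall>u \<in> carrier U. \<forall>v \<in> carrier V. \<forall>w \<in> carrier W.
          h (tens K (tensor_space K U V) W (tens K U V u v) w) =
          tens K U (tensor_space K V W) u (tens K V W v w))"

text \<open>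
  \<open>id \<otimes> s \<otimes> id\<close>, where \<open>s\<close> permutes the two middle factors, with the bracketing in which it
  is needed: \<open>(U \<otimes> V) \<otimes> (V' \<otimes> W) \<rightarrow> (U \<otimes> V') \<otimes> (V \<otimes> W)\<close>.
\<close>

definition tensor_middle_swap ::
  "('k, 'm) ring_scheme \<Rightarrow> ('k, 'u) module \<Rightarrow> ('k, 'v) module \<Rightarrow> ('k, 'v1) module \<Rightarrow> ('k, 'w) module
    \<Rightarrow> ('k, ('k, 'u, 'v) tensor, ('k, 'v1, 'w) tensor) tensor
    \<Rightarrow> ('k, ('k, 'u, 'v1) tensor, ('k, 'v, 'w) tensor) tensor" where
  "tensor_middle_swap K U V V' W =
     the_linear K
       (tensor_space K (tensor_space K U V) (tensor_space K V' W))
       (tensor_space K (tensor_space K U V') (tensor_space K V W))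
       (\<lambda>h. \<forall>u \<in> carrier U. \<forall>v \<in> carrier V. \<forall>v' \<in> carrier V'. \<forall>w \<in> carrier W.
          h (tens K (tensor_space K U V) (tensor_space K V' W) (tens K U V u v) (tens K V' W v' w)) =
          tens K (tensor_space K U V') (tensor_space K V W) (tens K U V' u v') (tens K V W v w))"


section \<open>Hopf modules\<close>

text \<open>The structure maps of a Hopf algebra that enter the notion of a Hopf module.\<close>

record ('k, 'h) hopf_structure =
  hspace :: "('k, 'h) module"
  hmult :: "('k, 'h, 'h) tensor \<Rightarrow> 'h"
  hunit :: 'h
  hcomult :: "'h \<Rightarrow> ('k, 'h, 'h) tensor"
  hcounit :: "'h \<Rightarrow> 'k"

definition left_module_structure ::
  "('k, 'm) ring_scheme \<Rightarrow> ('k, 'h) hopf_structure \<Rightarrow> ('k, 'v) module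
    \<Rightarrow> (('k, 'h, 'v) tensor \<Rightarrow> 'v) \<Rightarrow> bool" where
  "left_module_structure K H V m \<longleftrightarrow> (let A = hspace H in
     module K V \<and>
     m \<in> linear_maps K (tensor_space K A V) V \<and>
     (\<forall>v \<in> carrier V. m (tens K A V (hunit H) v) = v) \<and>
     (\<forall>a \<in> carrier A. \<forall>b \<in> carrier A. \<forall>v \<in> carrier V.
        m (tens K A V (hmult H (tens K A A a b)) v) = m (tens K A V a (m (tens K A V b v)))))"

definition left_comodule_structure ::
  "('k, 'm) ring_scheme \<Rightarrow> ('k, 'h) hopf_structure \<Rightarrow> ('k, 'v) module
    \<Rightarrow> ('v \<Rightarrow> ('k, 'h, 'v) tensor) \<Rightarrow> bool" where
  "left_comodule_structure K H V \<delta> \<longleftrightarrow> (let A = hspace H in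
     module K V \<and>
     \<delta> \<in> linear_maps K V (tensor_space K A V) \<and>
     (\<forall>v \<in> carrier V.
        tensor_map K A A V (tensor_space K A V) (id_map A) \<delta> (\<delta> v) =
        tensor_assoc K A A V
          (tensor_map K A (tensor_space K A A) V V (hcomult H) (id_map V) (\<delta> v))) \<and>
     (\<forall>v \<in> carrier V.
        tensor_lunit K V (tensor_map K A (ground_space K) V V (hcounit H) (id_map V) (\<delta> v)) = v))"

text \<open>
  The \<open>H\<close>-module structure
  \<open>(m\<^sub>H \<otimes> m\<^sub>V) \<circ> (id \<otimes> s \<otimes> id) \<circ> (\<Delta>\<^sub>H \<otimes> id) : H \<otimes> (H \<otimes> V) \<rightarrow> H \<otimes> V\<close>.
\<close>

definition diagonal_action ::
  "('k, 'm) ring_scheme \<Rightarrow> ('k, 'h) hopf_structure \<Rightarrow> ('k, 'v) module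
    \<Rightarrow> (('k, 'h, 'v) tensor \<Rightarrow> 'v)
    \<Rightarrow> ('k, 'h, ('k, 'h, 'v) tensor) tensor \<Rightarrow> ('k, 'h, 'v) tensor" where
  "diagonal_action K H V m t = (let A = hspace H; AA = tensor_space K A A; AV = tensor_space K A V in
     tensor_map K AA A AV V (hmult H) m
           (tensor_middle_swap K A A A V
             (tensor_map K A AA AV AV (hcomult H) (id_map AV) t)))"

definition left_hopf_module ::
  "('k, 'm) ring_scheme \<Rightarrow> ('k, 'h) hopf_structure \<Rightarrow> ('k, 'v) module
    \<Rightarrow> (('k, 'h, 'v) tensor \<Rightarrow> 'v) \<Rightarrow> ('v \<Rightarrow> ('k, 'h, 'v) tensor) \<Rightarrow> bool" where
  "left_hopf_module K H V m \<delta> \<longleftrightarrow> (let A = hspace H; AV = tensor_space K A V in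
     left_module_structure K H V m \<and>
     left_comodule_structure K H V \<delta> \<and>
     (\<forall>h \<in> carrier A. \<forall>v \<in> carrier V.
        \<delta> (m (tens K A V h v)) = diagonal_action K H V m (tens K A AV h (\<delta> v))))"


section \<open>Framed chord diagrams\<close>

text \<open>
  A chord carries a label and its framing (\<open>0\<close>: oriented, \<open>1\<close>: disorienting). Cutting the
  oriented circle at a point that is not a chord endpoint and listing the chords in the order in
  which their endpoints are met turns a framed chord diagram into a word in which every chord that
  occurs does so exactly twice. Two words describe the same diagram up to orientation preserving
  diffeomorphism iff they differ by a rotation (another cutting point) and a framing preserving
  relabelling of the chords.
\<close>

type_synonym chord = "nat \<times> bit"

definition chord_word :: "chord list \<Rightarrow> bool" where
  "chord_word w \<longleftrightarrow> (\<forall>x \<in> set w. count_list w x = 2)"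

definition same_diagram :: "chord list \<Rightarrow> chord list \<Rightarrow> bool" where
  "same_diagram w w' \<longleftrightarrow> chord_word w \<and> chord_word w' \<and>
     (\<exists>n \<sigma>. inj_on \<sigma> (set w) \<and> (\<forall>x \<in> set w. snd (\<sigma> x) = snd x) \<and> w' = map \<sigma> (rotate n w))"

lemma same_diagram_refl: "chord_word w \<Longrightarrow> same_diagram w w"
  unfolding same_diagram_def by (auto intro!: exI[of _ 0] exI[of _ id])

lemma same_diagram_sym:
  assumes "same_diagram w w'"
  shows "same_diagram w' w"
proof -
  from assms obtain n \<sigma> where cw: "chord_word w" "chord_word w'"
    and s: "inj_on \<sigma> (set w)" "\<forall>x \<in> set w. snd (\<sigma> x) = snd x" and w': "w' = map \<sigma> (rotate n w)"
    unfolding same_diagram_def by blast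
  define \<tau> where "\<tau> = the_inv_into (set w) \<sigma>"
  have set': "set w' = \<sigma> ` set w" by (simp add: w')
  have \<tau>: "\<tau> (\<sigma> x) = x" if "x \<in> set w" for x
    using s(1) that by (simp add: \<tau>_def the_inv_into_f_f)
  have unmap: "map \<tau> w' = rotate n w"
    unfolding w' map_map by (rule map_idI) (simp add: \<tau>)
  obtain k where k: "rotate (k + n) w = w"
  proof (cases "w = []")
    case False
    then have "(n * length w - n) + n = n * length w" by (cases w) auto
    then have "rotate ((n * length w - n) + n) w = w"
      by (metis mod_mult_self2_is_0 rotate_conv_mod rotate0 id_apply)
    then show ?thesis by (rule that)
  qed (use that[of 0] in auto)
  have "map \<tau> (rotate k w') = rotate k (rotate n w)"
    by (simp add: rotate_map unmap[symmetric])
  also have "\<dots> = rotate (k + n) w" by (simp add: rotate_rotate)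
  also have "\<dots> = w" by (rule k)
  finally have "w = map \<tau> (rotate k w')" by simp
  moreover have "inj_on \<tau> (set w')"
    unfolding set' by (rule inj_on_inverseI[of _ \<sigma>]) (metis \<tau> imageE)
  moreover have "\<forall>x \<in> set w'. snd (\<tau> x) = snd x"
    unfolding set' using s(2) by (metis \<tau> imageE)
  ultimately show ?thesis unfolding same_diagram_def using cw by blast
qed

lemma same_diagram_trans:
  assumes "same_diagram u v" "same_diagram v w"
  shows "same_diagram u w"
proof -
  from assms obtain n \<sigma> k \<tau> where cw: "chord_word u" "chord_word w"
    and s: "inj_on \<sigma> (set u)" "\<forall>x \<in> set u. snd (\<sigma> x) = snd x" and v: "v = map \<sigma> (rotate n u)"
    and t: "inj_on \<tau> (set v)" "\<forall>x \<in> set v. snd (\<tau> x) = snd x" and w: "w = map \<tau> (rotate k v)"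
    unfolding same_diagram_def by blast
  have set_v: "set v = \<sigma> ` set u" by (simp add: v)
  have "w = map (\<tau> \<circ> \<sigma>) (rotate (k + n) u)"
    unfolding w v by (simp add: rotate_map rotate_rotate)
  moreover have "inj_on (\<tau> \<circ> \<sigma>) (set u)"
    using s(1) t(1) by (auto simp: set_v intro: comp_inj_on)
  moreover have "\<forall>x \<in> set u. snd ((\<tau> \<circ> \<sigma>) x) = snd x"
    using s(2) t(2) by (auto simp: set_v)
  ultimately show ?thesis unfolding same_diagram_def using cw by blast
qed

quotient_type diagram = "chord list" / partial: same_diagram
  morphisms rep_diagram diagram_of
proof (rule part_equivpI)
  have "same_diagram [] []" by (simp add: same_diagram_refl chord_word_def)
  then show "\<exists>w. same_diagram w w" ..
  show "symp same_diagram" by (rule sympI) (rule same_diagram_sym)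
  show "transp same_diagram" by (rule transpI) (rule same_diagram_trans)
qed

definition black_word :: "chord list \<Rightarrow> bool" where
  "black_word w \<longleftrightarrow> (\<forall>x \<in> set w. snd x = 0)"

lift_definition black :: "diagram \<Rightarrow> bool" is black_word
  unfolding same_diagram_def black_word_def by (auto simp del: split_paired_All) (metis snd_conv)+

text \<open>The subdiagram formed by the chords in \<open>I\<close>.\<close>

definition subword :: "chord set \<Rightarrow> chord list \<Rightarrow> chord list" where
  "subword I w = filter (\<lambda>x. x \<in> I) w"


section \<open>The 4T-relations\<close>

text \<open>
  Cut the circle at the fixed endpoint \<open>r\<close> of the jumping chord \<open>u\<close>. The other chords then read
  \<open>a @ v # b @ v # c\<close>, where the first \<open>v\<close> is the endpoint \<open>p\<close> and the second one is \<open>q\<close>. Naming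
  the endpoints of \<open>v\<close> in the opposite order gives the same set of relations: for \<open>v\<close> oriented the two
  relations coincide, for \<open>v\<close> disorienting they are exchanged when \<open>\<phi>\<close> is replaced by \<open>\<phi> + 1\<close>.
\<close>

datatype jump_place = Before_p | After_p | Before_q | After_q

fun jump_word :: "chord list \<Rightarrow> chord list \<Rightarrow> chord list \<Rightarrow> chord \<Rightarrow> chord \<Rightarrow> jump_place \<Rightarrow> chord list" where
  "jump_word a b c v u Before_p = u # a @ [u, v] @ b @ [v] @ c"
| "jump_word a b c v u After_p  = u # a @ [v, u] @ b @ [v] @ c"
| "jump_word a b c v u Before_q = u # a @ [v] @ b @ [u, v] @ c"
| "jump_word a b c v u After_q  = u # a @ [v] @ b @ [v, u] @ c"

text \<open>\<open>k\<close> is the label of the jumping chord, whose framing varies.\<close>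

definition jump_config :: "chord list \<Rightarrow> chord list \<Rightarrow> chord list \<Rightarrow> chord \<Rightarrow> nat \<Rightarrow> bool" where
  "jump_config a b c v k \<longleftrightarrow>
     chord_word (a @ [v] @ b @ [v] @ c) \<and> k \<notin> fst ` set (a @ [v] @ b @ [v] @ c)"

definition framed_diagram_space :: "('k, 'm) ring_scheme \<Rightarrow> ('k, diagram \<Rightarrow> 'k) module" where
  "framed_diagram_space K = free_space K UNIV"

definition black_diagram_space :: "('k, 'm) ring_scheme \<Rightarrow> ('k, diagram \<Rightarrow> 'k) module" where
  "black_diagram_space K = free_space K {d. black d}"

definition framed_4T_relators :: "('k, 'm) ring_scheme \<Rightarrow> (diagram \<Rightarrow> 'k) set" where
  "framed_4T_relators K =
     (let F = framed_diagram_space K;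
          D = (\<lambda>a b c v k \<phi> x. basis_vec K (diagram_of (jump_word a b c v (k, \<phi>) x))) in
     {(D a b c v k \<phi> Before_p \<ominus>\<^bsub>F\<^esub> D a b c v k \<phi> After_p) \<ominus>\<^bsub>F\<^esub>
      (D a b c v k \<phi> After_q \<ominus>\<^bsub>F\<^esub> D a b c v k \<phi> Before_q) | a b c v k \<phi>.
        jump_config a b c v k \<and> snd v = 0} \<union>
     {(D a b c v k \<phi> Before_p \<ominus>\<^bsub>F\<^esub> D a b c v k \<phi> After_p) \<ominus>\<^bsub>F\<^esub>
      (D a b c v k (\<phi> + 1) Before_q \<ominus>\<^bsub>F\<^esub> D a b c v k (\<phi> + 1) After_q) | a b c v k \<phi>.
        jump_config a b c v k \<and> snd v = 1})"

definition ordinary_4T_relators :: "('k, 'm) ring_scheme \<Rightarrow> (diagram \<Rightarrow> 'k) set" where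
  "ordinary_4T_relators K =
     (let F = black_diagram_space K;
          D = (\<lambda>a b c v k x. basis_vec K (diagram_of (jump_word a b c v (k, 0) x))) in
     {(D a b c v k Before_p \<ominus>\<^bsub>F\<^esub> D a b c v k After_p) \<ominus>\<^bsub>F\<^esub>
      (D a b c v k After_q \<ominus>\<^bsub>F\<^esub> D a b c v k Before_q) | a b c v k.
        jump_config a b c v k \<and> black_word (a @ [v] @ b @ [v] @ c)})"


section \<open>The spaces \<open>\<M>\<close> and \<open>\<A>\<close> and their structure maps\<close>

type_synonym 'k diagram_class = "(diagram \<Rightarrow> 'k) set"

definition framed_null :: "('k, 'm) ring_scheme \<Rightarrow> 'k diagram_class" where
  "framed_null K = subspace_generated K (framed_diagram_space K) (framed_4T_relators K)"

definition M_space :: "('k, 'm) ring_scheme \<Rightarrow> ('k, 'k diagram_class) module" where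
  "M_space K = quotient_space (framed_diagram_space K) (framed_null K)"

definition M_class :: "('k, 'm) ring_scheme \<Rightarrow> chord list \<Rightarrow> 'k diagram_class" where
  "M_class K w = framed_null K +>\<^bsub>framed_diagram_space K\<^esub> basis_vec K (diagram_of w)"

definition black_null :: "('k, 'm) ring_scheme \<Rightarrow> 'k diagram_class" where
  "black_null K = subspace_generated K (black_diagram_space K) (ordinary_4T_relators K)"

definition A_space :: "('k, 'm) ring_scheme \<Rightarrow> ('k, 'k diagram_class) module" where
  "A_space K = quotient_space (black_diagram_space K) (black_null K)"

definition A_class :: "('k, 'm) ring_scheme \<Rightarrow> chord list \<Rightarrow> 'k diagram_class" where
  "A_class K w = black_null K +>\<^bsub>black_diagram_space K\<^esub> basis_vec K (diagram_of w)"

text \<open>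
  The glued diagram of two words with no common chord is their concatenation. The
  specifications below range over all words representing the diagrams, that is over all choices
  of the cutting points.
\<close>

definition A_mult ::
  "('k, 'm) ring_scheme \<Rightarrow> ('k, 'k diagram_class, 'k diagram_class) tensor \<Rightarrow> 'k diagram_class" where
  "A_mult K = the_linear K (tensor_space K (A_space K) (A_space K)) (A_space K)
     (\<lambda>f. \<forall>c d. chord_word c \<and> black_word c \<and> chord_word d \<and> black_word d \<and> set c \<inter> set d = {} \<longrightarrow>
        f (tens K (A_space K) (A_space K) (A_class K c) (A_class K d)) = A_class K (c @ d))"

definition A_comult ::
  "('k, 'm) ring_scheme \<Rightarrow> 'k diagram_class \<Rightarrow> ('k, 'k diagram_class, 'k diagram_class) tensor" where
  "A_comult K = (let A = A_space K in the_linear K A (tensor_space K A A)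
     (\<lambda>f. \<forall>w. chord_word w \<and> black_word w \<longrightarrow>
        f (A_class K w) = (\<Oplus>\<^bsub>tensor_space K A A\<^esub> I \<in> Pow (set w).
          tens K A A (A_class K (subword I w)) (A_class K (subword (set w - I) w)))))"

definition A_counit :: "('k, 'm) ring_scheme \<Rightarrow> 'k diagram_class \<Rightarrow> 'k" where
  "A_counit K = the_linear K (A_space K) (ground_space K)
     (\<lambda>f. \<forall>w. chord_word w \<and> black_word w \<longrightarrow>
        f (A_class K w) = (if w = [] then \<one>\<^bsub>K\<^esub> else \<zero>\<^bsub>K\<^esub>))"

definition A_hopf :: "('k, 'm) ring_scheme \<Rightarrow> ('k, 'k diagram_class) hopf_structure" where
  "A_hopf K = \<lparr>hspace = A_space K, hmult = A_mult K, hunit = A_class K [],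
     hcomult = A_comult K, hcounit = A_counit K\<rparr>"

definition M_mult ::
  "('k, 'm) ring_scheme \<Rightarrow> ('k, 'k diagram_class, 'k diagram_class) tensor \<Rightarrow> 'k diagram_class" where
  "M_mult K = the_linear K (tensor_space K (A_space K) (M_space K)) (M_space K)
     (\<lambda>f. \<forall>c d. chord_word c \<and> black_word c \<and> chord_word d \<and> set c \<inter> set d = {} \<longrightarrow>
        f (tens K (A_space K) (M_space K) (A_class K c) (M_class K d)) = M_class K (c @ d))"

definition M_comult ::
  "('k, 'm) ring_scheme \<Rightarrow> 'k diagram_class \<Rightarrow> ('k, 'k diagram_class, 'k diagram_class) tensor" where
  "M_comult K = (let M = M_space K in the_linear K M (tensor_space K M M)
     (\<lambda>f. \<forall>w. chord_word w \<longrightarrow>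
        f (M_class K w) = (\<Oplus>\<^bsub>tensor_space K M M\<^esub> I \<in> Pow (set w).
          tens K M M (M_class K (subword I w)) (M_class K (subword (set w - I) w)))))"

definition M_Pr :: "('k, 'm) ring_scheme \<Rightarrow> 'k diagram_class \<Rightarrow> 'k diagram_class" where
  "M_Pr K = the_linear K (M_space K) (A_space K)
     (\<lambda>f. \<forall>w. chord_word w \<longrightarrow>
        f (M_class K w) = (if black_word w then A_class K w else \<zero>\<^bsub>A_space K\<^esub>))"

definition M_coaction ::
  "('k, 'm) ring_scheme \<Rightarrow> 'k diagram_class \<Rightarrow> ('k, 'k diagram_class, 'k diagram_class) tensor" where
  "M_coaction K = (let A = A_space K; M = M_space K in
     compose (carrier M) (tensor_map K M A M M (M_Pr K) (id_map M)) (M_comult K))"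

end

theory Submission
  imports Defs
begin

text \<open>
  All spaces involved are given by generators and relations, so linear maps are specified on words
  and only have to respect rotation, relabelling and the 4T-relations. The product of a black word
  \<open>c\<close> with a framed word \<open>d\<close> does not depend on the cutting points because any chord
  endpoint \<open>x\<close> can be moved across all of \<open>c\<close>: it passes both endpoints of every oriented chord \<open>v\<close> of \<open>c\<close>, and
  the 4T-relation for \<open>v\<close> says that these two steps cancel. In the coproduct of a 4T-relation, a
  splitting that separates the jumping chord from \<open>v\<close> contributes nothing and any other splitting
  contributes a 4T-relation in one tensor factor. The structure maps of \<open>\<A>\<close> are obtained from those
  of \<open>\<M>\<close>, of which \<open>\<A>\<close> is a retract through \<open>Pr\<close>. On words, the Hopf module axioms reduce to
  reindexing sums over subsets of chords.
\<close>

section \<open>Linear maps\<close>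

text \<open>Every structure map is a definite description over extensional linear maps, so nothing
  is known about its values until one linear map with the prescribed values has been built and shown
  to be the only one. Hence the recurring pattern: a lifting lemma for existence, an extensionality
  lemma for uniqueness, and afterwards only linearity and values on generators are quoted.

  The specifications of the products prescribe values only on pairs of words without common chords,
  and such a condition cannot be met one factor at a time. Existence therefore goes through a
  product defined on all pairs, with the two words relabelled apart, whereas uniqueness rests on the
  fact that a diagram has representatives avoiding any given finite set of chords.

  A second obstacle is that a subdiagram of a framed diagram may or may not be black, while classes
  in \<open>\<A>\<close> make sense only for black words. Formulas with values in
  \<open>\<A>\<close> are therefore stated with \<open>prA\<close>, which is zero on the other
  words; they then hold without case distinctions, which is what the sums over all subsets of chords
  require.\<close>

locale lin_map =
  fixes K :: "('k, 'm) ring_scheme" and V :: "('k, 'v) module" and W :: "('k, 'w) module" and f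
  assumes dom: "module K V" and cod: "module K W"
    and closed: "x \<in> carrier V \<Longrightarrow> f x \<in> carrier W"
    and add: "x \<in> carrier V \<Longrightarrow> y \<in> carrier V \<Longrightarrow> f (x \<oplus>\<^bsub>V\<^esub> y) = f x \<oplus>\<^bsub>W\<^esub> f y"
    and smult: "a \<in> carrier K \<Longrightarrow> x \<in> carrier V \<Longrightarrow> f (a \<odot>\<^bsub>V\<^esub> x) = a \<odot>\<^bsub>W\<^esub> f x"
begin

sublocale V: module K V by (rule dom)
sublocale W: module K W by (rule cod)

lemma map_zero: "f \<zero>\<^bsub>V\<^esub> = \<zero>\<^bsub>W\<^esub>"
proof -
  have "f (\<zero>\<^bsub>K\<^esub> \<odot>\<^bsub>V\<^esub> \<zero>\<^bsub>V\<^esub>) = \<zero>\<^bsub>K\<^esub> \<odot>\<^bsub>W\<^esub> f \<zero>\<^bsub>V\<^esub>" by (rule smult) auto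
  then show ?thesis by (simp add: closed)
qed

lemma map_minus:
  assumes "x \<in> carrier V" "y \<in> carrier V"
  shows "f (x \<ominus>\<^bsub>V\<^esub> y) = f x \<ominus>\<^bsub>W\<^esub> f y"
proof -
  have "f (\<ominus>\<^bsub>V\<^esub> y) \<oplus>\<^bsub>W\<^esub> f y = \<zero>\<^bsub>W\<^esub>"
    using assms by (simp flip: add add: V.M.l_neg map_zero)
  then have "\<ominus>\<^bsub>W\<^esub> f y = f (\<ominus>\<^bsub>V\<^esub> y)"
    using assms by (intro W.M.minus_equality) (auto simp: closed)
  then show ?thesis using assms by (simp add: a_minus_def add)
qed

lemma map_finsum:
  assumes "finite S" "g \<in> S \<rightarrow> carrier V"
  shows "f (\<Oplus>\<^bsub>V\<^esub>i\<in>S. g i) = (\<Oplus>\<^bsub>W\<^esub>i\<in>S. f (g i))"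
  using assms by (induction S) (simp_all add: map_zero add Pi_def closed)

lemma restrict_linear_maps: "restrict f (carrier V) \<in> linear_maps K V W"
  unfolding linear_maps_def by (auto simp: closed add smult)

end

lemma linear_mapsD:
  assumes "module K V" "module K W" "f \<in> linear_maps K V W"
  shows "lin_map K V W f"
  using assms unfolding linear_maps_def by (intro lin_map.intro) auto

lemma linear_maps_eqI:
  assumes "f \<in> linear_maps K V W" "g \<in> linear_maps K V W" "\<And>x. x \<in> carrier V \<Longrightarrow> f x = g x"
  shows "f = g"
  using assms unfolding linear_maps_def by (auto intro: PiE_ext)

lemma lin_map_id: "module K V \<Longrightarrow> lin_map K V V (id_map V)"
  unfolding id_map_def
  by (simp add: lin_map_def module.smult_closed abelian_monoid.a_closed module.axioms abelian_group.axioms)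

lemma lin_map_comp:
  assumes "lin_map K U V f" "lin_map K V W g"
  shows "lin_map K U W (\<lambda>x. g (f x))"
  using assms by (simp add: lin_map_def)

lemma lin_map_cong:
  assumes f: "lin_map K V W f" and eq: "\<And>x. x \<in> carrier V \<Longrightarrow> f x = g x"
  shows "lin_map K V W g"
proof -
  interpret f: lin_map K V W f by (rule f)
  show ?thesis
    by unfold_locales (auto simp flip: eq simp: f.closed f.add f.smult)
qed

lemma lin_map_zero:
  assumes "module K V" "module K W"
  shows "lin_map K V W (\<lambda>x. \<zero>\<^bsub>W\<^esub>)"
proof -
  interpret V: module K V by fact
  interpret W: module K W by fact
  show ?thesis by unfold_locales auto
qed

text \<open>Pointwise sums and multiples serve to prove linearity in a parameter: both sides of
  \<open>h (w + w') t = h w t + h w' t\<close> are then linear in \<open>t\<close>, and an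
  extensionality lemma reduces the equation to generators.\<close>

lemma lin_map_add:
  assumes "lin_map K V W f" "lin_map K V W g"
  shows "lin_map K V W (\<lambda>x. f x \<oplus>\<^bsub>W\<^esub> g x)"
proof -
  interpret f: lin_map K V W f by fact
  interpret g: lin_map K V W g by fact
  show ?thesis
    by unfold_locales
      (auto simp: f.closed g.closed f.add g.add f.smult g.smult f.W.smult_r_distr f.W.M.a_ac)
qed

lemma lin_map_smult:
  assumes "lin_map K V W f" and a: "a \<in> carrier K"
  shows "lin_map K V W (\<lambda>x. a \<odot>\<^bsub>W\<^esub> f x)"
proof -
  interpret f: lin_map K V W f by fact
  show ?thesis
    using a by unfold_locales
      (auto simp: f.closed f.add f.smult f.W.smult_r_distr f.V.m_comm simp flip: f.W.smult_assoc1)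
qed

text \<open>The only candidate for the description is the restriction of \<open>h\<close>, because
  members of \<open>linear_maps\<close> are extensional; this is why \<open>P\<close> is tested on
  the restriction, while uniqueness is asked only on the carrier.\<close>

lemma the_linear_eq:
  assumes h: "lin_map K V W h" and P: "P (restrict h (carrier V))"
    and uniq: "\<And>f x. \<lbrakk>lin_map K V W f; P f; x \<in> carrier V\<rbrakk> \<Longrightarrow> f x = h x"
  shows "the_linear K V W P = restrict h (carrier V)"
  unfolding the_linear_def
proof (rule the_equality)
  interpret h: lin_map K V W h by (rule h)
  show "restrict h (carrier V) \<in> linear_maps K V W \<and> P (restrict h (carrier V))"
    using h.restrict_linear_maps P by simp
  fix f assume f: "f \<in> linear_maps K V W \<and> P f"
  show "f = restrict h (carrier V)"
  proof (rule linear_maps_eqI)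
    show "f \<in> linear_maps K V W" using f by simp
    show "restrict h (carrier V) \<in> linear_maps K V W" by (rule h.restrict_linear_maps)
    show "f x = restrict h (carrier V) x" if "x \<in> carrier V" for x
      using uniq[of f x] linear_mapsD[OF h.dom h.cod, of f] f that by simp
  qed
qed

lemma lin_map_restrict: "lin_map K V W h \<Longrightarrow> lin_map K V W (restrict h (carrier V))"
  by (rule lin_map_cong) simp_all


section \<open>Free modules, quotients and presentations\<close>

lemma module_ground_space: "cring K \<Longrightarrow> module K (ground_space K)"
proof -
  assume "cring K"
  then interpret cring K .
  show ?thesis
    by (rule moduleI, unfold_locales)
      (auto simp: ground_space_def Units_def intro!: add.m_assoc l_distr r_distr m_assoc a_comm
        bexI[of _ "\<ominus>\<^bsub>K\<^esub> _"] l_neg r_neg)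
qed

section \<open>Free vector spaces on a set\<close>

lemma free_space_simps [simp]:
  "zero (free_space K X) = (\<lambda>x. \<zero>\<^bsub>K\<^esub>)"
  "add (free_space K X) = (\<lambda>f g x. f x \<oplus>\<^bsub>K\<^esub> g x)"
  "smult (free_space K X) = (\<lambda>a f x. a \<otimes>\<^bsub>K\<^esub> f x)"
  by (simp_all add: free_space_def)

lemma free_space_carrier:
  "f \<in> carrier (free_space K X) \<longleftrightarrow> (\<forall>x. f x \<in> carrier K) \<and> (\<forall>x. x \<notin> X \<longrightarrow> f x = \<zero>\<^bsub>K\<^esub>)
    \<and> finite {x. f x \<noteq> \<zero>\<^bsub>K\<^esub>}"
  by (simp add: free_space_def)

lemma module_free_space:
  assumes "cring K"
  shows "module K (free_space K X)"
proof -
  interpret cring K by fact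
  have add: "(\<lambda>x. f x \<oplus>\<^bsub>K\<^esub> g x) \<in> carrier (free_space K X)"
    if "f \<in> carrier (free_space K X)" "g \<in> carrier (free_space K X)" for f g
    using that finite_subset[of "{x. f x \<oplus>\<^bsub>K\<^esub> g x \<noteq> \<zero>\<^bsub>K\<^esub>}" "{x. f x \<noteq> \<zero>\<^bsub>K\<^esub>} \<union> {x. g x \<noteq> \<zero>\<^bsub>K\<^esub>}"]
    by (force simp: free_space_carrier)
  have smult: "(\<lambda>x. a \<otimes>\<^bsub>K\<^esub> f x) \<in> carrier (free_space K X)"
    if "a \<in> carrier K" "f \<in> carrier (free_space K X)" for a f
    using that finite_subset[of "{x. a \<otimes>\<^bsub>K\<^esub> f x \<noteq> \<zero>\<^bsub>K\<^esub>}" "{x. f x \<noteq> \<zero>\<^bsub>K\<^esub>}"]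
    by (force simp: free_space_carrier)
  \<comment> \<open>The inverse is taken as the multiple by -1, so that its finite support comes
    from \<open>smult\<close>.\<close>
  have neg: "\<exists>g\<in>carrier (free_space K X). (\<lambda>x. g x \<oplus>\<^bsub>K\<^esub> f x) = (\<lambda>x. \<zero>\<^bsub>K\<^esub>)"
    if "f \<in> carrier (free_space K X)" for f
    using that smult[of "\<ominus>\<^bsub>K\<^esub> \<one>\<^bsub>K\<^esub>" f]
    by (intro bexI[of _ "\<lambda>x. \<ominus>\<^bsub>K\<^esub> \<one>\<^bsub>K\<^esub> \<otimes>\<^bsub>K\<^esub> f x"]) (auto simp: free_space_carrier l_minus l_neg)
  show ?thesis
    by (rule moduleI[OF is_cring], rule abelian_groupI)
      (use add smult neg in \<open>auto simp: free_space_carrier l_distr r_distr m_assoc a_ac\<close>)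
qed

lemma basis_vec_carrier [simp]:
  assumes "cring K" "x \<in> X"
  shows "basis_vec K x \<in> carrier (free_space K X)"
proof -
  interpret cring K by fact
  show ?thesis using \<open>x \<in> X\<close> finite_subset[of "{y. basis_vec K x y \<noteq> \<zero>\<^bsub>K\<^esub>}" "{x}"]
    by (auto simp: free_space_carrier basis_vec_def)
qed

lemma free_space_induct:
  assumes K: "cring K" and f: "f \<in> carrier (free_space K X)"
    and zero: "P (\<lambda>x. \<zero>\<^bsub>K\<^esub>)"
    and add: "\<And>a x g. \<lbrakk>a \<in> carrier K; x \<in> X; g \<in> carrier (free_space K X); P g\<rbrakk>
      \<Longrightarrow> P (a \<odot>\<^bsub>free_space K X\<^esub> basis_vec K x \<oplus>\<^bsub>free_space K X\<^esub> g)"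
  shows "P f"
proof -
  interpret cring K by fact
  \<comment> \<open>The induction runs over a finite set containing the support rather than over the
    support itself: clearing the value at the new point makes the hypothesis applicable even if that
    value was zero already.\<close>
  have "P f" if "finite S" "{x. f x \<noteq> \<zero>\<^bsub>K\<^esub>} \<subseteq> S" "f \<in> carrier (free_space K X)" for S f
    using that
  proof (induction S arbitrary: f)
    case empty
    then have "f = (\<lambda>x. \<zero>\<^bsub>K\<^esub>)" by auto
    then show ?case using zero by simp
  next
    case (insert x S)
    define g where "g = f(x := \<zero>\<^bsub>K\<^esub>)"
    have "{x. g x \<noteq> \<zero>\<^bsub>K\<^esub>} \<subseteq> {x. f x \<noteq> \<zero>\<^bsub>K\<^esub>}" by (auto simp: g_def)
    then have "finite {x. g x \<noteq> \<zero>\<^bsub>K\<^esub>}"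
      using insert.prems(2) by (auto simp: free_space_carrier intro: finite_subset)
    then have g: "g \<in> carrier (free_space K X)"
      using insert.prems(2) by (simp add: free_space_carrier g_def)
    have Pg: "P g"
      by (rule insert.IH[OF _ g]) (use insert.prems in \<open>auto simp: g_def\<close>)
    show ?case
    proof (cases "x \<in> X")
      case True
      have "f = f x \<odot>\<^bsub>free_space K X\<^esub> basis_vec K x \<oplus>\<^bsub>free_space K X\<^esub> g"
        using insert.prems(2) by (auto simp: g_def free_space_carrier basis_vec_def)
      then show ?thesis
        using add[OF _ True g Pg, of "f x"] insert.prems(2) by (simp add: free_space_carrier)
    next
      case False
      then have "f = g" using insert.prems(2) by (auto simp: g_def free_space_carrier)
      then show ?thesis using Pg by simp
    qed
  qed
  then show ?thesis using f by (auto simp: free_space_carrier)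
qed

lemma free_space_lift:
  assumes K: "cring K" and W: "module K W" and g: "\<And>x. x \<in> X \<Longrightarrow> g x \<in> carrier W"
  shows "\<exists>h. lin_map K (free_space K X) W h \<and> (\<forall>x\<in>X. h (basis_vec K x) = g x)"
proof -
  interpret W: module K W by fact
  define h where "h f = (\<Oplus>\<^bsub>W\<^esub>x\<in>{x. f x \<noteq> \<zero>\<^bsub>K\<^esub>}. f x \<odot>\<^bsub>W\<^esub> g x)" for f
  have cl: "f x \<odot>\<^bsub>W\<^esub> g x \<in> carrier W" if "f \<in> carrier (free_space K X)" "x \<in> X" for f x
    using that g by (auto simp: free_space_carrier)
  \<comment> \<open>The supports of two functions, of their sum and of a multiple may all differ
    because values can cancel. Summing over any larger finite set gives the three sums a common
    index set.\<close>
  have h_sup: "h f = (\<Oplus>\<^bsub>W\<^esub>x\<in>S. f x \<odot>\<^bsub>W\<^esub> g x)"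
    if "f \<in> carrier (free_space K X)" "finite S" "{x. f x \<noteq> \<zero>\<^bsub>K\<^esub>} \<subseteq> S" "S \<subseteq> X" for f S
    unfolding h_def using that g
    by (intro W.M.add.finprod_mono_neutral_cong_left) (auto simp: free_space_carrier)
  have supp: "finite {x. f x \<noteq> \<zero>\<^bsub>K\<^esub>}" "{x. f x \<noteq> \<zero>\<^bsub>K\<^esub>} \<subseteq> X" if "f \<in> carrier (free_space K X)" for f
    using that by (auto simp: free_space_carrier)
  interpret F: module K "free_space K X" by (rule module_free_space[OF K])
  have "lin_map K (free_space K X) W h"
  proof unfold_locales
    fix f assume f: "f \<in> carrier (free_space K X)"
    show "h f \<in> carrier W"
      unfolding h_def using cl[OF f] supp(2)[OF f] by (intro W.M.finsum_closed) auto
    fix a assume a: "a \<in> carrier K"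
    have "h (a \<odot>\<^bsub>free_space K X\<^esub> f) =
        (\<Oplus>\<^bsub>W\<^esub>x\<in>{x. f x \<noteq> \<zero>\<^bsub>K\<^esub>}. (a \<odot>\<^bsub>free_space K X\<^esub> f) x \<odot>\<^bsub>W\<^esub> g x)"
      using f a supp[OF f] F.smult_closed[OF a f] by (intro h_sup) auto
    also have "\<dots> = (\<Oplus>\<^bsub>W\<^esub>x\<in>{x. f x \<noteq> \<zero>\<^bsub>K\<^esub>}. a \<odot>\<^bsub>W\<^esub> (f x \<odot>\<^bsub>W\<^esub> g x))"
      using f a supp[OF f] g cl[OF f]
      by (intro W.M.finsum_cong') (auto simp: free_space_carrier W.smult_assoc1 subset_eq)
    also have "\<dots> = a \<odot>\<^bsub>W\<^esub> h f"
      unfolding h_def using f a supp[OF f] g cl[OF f]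
      by (intro W.finsum_smult_ldistr[symmetric]) auto
    finally show "h (a \<odot>\<^bsub>free_space K X\<^esub> f) = a \<odot>\<^bsub>W\<^esub> h f" .
  next
    fix f f' assume f: "f \<in> carrier (free_space K X)" "f' \<in> carrier (free_space K X)"
    let ?S = "{x. f x \<noteq> \<zero>\<^bsub>K\<^esub>} \<union> {x. f' x \<noteq> \<zero>\<^bsub>K\<^esub>}"
    have S: "finite ?S" "?S \<subseteq> X" using supp[OF f(1)] supp[OF f(2)] by auto
    have "h (f \<oplus>\<^bsub>free_space K X\<^esub> f') = (\<Oplus>\<^bsub>W\<^esub>x\<in>?S. (f \<oplus>\<^bsub>free_space K X\<^esub> f') x \<odot>\<^bsub>W\<^esub> g x)"
      by (rule h_sup[OF F.a_closed[OF f] S(1) _ S(2)]) auto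
    also have "\<dots> = (\<Oplus>\<^bsub>W\<^esub>x\<in>?S. f x \<odot>\<^bsub>W\<^esub> g x \<oplus>\<^bsub>W\<^esub> f' x \<odot>\<^bsub>W\<^esub> g x)"
    proof (rule W.M.finsum_cong'[OF refl])
      have "(f \<oplus>\<^bsub>free_space K X\<^esub> f') x \<odot>\<^bsub>W\<^esub> g x = f x \<odot>\<^bsub>W\<^esub> g x \<oplus>\<^bsub>W\<^esub> f' x \<odot>\<^bsub>W\<^esub> g x" if "x \<in> X" for x
        using f g[OF that] by (simp add: free_space_carrier W.smult_l_distr)
      then show "(f \<oplus>\<^bsub>free_space K X\<^esub> f') x \<odot>\<^bsub>W\<^esub> g x = f x \<odot>\<^bsub>W\<^esub> g x \<oplus>\<^bsub>W\<^esub> f' x \<odot>\<^bsub>W\<^esub> g x"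
        if "x \<in> ?S" for x using S(2) that by blast
      show "(\<lambda>x. f x \<odot>\<^bsub>W\<^esub> g x \<oplus>\<^bsub>W\<^esub> f' x \<odot>\<^bsub>W\<^esub> g x) \<in> ?S \<rightarrow> carrier W"
        using cl[OF f(1)] cl[OF f(2)] S(2) by (intro Pi_I W.M.a_closed) blast+
    qed
    also have "\<dots> = (\<Oplus>\<^bsub>W\<^esub>x\<in>?S. f x \<odot>\<^bsub>W\<^esub> g x) \<oplus>\<^bsub>W\<^esub> (\<Oplus>\<^bsub>W\<^esub>x\<in>?S. f' x \<odot>\<^bsub>W\<^esub> g x)"
      using S(2) cl[OF f(1)] cl[OF f(2)] by (intro W.M.finsum_addf Pi_I) blast+
    also have "\<dots> = h f \<oplus>\<^bsub>W\<^esub> h f'"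
      using S f by (simp add: h_sup[of f ?S] h_sup[of f' ?S])
    finally show "h (f \<oplus>\<^bsub>free_space K X\<^esub> f') = h f \<oplus>\<^bsub>W\<^esub> h f'" .
  qed
  moreover have "h (basis_vec K x) = g x" if "x \<in> X" for x
  proof -
    have "h (basis_vec K x) = (\<Oplus>\<^bsub>W\<^esub>y\<in>{x}. basis_vec K x y \<odot>\<^bsub>W\<^esub> g y)"
      by (rule h_sup[OF basis_vec_carrier[OF K that]]) (use that in \<open>auto simp: basis_vec_def\<close>)
    then show ?thesis using g[OF that] by (simp add: basis_vec_def)
  qed
  ultimately show ?thesis by auto
qed

section \<open>Quotients by a subspace\<close>

locale quotient_module = V: module K V
  for K :: "('k, 'm) ring_scheme" and V :: "('k, 'v) module" and N +
  assumes sub: "submodule N K V"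
begin

sublocale N: abelian_subgroup N V
  using sub V.M.abelian_group_axioms
  by (intro abelian_subgroupI3 additive_subgroup.intro) (auto dest: submodule.axioms)

abbreviation "Q \<equiv> quotient_space V N"

lemma carrier_quotient: "carrier Q = (\<lambda>x. N +>\<^bsub>V\<^esub> x) ` carrier V"
  by (auto simp: quotient_space_def A_RCOSETS_def')

lemma zero_quotient: "\<zero>\<^bsub>Q\<^esub> = N +>\<^bsub>V\<^esub> \<zero>\<^bsub>V\<^esub>"
  using N.a_subset by (simp add: quotient_space_def)

lemma add_quotient:
  "x \<in> carrier V \<Longrightarrow> y \<in> carrier V \<Longrightarrow> (N +>\<^bsub>V\<^esub> x) \<oplus>\<^bsub>Q\<^esub> (N +>\<^bsub>V\<^esub> y) = N +>\<^bsub>V\<^esub> (x \<oplus>\<^bsub>V\<^esub> y)"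
  by (simp add: quotient_space_def N.a_rcos_sum)

lemma coset_elem: "x' \<in> N +>\<^bsub>V\<^esub> x \<longleftrightarrow> (\<exists>n\<in>N. x' = n \<oplus>\<^bsub>V\<^esub> x)"
  by (auto simp: a_r_coset_def')

lemma coset_eq: "n \<in> N \<Longrightarrow> x \<in> carrier V \<Longrightarrow> N +>\<^bsub>V\<^esub> (n \<oplus>\<^bsub>V\<^esub> x) = N +>\<^bsub>V\<^esub> x"
  by (metis N.a_Hcarr N.a_repr_independence' V.M.a_closed coset_elem)

text \<open>\<open>quotient_space\<close> forms the union of cosets over all representatives. Since
  \<open>N\<close> is closed under multiples, all these cosets are equal, and the union is just one
  of them.\<close>

lemma smult_quotient:
  assumes "a \<in> carrier K" "x \<in> carrier V"
  shows "a \<odot>\<^bsub>Q\<^esub> (N +>\<^bsub>V\<^esub> x) = N +>\<^bsub>V\<^esub> (a \<odot>\<^bsub>V\<^esub> x)"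
proof -
  have "N +>\<^bsub>V\<^esub> (a \<odot>\<^bsub>V\<^esub> y) = N +>\<^bsub>V\<^esub> (a \<odot>\<^bsub>V\<^esub> x)" if "y \<in> N +>\<^bsub>V\<^esub> x" for y
  proof -
    from that obtain n where n: "n \<in> N" "y = n \<oplus>\<^bsub>V\<^esub> x" by (auto simp: coset_elem)
    then have "a \<odot>\<^bsub>V\<^esub> y = a \<odot>\<^bsub>V\<^esub> n \<oplus>\<^bsub>V\<^esub> a \<odot>\<^bsub>V\<^esub> x"
      using assms by (simp add: V.smult_r_distr)
    then show ?thesis
      using assms n by (simp add: coset_eq submodule.smult_closed[OF sub])
  qed
  then have "(\<lambda>y. N +>\<^bsub>V\<^esub> (a \<odot>\<^bsub>V\<^esub> y)) ` (N +>\<^bsub>V\<^esub> x) = {N +>\<^bsub>V\<^esub> (a \<odot>\<^bsub>V\<^esub> x)}"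
    using N.a_rcos_self[OF assms(2)] by blast
  then show ?thesis by (simp add: quotient_space_def)
qed

lemma module_quotient: "module K Q"
proof -
  have neg: "\<exists>y\<in>carrier Q. y \<oplus>\<^bsub>Q\<^esub> (N +>\<^bsub>V\<^esub> x) = \<zero>\<^bsub>Q\<^esub>" if "x \<in> carrier V" for x
  proof (rule bexI[of _ "N +>\<^bsub>V\<^esub> (\<ominus>\<^bsub>V\<^esub> x)"])
    show "(N +>\<^bsub>V\<^esub> (\<ominus>\<^bsub>V\<^esub> x)) \<oplus>\<^bsub>Q\<^esub> (N +>\<^bsub>V\<^esub> x) = \<zero>\<^bsub>Q\<^esub>"
      using that by (subst add_quotient) (simp_all add: zero_quotient V.M.l_neg)
    show "N +>\<^bsub>V\<^esub> (\<ominus>\<^bsub>V\<^esub> x) \<in> carrier Q"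
      using that unfolding carrier_quotient by blast
  qed
  have cl: "N +>\<^bsub>V\<^esub> x \<in> carrier Q" if "x \<in> carrier V" for x
    using that unfolding carrier_quotient by blast
  have rep: thesis if "X \<in> carrier Q" "\<And>x. x \<in> carrier V \<Longrightarrow> X = N +>\<^bsub>V\<^esub> x \<Longrightarrow> thesis" for X thesis
    using that unfolding carrier_quotient by blast
  note simps = add_quotient smult_quotient zero_quotient cl
  show ?thesis
  proof (rule moduleI[OF V.is_cring], rule abelian_groupI)
    fix X Y Z assume "X \<in> carrier Q" "Y \<in> carrier Q" "Z \<in> carrier Q"
    then obtain x y z where x: "x \<in> carrier V" "y \<in> carrier V" "z \<in> carrier V"
      and X: "X = N +>\<^bsub>V\<^esub> x" "Y = N +>\<^bsub>V\<^esub> y" "Z = N +>\<^bsub>V\<^esub> z" by (elim rep)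
    show "X \<oplus>\<^bsub>Q\<^esub> Y \<oplus>\<^bsub>Q\<^esub> Z = X \<oplus>\<^bsub>Q\<^esub> (Y \<oplus>\<^bsub>Q\<^esub> Z)" using x by (simp add: X simps V.M.a_assoc)
  next
    fix X Y assume "X \<in> carrier Q" "Y \<in> carrier Q"
    then obtain x y where x: "x \<in> carrier V" "y \<in> carrier V"
      and X: "X = N +>\<^bsub>V\<^esub> x" "Y = N +>\<^bsub>V\<^esub> y" by (elim rep)
    show "X \<oplus>\<^bsub>Q\<^esub> Y \<in> carrier Q" using x by (simp add: X simps)
    show "X \<oplus>\<^bsub>Q\<^esub> Y = Y \<oplus>\<^bsub>Q\<^esub> X" using x V.M.a_comm[of x y] by (simp add: X simps)
    fix a assume a: "a \<in> carrier K"
    show "a \<odot>\<^bsub>Q\<^esub> (X \<oplus>\<^bsub>Q\<^esub> Y) = a \<odot>\<^bsub>Q\<^esub> X \<oplus>\<^bsub>Q\<^esub> a \<odot>\<^bsub>Q\<^esub> Y"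
      using x a by (simp add: X simps V.smult_r_distr)
  next
    fix X assume "X \<in> carrier Q"
    then obtain x where x: "x \<in> carrier V" and X: "X = N +>\<^bsub>V\<^esub> x" by (elim rep)
    show "\<zero>\<^bsub>Q\<^esub> \<oplus>\<^bsub>Q\<^esub> X = X"
      unfolding X zero_quotient using x by (subst add_quotient) simp_all
    show "\<exists>Y\<in>carrier Q. Y \<oplus>\<^bsub>Q\<^esub> X = \<zero>\<^bsub>Q\<^esub>" using neg x X by blast
    show "\<one>\<^bsub>K\<^esub> \<odot>\<^bsub>Q\<^esub> X = X" using x by (simp add: X simps)
    fix a assume a: "a \<in> carrier K"
    show "a \<odot>\<^bsub>Q\<^esub> X \<in> carrier Q" using x a by (simp add: X simps)
    fix b assume b: "b \<in> carrier K"
    show "(a \<oplus>\<^bsub>K\<^esub> b) \<odot>\<^bsub>Q\<^esub> X = a \<odot>\<^bsub>Q\<^esub> X \<oplus>\<^bsub>Q\<^esub> b \<odot>\<^bsub>Q\<^esub> X"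
      using x a b by (simp add: X simps V.smult_l_distr)
    show "a \<otimes>\<^bsub>K\<^esub> b \<odot>\<^bsub>Q\<^esub> X = a \<odot>\<^bsub>Q\<^esub> (b \<odot>\<^bsub>Q\<^esub> X)"
      using x a b by (simp add: X simps V.smult_assoc1)
  next
    show "\<zero>\<^bsub>Q\<^esub> \<in> carrier Q" unfolding zero_quotient by (rule cl) simp
  qed
qed

lemma lin_map_coset: "lin_map K V Q (\<lambda>x. N +>\<^bsub>V\<^esub> x)"
  by (rule lin_map.intro)
    (simp_all add: V.module_axioms module_quotient add_quotient smult_quotient carrier_quotient)

lemma coset_null: "x \<in> N \<Longrightarrow> N +>\<^bsub>V\<^esub> x = \<zero>\<^bsub>Q\<^esub>"
  unfolding zero_quotient using coset_eq[of x "\<zero>\<^bsub>V\<^esub>"] N.a_Hcarr[of x]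
  by (simp del: V.M.a_coset_add_zero)

lemma lift_quotient:
  assumes f: "lin_map K V W f" and null: "\<And>x. x \<in> N \<Longrightarrow> f x = \<zero>\<^bsub>W\<^esub>"
  shows "\<exists>h. lin_map K Q W h \<and> (\<forall>x\<in>carrier V. h (N +>\<^bsub>V\<^esub> x) = f x)"
proof -
  interpret f: lin_map K V W f by (rule f)
  \<comment> \<open>Any representative will do: two of them differ by an element of
    \<open>N\<close>, where \<open>f\<close> vanishes.\<close>
  define h where "h X = f (SOME x. x \<in> X)" for X
  have h: "h (N +>\<^bsub>V\<^esub> x) = f x" if x: "x \<in> carrier V" for x
  proof -
    have "(SOME y. y \<in> N +>\<^bsub>V\<^esub> x) \<in> N +>\<^bsub>V\<^esub> x"
      using N.a_rcos_self[OF x] by (rule someI)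
    then obtain n where "n \<in> N" "(SOME y. y \<in> N +>\<^bsub>V\<^esub> x) = n \<oplus>\<^bsub>V\<^esub> x" by (auto simp: coset_elem)
    then show ?thesis using x N.a_Hcarr null by (simp add: h_def f.add f.closed)
  qed
  have "lin_map K Q W h"
  proof (rule lin_map.intro[OF module_quotient f.cod])
    fix X Y assume "X \<in> carrier Q" "Y \<in> carrier Q"
    then obtain x y where x: "x \<in> carrier V" "y \<in> carrier V"
      and X: "X = N +>\<^bsub>V\<^esub> x" "Y = N +>\<^bsub>V\<^esub> y" unfolding carrier_quotient by blast
    show "h (X \<oplus>\<^bsub>Q\<^esub> Y) = h X \<oplus>\<^bsub>W\<^esub> h Y" using x by (simp add: X add_quotient h f.add)
    show "h X \<in> carrier W" using x by (simp add: X h f.closed)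
    show "h (a \<odot>\<^bsub>Q\<^esub> X) = a \<odot>\<^bsub>W\<^esub> h X" if "a \<in> carrier K" for a
      using x that by (simp add: X smult_quotient h f.smult)
  qed
  then show ?thesis using h by blast
qed

end

section \<open>Generated subspaces and presentations by generators and relations\<close>

lemma submodule_generated:
  assumes "module K V" "S \<subseteq> carrier V"
  shows "submodule (subspace_generated K V S) K V"
proof -
  interpret V: module K V by fact
  show ?thesis
  proof (rule V.submoduleI)
    show "subspace_generated K V S \<subseteq> carrier V"
      using V.carrier_is_submodule assms by (auto simp: subspace_generated_def)
    show "\<zero>\<^bsub>V\<^esub> \<in> subspace_generated K V S"
      using subgroup.one_closed[OF submodule.axioms(1)] by (fastforce simp: subspace_generated_def)
  qed (simp_all add: subspace_generated_def V.submoduleE)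
qed

lemma generated_superset: "S \<subseteq> subspace_generated K V S"
  by (auto simp: subspace_generated_def)

lemma generated_least: "submodule N K V \<Longrightarrow> S \<subseteq> N \<Longrightarrow> subspace_generated K V S \<subseteq> N"
  by (auto simp: subspace_generated_def)

text \<open>Together with \<open>generated_least\<close> this turns a check on relators into a
  statement about the whole subspace they generate.\<close>

lemma (in lin_map) submodule_kernel: "submodule {x \<in> carrier V. f x = \<zero>\<^bsub>W\<^esub>} K V"
proof (rule V.submoduleI)
  fix x assume "x \<in> {x \<in> carrier V. f x = \<zero>\<^bsub>W\<^esub>}"
  then have "x \<in> carrier V" "f (\<zero>\<^bsub>V\<^esub> \<ominus>\<^bsub>V\<^esub> x) = \<zero>\<^bsub>W\<^esub> \<ominus>\<^bsub>W\<^esub> \<zero>\<^bsub>W\<^esub>"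
    by (auto simp: map_minus map_zero)
  then show "\<ominus>\<^bsub>V\<^esub> x \<in> {x \<in> carrier V. f x = \<zero>\<^bsub>W\<^esub>}"
    by (simp add: a_minus_def W.M.r_neg)
qed (auto simp: map_zero add smult closed)

text \<open>The common shape of tensor products, of \<open>\<M>\<close> and of \<open>\<A>\<close>.
  Induction, extensionality and lifting are proved once for this shape and then specialised.\<close>

definition presented ::
  "('k, 'm) ring_scheme \<Rightarrow> 'x set \<Rightarrow> ('x \<Rightarrow> 'k) set \<Rightarrow> ('k, ('x \<Rightarrow> 'k) set) module" where
  "presented K X R = quotient_space (free_space K X) (subspace_generated K (free_space K X) R)"

definition pgen :: "('k, 'm) ring_scheme \<Rightarrow> 'x set \<Rightarrow> ('x \<Rightarrow> 'k) set \<Rightarrow> 'x \<Rightarrow> ('x \<Rightarrow> 'k) set" where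
  "pgen K X R x = subspace_generated K (free_space K X) R +>\<^bsub>free_space K X\<^esub> basis_vec K x"

locale presentation = cring K
  for K :: "('k, 'm) ring_scheme" (structure) and X :: "'x set" and R +
  assumes relators: "R \<subseteq> carrier (free_space K X)"
begin

abbreviation "F \<equiv> free_space K X"
abbreviation "P \<equiv> presented K X R"
abbreviation "gen \<equiv> pgen K X R"
abbreviation "cls f \<equiv> subspace_generated K F R +>\<^bsub>F\<^esub> f"

sublocale F: module K F by (rule module_free_space[OF is_cring])

sublocale Q: quotient_module K F "subspace_generated K F R"
  by (intro quotient_module.intro quotient_module_axioms.intro F.module_axioms
      submodule_generated[OF F.module_axioms relators])

lemma module_presented: "module K P"
  unfolding presented_def by (rule Q.module_quotient)

sublocale P: module K P by (rule module_presented)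

lemma lin_map_cls: "lin_map K F P (\<lambda>f. cls f)"
  using Q.lin_map_coset by (simp add: presented_def)

sublocale cls: lin_map K F P "\<lambda>f. cls f"
  by (rule lin_map_cls)

lemma cls_basis: "cls (basis_vec K x) = gen x"
  by (simp add: pgen_def)

lemma gen_closed: "x \<in> X \<Longrightarrow> gen x \<in> carrier P"
  using cls.closed by (simp add: pgen_def is_cring)

lemma cls_relator: "r \<in> R \<Longrightarrow> cls r = \<zero>\<^bsub>P\<^esub>"
  unfolding presented_def by (rule Q.coset_null) (rule subsetD[OF generated_superset])

lemma presented_induct:
  assumes v: "v \<in> carrier P" and zero: "Pr \<zero>\<^bsub>P\<^esub>"
    and add: "\<And>u v. \<lbrakk>u \<in> carrier P; v \<in> carrier P; Pr u; Pr v\<rbrakk> \<Longrightarrow> Pr (u \<oplus>\<^bsub>P\<^esub> v)"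
    and smult: "\<And>a v. \<lbrakk>a \<in> carrier K; v \<in> carrier P; Pr v\<rbrakk> \<Longrightarrow> Pr (a \<odot>\<^bsub>P\<^esub> v)"
    and gen: "\<And>x. x \<in> X \<Longrightarrow> Pr (gen x)"
  shows "Pr v"
proof -
  from v obtain f where f: "f \<in> carrier F" and v: "v = cls f"
    using Q.carrier_quotient by (auto simp: presented_def)
  have "Pr (cls f)"
    using is_cring f
  proof (rule free_space_induct)
    show "Pr (cls (\<lambda>x. \<zero>))"
      using zero cls.map_zero by simp
  next
    fix a x g assume a: "a \<in> carrier K" "x \<in> X" "g \<in> carrier F" "Pr (cls g)"
    have "cls (a \<odot>\<^bsub>F\<^esub> basis_vec K x \<oplus>\<^bsub>F\<^esub> g) = a \<odot>\<^bsub>P\<^esub> gen x \<oplus>\<^bsub>P\<^esub> cls g"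
      using a is_cring by (simp add: cls.add cls.smult cls_basis del: free_space_simps)
    then show "Pr (cls (a \<odot>\<^bsub>F\<^esub> basis_vec K x \<oplus>\<^bsub>F\<^esub> g))"
      using a by (simp add: add smult gen gen_closed cls.closed del: free_space_simps)
  qed
  then show ?thesis by (simp add: v)
qed

lemma lin_map_ext:
  assumes "lin_map K P W f" "lin_map K P W g" "\<And>x. x \<in> X \<Longrightarrow> f (gen x) = g (gen x)"
    and v: "v \<in> carrier P"
  shows "f v = g v"
proof -
  interpret f: lin_map K P W f by fact
  interpret g: lin_map K P W g by fact
  show ?thesis
    by (rule presented_induct[OF v])
      (simp_all add: f.map_zero g.map_zero f.add g.add f.smult g.smult assms(3))
qed

text \<open>The linear extension of \<open>g\<close> to the free space exists only inside the proof,
  so the condition on relators is demanded of an arbitrary extension \<open>h\<close>; linearity and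
  its values on basis vectors are all that a caller needs.\<close>

lemma lift_presented:
  assumes W: "module K W" and g: "\<And>x. x \<in> X \<Longrightarrow> g x \<in> carrier W"
    and null: "\<And>h r. \<lbrakk>lin_map K F W h; \<And>x. x \<in> X \<Longrightarrow> h (basis_vec K x) = g x; r \<in> R\<rbrakk> \<Longrightarrow> h r = \<zero>\<^bsub>W\<^esub>"
  shows "\<exists>h. lin_map K P W h \<and> (\<forall>x\<in>X. h (gen x) = g x)"
proof -
  obtain h where h: "lin_map K F W h" "\<And>x. x \<in> X \<Longrightarrow> h (basis_vec K x) = g x"
    using free_space_lift[OF is_cring W, of X g] g by blast
  interpret h: lin_map K F W h by (rule h(1))
  let ?ker = "{f \<in> carrier F. h f = \<zero>\<^bsub>W\<^esub>}"
  have "R \<subseteq> ?ker"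
    using relators null[of h] h by (simp add: subset_iff)
  then have "subspace_generated K F R \<subseteq> ?ker"
    by (rule generated_least[OF h.submodule_kernel])
  then have "h f = \<zero>\<^bsub>W\<^esub>" if "f \<in> subspace_generated K F R" for f
    using that by blast
  then have "\<exists>h'. lin_map K P W h' \<and> (\<forall>f\<in>carrier F. h' (cls f) = h f)"
    unfolding presented_def by (rule Q.lift_quotient[OF h(1)])
  then obtain h' where h': "lin_map K P W h'" "\<forall>f\<in>carrier F. h' (cls f) = h f"
    by (elim exE conjE)
  have "\<forall>x\<in>X. h' (gen x) = g x"
  proof
    fix x assume "x \<in> X"
    then show "h' (gen x) = g x"
      using h(2) bspec[OF h'(2) basis_vec_carrier[OF is_cring]] unfolding pgen_def by metis
  qed
  then show ?thesis using h'(1) by (intro exI conjI)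
qed

end

section \<open>Tensor products\<close>

lemma (in abelian_group) minus_eq_zero_iff:
  assumes "x \<in> carrier G" "y \<in> carrier G"
  shows "x \<ominus> y = \<zero> \<longleftrightarrow> x = y"
proof
  assume "x \<ominus> y = \<zero>"
  then have "\<ominus> (\<ominus> y) = x"
    using assms by (intro minus_equality) (simp_all add: a_minus_def)
  then show "x = y" using assms by (simp add: minus_minus)
qed (use assms in \<open>simp add: a_minus_def r_neg\<close>)

lemma (in lin_map) map_minus_eq_zero_iff:
  "x \<in> carrier V \<Longrightarrow> y \<in> carrier V \<Longrightarrow> f (x \<ominus>\<^bsub>V\<^esub> y) = \<zero>\<^bsub>W\<^esub> \<longleftrightarrow> f x = f y"
  by (simp add: map_minus W.M.minus_eq_zero_iff closed)

text \<open>All relators in question are written as differences, so they enter as equations between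
  classes.\<close>

lemma (in presentation) cls_eq_if_relator:
  "f \<ominus>\<^bsub>F\<^esub> g \<in> R \<Longrightarrow> f \<in> carrier F \<Longrightarrow> g \<in> carrier F \<Longrightarrow> cls f = cls g"
  using cls_relator[of "f \<ominus>\<^bsub>F\<^esub> g"] cls.map_minus_eq_zero_iff by simp

definition bilinear ::
  "('k, 'm) ring_scheme \<Rightarrow> ('k, 'v) module \<Rightarrow> ('k, 'w) module \<Rightarrow> ('k, 'u) module
    \<Rightarrow> ('v \<Rightarrow> 'w \<Rightarrow> 'u) \<Rightarrow> bool" where
  "bilinear K V W U b \<longleftrightarrow> (\<forall>v\<in>carrier V. lin_map K W U (b v)) \<and>
     (\<forall>w\<in>carrier W. lin_map K V U (\<lambda>v. b v w))"

lemma bilinearity_relatorsI: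
  fixes K V W
  defines "F \<equiv> free_space K (carrier V \<times> carrier W)"
  shows "x \<in> carrier V \<Longrightarrow> y \<in> carrier V \<Longrightarrow> w \<in> carrier W \<Longrightarrow>
      basis_vec K (x \<oplus>\<^bsub>V\<^esub> y, w) \<ominus>\<^bsub>F\<^esub> (basis_vec K (x, w) \<oplus>\<^bsub>F\<^esub> basis_vec K (y, w))
        \<in> bilinearity_relators K V W"
    and "v \<in> carrier V \<Longrightarrow> x' \<in> carrier W \<Longrightarrow> y' \<in> carrier W \<Longrightarrow>
      basis_vec K (v, x' \<oplus>\<^bsub>W\<^esub> y') \<ominus>\<^bsub>F\<^esub> (basis_vec K (v, x') \<oplus>\<^bsub>F\<^esub> basis_vec K (v, y'))
        \<in> bilinearity_relators K V W"
    and "a \<in> carrier K \<Longrightarrow> v \<in> carrier V \<Longrightarrow> w \<in> carrier W \<Longrightarrow>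
      basis_vec K (a \<odot>\<^bsub>V\<^esub> v, w) \<ominus>\<^bsub>F\<^esub> (a \<odot>\<^bsub>F\<^esub> basis_vec K (v, w)) \<in> bilinearity_relators K V W"
    and "a \<in> carrier K \<Longrightarrow> v \<in> carrier V \<Longrightarrow> w \<in> carrier W \<Longrightarrow>
      basis_vec K (v, a \<odot>\<^bsub>W\<^esub> w) \<ominus>\<^bsub>F\<^esub> (a \<odot>\<^bsub>F\<^esub> basis_vec K (v, w)) \<in> bilinearity_relators K V W"
  unfolding bilinearity_relators_def tensor_free_def F_def Let_def
  by (rule UnI1, rule UnI1, rule UnI1, blast) (rule UnI1, rule UnI1, rule UnI2, blast,
      rule UnI1, rule UnI2, blast, rule UnI2, blast)

lemma tensor_presentation:
  assumes "module K V" "module K W"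
  shows "presentation K (carrier V \<times> carrier W) (bilinearity_relators K V W)"
proof -
  interpret V: module K V by fact
  interpret W: module K W by fact
  interpret F: module K "tensor_free K V W"
    unfolding tensor_free_def by (rule module_free_space[OF V.is_cring])
  have [simp]: "basis_vec K (v, w) \<in> carrier (tensor_free K V W)"
    if "v \<in> carrier V" "w \<in> carrier W" for v w
    unfolding tensor_free_def using that by (intro basis_vec_carrier[OF V.is_cring]) simp
  have "bilinearity_relators K V W \<subseteq> carrier (tensor_free K V W)"
    unfolding bilinearity_relators_def Let_def
    by (intro Un_least subsetI; elim CollectE exE conjE; simp)
  then show ?thesis
    unfolding tensor_free_def presentation_def presentation_axioms_def using V.is_cring by simp
qed

context
  fixes K :: "('k, 'm) ring_scheme" and V :: "('k, 'v) module" and W :: "('k, 'w) module"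
  assumes V: "module K V" and W: "module K W"
begin

interpretation V: module K V by (rule V)
interpretation W: module K W by (rule W)
interpretation presentation K "carrier V \<times> carrier W" "bilinearity_relators K V W"
  by (rule tensor_presentation[OF V W])

lemma tensor_space_presented:
  "tensor_space K V W = presented K (carrier V \<times> carrier W) (bilinearity_relators K V W)"
  by (simp add: tensor_space_def presented_def tensor_null_def tensor_free_def)

lemma tens_eq: "tens K V W v w = gen (v, w)"
  by (simp add: tens_def pgen_def tensor_null_def tensor_free_def)

lemma module_tensor_space: "module K (tensor_space K V W)"
  unfolding tensor_space_presented by (rule module_presented)

lemma tens_closed: "v \<in> carrier V \<Longrightarrow> w \<in> carrier W \<Longrightarrow> tens K V W v w \<in> carrier (tensor_space K V W)"
  unfolding tensor_space_presented tens_eq by (rule gen_closed) simp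

lemma bilinear_tens: "bilinear K V W (tensor_space K V W) (tens K V W)"
proof -
  have e: "basis_vec K (v, w) \<in> carrier F" if "v \<in> carrier V" "w \<in> carrier W" for v w
    using that by (intro basis_vec_carrier[OF V.is_cring]) simp
  note eq = tensor_space_presented tens_eq
  have cl: "gen (v, w) \<in> carrier P" if "v \<in> carrier V" "w \<in> carrier W" for v w
    using that by (intro gen_closed) simp
  have 1: "gen (x \<oplus>\<^bsub>V\<^esub> y, w) = gen (x, w) \<oplus>\<^bsub>P\<^esub> gen (y, w)"
    if "x \<in> carrier V" "y \<in> carrier V" "w \<in> carrier W" for x y w
  proof -
    have "cls (basis_vec K (x \<oplus>\<^bsub>V\<^esub> y, w)) = cls (basis_vec K (x, w) \<oplus>\<^bsub>F\<^esub> basis_vec K (y, w))"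
      using that by (intro cls_eq_if_relator bilinearity_relatorsI F.M.a_closed e V.M.a_closed)
    also have "\<dots> = gen (x, w) \<oplus>\<^bsub>P\<^esub> gen (y, w)"
      using that by (subst cls.add) (simp_all only: e cls_basis)
    finally show ?thesis by (simp only: cls_basis)
  qed
  have 2: "gen (v, x \<oplus>\<^bsub>W\<^esub> y) = gen (v, x) \<oplus>\<^bsub>P\<^esub> gen (v, y)"
    if "v \<in> carrier V" "x \<in> carrier W" "y \<in> carrier W" for v x y
  proof -
    have "cls (basis_vec K (v, x \<oplus>\<^bsub>W\<^esub> y)) = cls (basis_vec K (v, x) \<oplus>\<^bsub>F\<^esub> basis_vec K (v, y))"
      using that by (intro cls_eq_if_relator bilinearity_relatorsI F.M.a_closed e W.M.a_closed)
    also have "\<dots> = gen (v, x) \<oplus>\<^bsub>P\<^esub> gen (v, y)"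
      using that by (subst cls.add) (simp_all only: e cls_basis)
    finally show ?thesis by (simp only: cls_basis)
  qed
  have 3: "gen (a \<odot>\<^bsub>V\<^esub> v, w) = a \<odot>\<^bsub>P\<^esub> gen (v, w)"
    if "a \<in> carrier K" "v \<in> carrier V" "w \<in> carrier W" for a v w
  proof -
    have "cls (basis_vec K (a \<odot>\<^bsub>V\<^esub> v, w)) = cls (a \<odot>\<^bsub>F\<^esub> basis_vec K (v, w))"
      using that by (intro cls_eq_if_relator bilinearity_relatorsI F.smult_closed e V.smult_closed)
    also have "\<dots> = a \<odot>\<^bsub>P\<^esub> gen (v, w)"
      using that by (subst cls.smult) (simp_all only: e cls_basis)
    finally show ?thesis by (simp only: cls_basis)
  qed
  have 4: "gen (v, a \<odot>\<^bsub>W\<^esub> w) = a \<odot>\<^bsub>P\<^esub> gen (v, w)"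
    if "a \<in> carrier K" "v \<in> carrier V" "w \<in> carrier W" for a v w
  proof -
    have "cls (basis_vec K (v, a \<odot>\<^bsub>W\<^esub> w)) = cls (a \<odot>\<^bsub>F\<^esub> basis_vec K (v, w))"
      using that by (intro cls_eq_if_relator bilinearity_relatorsI F.smult_closed e W.smult_closed)
    also have "\<dots> = a \<odot>\<^bsub>P\<^esub> gen (v, w)"
      using that by (subst cls.smult) (simp_all only: e cls_basis)
    finally show ?thesis by (simp only: cls_basis)
  qed
  show ?thesis
    unfolding bilinear_def eq
    by (intro conjI ballI lin_map.intro V W module_presented cl 1 2 3 4)
qed

text \<open>The universal property of the tensor product. Each bilinearity relator is a difference
  of two elements to which the extension of \<open>b\<close> assigns the same value, by linearity of
  \<open>b\<close> in one of its arguments.\<close>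

lemma tensor_lift:
  assumes b: "bilinear K V W U b"
  shows "\<exists>h. lin_map K (tensor_space K V W) U h \<and>
    (\<forall>v\<in>carrier V. \<forall>w\<in>carrier W. h (tens K V W v w) = b v w)"
proof -
  have l: "lin_map K W U (b v)" if "v \<in> carrier V" for v
    using b that by (simp add: bilinear_def)
  have r: "lin_map K V U (\<lambda>v. b v w)" if "w \<in> carrier W" for w
    using b that by (simp add: bilinear_def)
  \<comment> \<open>\<open>bilinear\<close> speaks about \<open>U\<close> only through elements of
    \<open>V\<close> and \<open>W\<close>; the zero vector guarantees that there is one.\<close>
  have U: "module K U" using l[of "\<zero>\<^bsub>V\<^esub>"] by (simp add: lin_map_def)
  have e: "basis_vec K (v, w) \<in> carrier F" if "v \<in> carrier V" "w \<in> carrier W" for v w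
    using that by (intro basis_vec_carrier[OF V.is_cring]) simp
  have "\<exists>h. lin_map K P U h \<and> (\<forall>x\<in>carrier V \<times> carrier W. h (gen x) = case_prod b x)"
  proof (rule lift_presented[OF U])
    show "case_prod b x \<in> carrier U" if "x \<in> carrier V \<times> carrier W" for x
      using that lin_map.closed[OF l] by auto
    fix h r assume h: "lin_map K F U h" "\<And>x. x \<in> carrier V \<times> carrier W \<Longrightarrow> h (basis_vec K x) = case_prod b x"
      and "r \<in> bilinearity_relators K V W"
    interpret h: lin_map K F U h by (rule h(1))
    have hb: "h (basis_vec K (v, w)) = b v w" if "v \<in> carrier V" "w \<in> carrier W" for v w
      using h(2)[of "(v, w)"] that by simp
    note facts = e hb V.M.a_closed W.M.a_closed V.smult_closed W.smult_closed F.M.a_closed F.smult_closed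
      h.add h.smult lin_map.add[OF l] lin_map.add[OF r] lin_map.smult[OF l] lin_map.smult[OF r]
    from \<open>r \<in> bilinearity_relators K V W\<close> consider
        x y w where "r = basis_vec K (x \<oplus>\<^bsub>V\<^esub> y, w) \<ominus>\<^bsub>F\<^esub> (basis_vec K (x, w) \<oplus>\<^bsub>F\<^esub> basis_vec K (y, w))"
          "x \<in> carrier V" "y \<in> carrier V" "w \<in> carrier W"
      | v x y where "r = basis_vec K (v, x \<oplus>\<^bsub>W\<^esub> y) \<ominus>\<^bsub>F\<^esub> (basis_vec K (v, x) \<oplus>\<^bsub>F\<^esub> basis_vec K (v, y))"
          "v \<in> carrier V" "x \<in> carrier W" "y \<in> carrier W"
      | a v w where "r = basis_vec K (a \<odot>\<^bsub>V\<^esub> v, w) \<ominus>\<^bsub>F\<^esub> (a \<odot>\<^bsub>F\<^esub> basis_vec K (v, w))"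
          "a \<in> carrier K" "v \<in> carrier V" "w \<in> carrier W"
      | a v w where "r = basis_vec K (v, a \<odot>\<^bsub>W\<^esub> w) \<ominus>\<^bsub>F\<^esub> (a \<odot>\<^bsub>F\<^esub> basis_vec K (v, w))"
          "a \<in> carrier K" "v \<in> carrier V" "w \<in> carrier W"
      unfolding bilinearity_relators_def tensor_free_def Let_def by (elim UnE CollectE exE conjE) metis+
    then show "h r = \<zero>\<^bsub>U\<^esub>"
    proof cases
      case 1
      then show ?thesis by (subst 1(1), subst h.map_minus_eq_zero_iff) (simp_all only: facts)
    next
      case 2
      then show ?thesis by (subst 2(1), subst h.map_minus_eq_zero_iff) (simp_all only: facts)
    next
      case 3
      then show ?thesis by (subst 3(1), subst h.map_minus_eq_zero_iff) (simp_all only: facts)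
    next
      case 4
      then show ?thesis by (subst 4(1), subst h.map_minus_eq_zero_iff) (simp_all only: facts)
    qed
  qed
  then show ?thesis unfolding tensor_space_presented tens_eq by simp
qed

lemma tensor_ext:
  assumes "lin_map K (tensor_space K V W) U f" "lin_map K (tensor_space K V W) U g"
    and "\<And>v w. v \<in> carrier V \<Longrightarrow> w \<in> carrier W \<Longrightarrow> f (tens K V W v w) = g (tens K V W v w)"
    and t: "t \<in> carrier (tensor_space K V W)"
  shows "f t = g t"
proof (rule lin_map_ext)
  show "f (gen x) = g (gen x)" if "x \<in> carrier V \<times> carrier W" for x
    using that assms(3) by (cases x) (simp add: tens_eq)
qed (use assms(1,2,4) in \<open>simp_all only: tensor_space_presented\<close>)

end

section \<open>Canonical maps between tensor products\<close>

lemma lin_map_tens_left: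
  assumes "module K V" "module K W" "v \<in> carrier V"
  shows "lin_map K W (tensor_space K V W) (tens K V W v)"
  using bilinear_tens[OF assms(1,2)] assms(3) by (simp add: bilinear_def)

lemma lin_map_tens_right:
  assumes "module K V" "module K W" "w \<in> carrier W"
  shows "lin_map K V (tensor_space K V W) (\<lambda>v. tens K V W v w)"
  using bilinear_tens[OF assms(1,2)] assms(3) by (simp add: bilinear_def)

text \<open>Replaces the definite description by its two usable properties, linearity and the value
  on pure tensors. Existence is \<open>tensor_lift\<close>, uniqueness is \<open>tensor_ext\<close>;
  the left unit, the associator and the middle swap follow the same scheme.\<close>

lemma tensor_map:
  assumes f: "lin_map K V V' f" and g: "lin_map K W W' g"
  shows "lin_map K (tensor_space K V W) (tensor_space K V' W') (tensor_map K V V' W W' f g)"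
    and "v \<in> carrier V \<Longrightarrow> w \<in> carrier W \<Longrightarrow>
      tensor_map K V V' W W' f g (tens K V W v w) = tens K V' W' (f v) (g w)"
proof -
  note mods = lin_map.dom[OF f] lin_map.cod[OF f] lin_map.dom[OF g] lin_map.cod[OF g]
  have bil: "bilinear K V W (tensor_space K V' W') (\<lambda>v w. tens K V' W' (f v) (g w))"
    unfolding bilinear_def
  proof (intro conjI ballI)
    show "lin_map K W (tensor_space K V' W') (\<lambda>w. tens K V' W' (f v) (g w))" if "v \<in> carrier V" for v
      by (rule lin_map_comp[OF g lin_map_tens_left[OF mods(2,4) lin_map.closed[OF f that]]])
    show "lin_map K V (tensor_space K V' W') (\<lambda>v. tens K V' W' (f v) (g w))" if "w \<in> carrier W" for w
      by (rule lin_map_comp[OF f lin_map_tens_right[OF mods(2,4) lin_map.closed[OF g that]]])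
  qed
  obtain h where h: "lin_map K (tensor_space K V W) (tensor_space K V' W') h"
    "\<forall>v\<in>carrier V. \<forall>w\<in>carrier W. h (tens K V W v w) = tens K V' W' (f v) (g w)"
    using tensor_lift[OF mods(1,3) bil] by (elim exE conjE)
  have eq: "tensor_map K V V' W W' f g = restrict h (carrier (tensor_space K V W))"
    unfolding tensor_map_def
  proof (rule the_linear_eq[OF h(1)])
    show "\<forall>v\<in>carrier V. \<forall>w\<in>carrier W.
        restrict h (carrier (tensor_space K V W)) (tens K V W v w) = tens K V' W' (f v) (g w)"
      using h(2) tens_closed[OF mods(1,3)] by simp
    show "h' x = h x" if "lin_map K (tensor_space K V W) (tensor_space K V' W') h'"
      "\<forall>v\<in>carrier V. \<forall>w\<in>carrier W. h' (tens K V W v w) = tens K V' W' (f v) (g w)"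
      "x \<in> carrier (tensor_space K V W)" for h' x
      by (rule tensor_ext[OF mods(1,3) that(1) h(1) _ that(3)]) (simp add: that(2) h(2))
  qed
  show "lin_map K (tensor_space K V W) (tensor_space K V' W') (tensor_map K V V' W W' f g)"
    unfolding eq by (rule lin_map_restrict[OF h(1)])
  show "tensor_map K V V' W W' f g (tens K V W v w) = tens K V' W' (f v) (g w)"
    if "v \<in> carrier V" "w \<in> carrier W"
    unfolding eq using h(2) that tens_closed[OF mods(1,3)] by simp
qed

lemma tensor_lunit:
  assumes V: "module K V"
  shows "lin_map K (tensor_space K (ground_space K) V) V (tensor_lunit K V)"
    and "a \<in> carrier K \<Longrightarrow> v \<in> carrier V \<Longrightarrow>
      tensor_lunit K V (tens K (ground_space K) V a v) = a \<odot>\<^bsub>V\<^esub> v"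
proof -
  interpret V: module K V by fact
  let ?G = "ground_space K"
  have carrier: "carrier ?G = carrier K" by (simp add: ground_space_def)
  have G: "module K ?G" by (rule module_ground_space[OF V.is_cring])
  have bil: "bilinear K ?G V V (\<lambda>a v. a \<odot>\<^bsub>V\<^esub> v)"
    unfolding bilinear_def carrier
  proof (intro conjI ballI)
    show "lin_map K V V (\<lambda>v. a \<odot>\<^bsub>V\<^esub> v)" if "a \<in> carrier K" for a
      using lin_map_smult[OF lin_map_id[OF V] that] by (rule lin_map_cong) (simp add: id_map_def)
    show "lin_map K ?G V (\<lambda>a. a \<odot>\<^bsub>V\<^esub> v)" if "v \<in> carrier V" for v
      using that by (intro lin_map.intro[OF G V])
        (simp_all add: ground_space_def V.smult_l_distr V.smult_assoc1)
  qed
  obtain h where h: "lin_map K (tensor_space K ?G V) V h"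
    "\<forall>a\<in>carrier K. \<forall>v\<in>carrier V. h (tens K ?G V a v) = a \<odot>\<^bsub>V\<^esub> v"
    using tensor_lift[OF G V bil] unfolding carrier by (elim exE conjE)
  have eq: "tensor_lunit K V = restrict h (carrier (tensor_space K ?G V))"
    unfolding tensor_lunit_def
  proof (rule the_linear_eq[OF h(1)])
    show "\<forall>a\<in>carrier K. \<forall>v\<in>carrier V.
        restrict h (carrier (tensor_space K ?G V)) (tens K ?G V a v) = a \<odot>\<^bsub>V\<^esub> v"
      using h(2) tens_closed[OF G V] by (simp add: carrier)
    show "h' x = h x" if "lin_map K (tensor_space K ?G V) V h'"
      "\<forall>a\<in>carrier K. \<forall>v\<in>carrier V. h' (tens K ?G V a v) = a \<odot>\<^bsub>V\<^esub> v"
      "x \<in> carrier (tensor_space K ?G V)" for h' x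
      by (rule tensor_ext[OF G V that(1) h(1) _ that(3)]) (simp add: that(2) h(2) carrier)
  qed
  show "lin_map K (tensor_space K ?G V) V (tensor_lunit K V)"
    unfolding eq by (rule lin_map_restrict[OF h(1)])
  show "tensor_lunit K V (tens K ?G V a v) = a \<odot>\<^bsub>V\<^esub> v" if "a \<in> carrier K" "v \<in> carrier V"
    unfolding eq using h(2) that tens_closed[OF G V] by (simp add: carrier)
qed

text \<open>The inner step for maps out of an iterated tensor product. A map linear in each of three
  arguments is lifted over \<open>U \<otimes> V\<close> for every fixed \<open>w\<close>; the lifts
  are picked by choice, and their dependence on \<open>w\<close> is linear because a lift is
  determined by its values on pure tensors.\<close>

lemma bilinear_lift_left:
  assumes U: "module K U" and V: "module K V"
    and b1: "\<And>u v. u \<in> carrier U \<Longrightarrow> v \<in> carrier V \<Longrightarrow> lin_map K W X (b u v)"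
    and b2: "\<And>w. w \<in> carrier W \<Longrightarrow> bilinear K U V X (\<lambda>u v. b u v w)"
  shows "\<exists>\<beta>. bilinear K (tensor_space K U V) W X \<beta> \<and>
    (\<forall>u\<in>carrier U. \<forall>v\<in>carrier V. \<forall>w\<in>carrier W. \<beta> (tens K U V u v) w = b u v w)"
proof -
  interpret U: module K U by fact
  interpret V: module K V by fact
  interpret b0: lin_map K W X "b \<zero>\<^bsub>U\<^esub> \<zero>\<^bsub>V\<^esub>" by (rule b1) simp_all
  let ?T = "tensor_space K U V"
  have "\<forall>w\<in>carrier W. \<exists>h. lin_map K ?T X h \<and>
      (\<forall>u\<in>carrier U. \<forall>v\<in>carrier V. h (tens K U V u v) = b u v w)"
    by (intro ballI tensor_lift[OF U V] b2)
  then obtain h where h: "\<forall>w\<in>carrier W. lin_map K ?T X (h w) \<and>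
      (\<forall>u\<in>carrier U. \<forall>v\<in>carrier V. h w (tens K U V u v) = b u v w)"
    by (elim bchoice[THEN exE])
  then have lin: "lin_map K ?T X (h w)" if "w \<in> carrier W" for w
    using that by simp
  have val: "h w (tens K U V u v) = b u v w"
    if "u \<in> carrier U" "v \<in> carrier V" "w \<in> carrier W" for u v w
    using h that by simp
  have "lin_map K W X (\<lambda>w. h w t)" if t: "t \<in> carrier ?T" for t
  proof (rule lin_map.intro[OF b0.dom b0.cod])
    show "h w t \<in> carrier X" if "w \<in> carrier W" for w
      by (rule lin_map.closed[OF lin[OF that] t])
    \<comment> \<open>Both sides are linear in \<open>t\<close>, so pure tensors suffice, and there
      linearity of \<open>b u v\<close> decides.\<close>
    show "h (w \<oplus>\<^bsub>W\<^esub> w') t = h w t \<oplus>\<^bsub>X\<^esub> h w' t" if w: "w \<in> carrier W" "w' \<in> carrier W" for w w'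
      by (rule tensor_ext[OF U V lin lin_map_add[OF lin lin] _ t])
        (simp_all add: w val lin_map.add[OF b1])
    show "h (a \<odot>\<^bsub>W\<^esub> w) t = a \<odot>\<^bsub>X\<^esub> h w t" if w: "a \<in> carrier K" "w \<in> carrier W" for a w
      by (rule tensor_ext[OF U V lin lin_map_smult[OF lin w(1)] _ t])
        (simp_all add: w val lin_map.smult[OF b1])
  qed
  then have "bilinear K ?T W X (\<lambda>t w. h w t)"
    unfolding bilinear_def using lin by simp
  then show ?thesis using val by (intro exI[of _ "\<lambda>t w. h w t"]) simp
qed

lemma tensor_assoc:
  assumes U: "module K U" and V: "module K V" and W: "module K W"
  shows "lin_map K (tensor_space K (tensor_space K U V) W) (tensor_space K U (tensor_space K V W))
      (tensor_assoc K U V W)"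
    and "u \<in> carrier U \<Longrightarrow> v \<in> carrier V \<Longrightarrow> w \<in> carrier W \<Longrightarrow>
      tensor_assoc K U V W (tens K (tensor_space K U V) W (tens K U V u v) w) =
      tens K U (tensor_space K V W) u (tens K V W v w)"
proof -
  let ?UV = "tensor_space K U V" and ?VW = "tensor_space K V W"
  let ?S = "tensor_space K ?UV W" and ?T = "tensor_space K U ?VW"
  let ?b = "\<lambda>u v w. tens K U ?VW u (tens K V W v w)"
  note UV = module_tensor_space[OF U V] and VW = module_tensor_space[OF V W]
  note T = module_tensor_space[OF U VW]
  have "lin_map K W ?T (?b u v)" if "u \<in> carrier U" "v \<in> carrier V" for u v
    by (rule lin_map_comp[OF lin_map_tens_left[OF V W that(2)] lin_map_tens_left[OF U VW that(1)]])
  note b1 = this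
  have b2: "bilinear K U V ?T (\<lambda>u v. ?b u v w)" if w: "w \<in> carrier W" for w
    unfolding bilinear_def
  proof (intro conjI ballI)
    show "lin_map K V ?T (\<lambda>v. ?b u v w)" if "u \<in> carrier U" for u
      by (rule lin_map_comp[OF lin_map_tens_right[OF V W w] lin_map_tens_left[OF U VW that]])
    show "lin_map K U ?T (\<lambda>u. ?b u v w)" if "v \<in> carrier V" for v
      by (rule lin_map_tens_right[OF U VW tens_closed[OF V W that w]])
  qed
  obtain \<beta> where \<beta>: "bilinear K ?UV W ?T \<beta>"
    "\<forall>u\<in>carrier U. \<forall>v\<in>carrier V. \<forall>w\<in>carrier W. \<beta> (tens K U V u v) w = ?b u v w"
  proof -
    note * = bilinear_lift_left[of K U V W ?T ?b, OF U V]
    show ?thesis by (rule exE[OF *], rule b1, assumption+, rule b2, assumption, elim conjE, rule that)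
  qed
  obtain h where h: "lin_map K ?S ?T h"
    "\<forall>t\<in>carrier ?UV. \<forall>w\<in>carrier W. h (tens K ?UV W t w) = \<beta> t w"
    using tensor_lift[OF UV W \<beta>(1)] by (elim exE conjE)
  have val: "h (tens K ?UV W (tens K U V u v) w) = ?b u v w"
    if "u \<in> carrier U" "v \<in> carrier V" "w \<in> carrier W" for u v w
    using that h(2) \<beta>(2) tens_closed[OF U V] by simp
  have eq: "tensor_assoc K U V W = restrict h (carrier ?S)"
    unfolding tensor_assoc_def
  proof (rule the_linear_eq[OF h(1)])
    show "\<forall>u\<in>carrier U. \<forall>v\<in>carrier V. \<forall>w\<in>carrier W.
        restrict h (carrier ?S) (tens K ?UV W (tens K U V u v) w) = ?b u v w"
      using val tens_closed[OF UV W] tens_closed[OF U V] by simp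
    show "h' x = h x" if h': "lin_map K ?S ?T h'" "\<forall>u\<in>carrier U. \<forall>v\<in>carrier V. \<forall>w\<in>carrier W.
        h' (tens K ?UV W (tens K U V u v) w) = ?b u v w" and x: "x \<in> carrier ?S" for h' x
    proof (rule tensor_ext[OF UV W h'(1) h(1) _ x])
      \<comment> \<open>Here \<open>t\<close> need not be a pure tensor; a second appeal to
        extensionality over \<open>U \<otimes> V\<close>, with \<open>w\<close> fixed, reduces it to
        one.\<close>
      fix t w assume t: "t \<in> carrier ?UV" and w: "w \<in> carrier W"
      show "h' (tens K ?UV W t w) = h (tens K ?UV W t w)"
        by (rule tensor_ext[OF U V lin_map_comp[OF lin_map_tens_right[OF UV W w] h'(1)]
              lin_map_comp[OF lin_map_tens_right[OF UV W w] h(1)] _ t])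
          (simp add: val h'(2) w)
    qed
  qed
  show "lin_map K ?S ?T (tensor_assoc K U V W)"
    unfolding eq by (rule lin_map_restrict[OF h(1)])
  show "tensor_assoc K U V W (tens K ?UV W (tens K U V u v) w) = ?b u v w"
    if "u \<in> carrier U" "v \<in> carrier V" "w \<in> carrier W"
    unfolding eq using val that tens_closed[OF UV W] tens_closed[OF U V] by simp
qed

text \<open>Four factors are reduced to the three of \<open>bilinear_lift_left\<close>: for fixed
  \<open>u\<close> and \<open>v\<close> the map on \<open>V' \<otimes> W\<close> is the tensor
  product of the linear maps \<open>tens K U V' u\<close> and \<open>tens K V W v\<close>, so
  \<open>V' \<otimes> W\<close> can play the part of the third factor.\<close>

lemma tensor_middle_swap:
  assumes U: "module K U" and V: "module K V" and V': "module K V'" and W: "module K W"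
  shows "lin_map K (tensor_space K (tensor_space K U V) (tensor_space K V' W))
      (tensor_space K (tensor_space K U V') (tensor_space K V W)) (tensor_middle_swap K U V V' W)"
    and "u \<in> carrier U \<Longrightarrow> v \<in> carrier V \<Longrightarrow> v' \<in> carrier V' \<Longrightarrow> w \<in> carrier W \<Longrightarrow>
      tensor_middle_swap K U V V' W
        (tens K (tensor_space K U V) (tensor_space K V' W) (tens K U V u v) (tens K V' W v' w)) =
      tens K (tensor_space K U V') (tensor_space K V W) (tens K U V' u v') (tens K V W v w)"
proof -
  let ?UV = "tensor_space K U V" and ?VW = "tensor_space K V W"
  let ?UV' = "tensor_space K U V'" and ?VW' = "tensor_space K V' W"
  let ?S = "tensor_space K ?UV ?VW'" and ?T = "tensor_space K ?UV' ?VW"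
  let ?c = "\<lambda>u v v' w. tens K ?UV' ?VW (tens K U V' u v') (tens K V W v w)"
  let ?b = "\<lambda>u v. tensor_map K V' ?UV' W ?VW (tens K U V' u) (tens K V W v)"
  note UV = module_tensor_space[OF U V] and VW = module_tensor_space[OF V W]
  note UV' = module_tensor_space[OF U V'] and VW' = module_tensor_space[OF V' W]
  note T = module_tensor_space[OF UV' VW]
  have b: "lin_map K ?VW' ?T (?b u v)" if "u \<in> carrier U" "v \<in> carrier V" for u v
    by (rule tensor_map(1)[OF lin_map_tens_left[OF U V' that(1)] lin_map_tens_left[OF V W that(2)]])
  have bval: "?b u v (tens K V' W v' w) = ?c u v v' w"
    if "u \<in> carrier U" "v \<in> carrier V" "v' \<in> carrier V'" "w \<in> carrier W" for u v v' w
    by (rule tensor_map(2)[OF lin_map_tens_left[OF U V' that(1)] lin_map_tens_left[OF V W that(2)]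
          that(3,4)])
  have clin1: "lin_map K U ?T (\<lambda>u. ?c u v v' w)"
    if "v \<in> carrier V" "v' \<in> carrier V'" "w \<in> carrier W" for v v' w
    by (rule lin_map_comp[OF lin_map_tens_right[OF U V' that(2)]
          lin_map_tens_right[OF UV' VW tens_closed[OF V W that(1,3)]]])
  have clin2: "lin_map K V ?T (\<lambda>v. ?c u v v' w)"
    if "u \<in> carrier U" "v' \<in> carrier V'" "w \<in> carrier W" for u v' w
    by (rule lin_map_comp[OF lin_map_tens_right[OF V W that(3)]
          lin_map_tens_left[OF UV' VW tens_closed[OF U V' that(1,2)]]])
  interpret U: module K U by fact
  interpret V: module K V by fact
  have b2: "bilinear K U V ?T (\<lambda>u v. ?b u v s)" if s: "s \<in> carrier ?VW'" for s
    unfolding bilinear_def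
  proof (intro conjI ballI)
    show "lin_map K U ?T (\<lambda>u. ?b u v s)" if v: "v \<in> carrier V" for v
    proof (rule lin_map.intro[OF U T])
      show "?b u v s \<in> carrier ?T" if "u \<in> carrier U" for u
        by (rule lin_map.closed[OF b[OF that v] s])
      show "?b (u \<oplus>\<^bsub>U\<^esub> u') v s = ?b u v s \<oplus>\<^bsub>?T\<^esub> ?b u' v s"
        if "u \<in> carrier U" "u' \<in> carrier U" for u u'
        by (rule tensor_ext[OF V' W b lin_map_add[OF b b] _ s])
          (simp_all add: that v bval lin_map.add[OF clin1])
      show "?b (a \<odot>\<^bsub>U\<^esub> u) v s = a \<odot>\<^bsub>?T\<^esub> ?b u v s"
        if "a \<in> carrier K" "u \<in> carrier U" for a u
        by (rule tensor_ext[OF V' W b lin_map_smult[OF b that(1)] _ s])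
          (simp_all add: that v bval lin_map.smult[OF clin1])
    qed
    show "lin_map K V ?T (\<lambda>v. ?b u v s)" if u: "u \<in> carrier U" for u
    proof (rule lin_map.intro[OF V T])
      show "?b u v s \<in> carrier ?T" if "v \<in> carrier V" for v
        by (rule lin_map.closed[OF b[OF u that] s])
      show "?b u (v \<oplus>\<^bsub>V\<^esub> v') s = ?b u v s \<oplus>\<^bsub>?T\<^esub> ?b u v' s"
        if "v \<in> carrier V" "v' \<in> carrier V" for v v'
        by (rule tensor_ext[OF V' W b lin_map_add[OF b b] _ s])
          (simp_all add: that u bval lin_map.add[OF clin2])
      show "?b u (a \<odot>\<^bsub>V\<^esub> v) s = a \<odot>\<^bsub>?T\<^esub> ?b u v s"
        if "a \<in> carrier K" "v \<in> carrier V" for a v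
        by (rule tensor_ext[OF V' W b lin_map_smult[OF b that(1)] _ s])
          (simp_all add: that u bval lin_map.smult[OF clin2])
    qed
  qed
  obtain \<beta> where \<beta>: "bilinear K ?UV ?VW' ?T \<beta>"
    "\<forall>u\<in>carrier U. \<forall>v\<in>carrier V. \<forall>s\<in>carrier ?VW'. \<beta> (tens K U V u v) s = ?b u v s"
  proof -
    note * = bilinear_lift_left[of K U V ?VW' ?T ?b, OF U V]
    show ?thesis by (rule exE[OF *], rule b, assumption+, rule b2, assumption, elim conjE, rule that)
  qed
  obtain h where h: "lin_map K ?S ?T h"
    "\<forall>t\<in>carrier ?UV. \<forall>s\<in>carrier ?VW'. h (tens K ?UV ?VW' t s) = \<beta> t s"
    using tensor_lift[OF UV VW' \<beta>(1)] by (elim exE conjE)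
  have val: "h (tens K ?UV ?VW' (tens K U V u v) (tens K V' W v' w)) = ?c u v v' w"
    if "u \<in> carrier U" "v \<in> carrier V" "v' \<in> carrier V'" "w \<in> carrier W" for u v v' w
    using that h(2) \<beta>(2) tens_closed[OF U V] tens_closed[OF V' W] bval by simp
  have eq: "tensor_middle_swap K U V V' W = restrict h (carrier ?S)"
    unfolding tensor_middle_swap_def
  proof (rule the_linear_eq[OF h(1)])
    show "\<forall>u\<in>carrier U. \<forall>v\<in>carrier V. \<forall>v'\<in>carrier V'. \<forall>w\<in>carrier W.
        restrict h (carrier ?S) (tens K ?UV ?VW' (tens K U V u v) (tens K V' W v' w)) = ?c u v v' w"
      using val tens_closed[OF UV VW'] tens_closed[OF U V] tens_closed[OF V' W] by simp
    show "h' x = h x" if h': "lin_map K ?S ?T h'"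
      "\<forall>u\<in>carrier U. \<forall>v\<in>carrier V. \<forall>v'\<in>carrier V'. \<forall>w\<in>carrier W.
        h' (tens K ?UV ?VW' (tens K U V u v) (tens K V' W v' w)) = ?c u v v' w"
      and x: "x \<in> carrier ?S" for h' x
    proof (rule tensor_ext[OF UV VW' h'(1) h(1) _ x])
      fix t s assume t: "t \<in> carrier ?UV" and s: "s \<in> carrier ?VW'"
      show "h' (tens K ?UV ?VW' t s) = h (tens K ?UV ?VW' t s)"
      proof (rule tensor_ext[OF U V lin_map_comp[OF lin_map_tens_right[OF UV VW' s] h'(1)]
            lin_map_comp[OF lin_map_tens_right[OF UV VW' s] h(1)] _ t])
        fix u v assume uv: "u \<in> carrier U" "v \<in> carrier V"
        note t' = tens_closed[OF U V uv]
        show "h' (tens K ?UV ?VW' (tens K U V u v) s) = h (tens K ?UV ?VW' (tens K U V u v) s)"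
          by (rule tensor_ext[OF V' W lin_map_comp[OF lin_map_tens_left[OF UV VW' t'] h'(1)]
                lin_map_comp[OF lin_map_tens_left[OF UV VW' t'] h(1)] _ s])
            (simp add: val h'(2) uv)
      qed
    qed
  qed
  show "lin_map K ?S ?T (tensor_middle_swap K U V V' W)"
    unfolding eq by (rule lin_map_restrict[OF h(1)])
  show "tensor_middle_swap K U V V' W
      (tens K ?UV ?VW' (tens K U V u v) (tens K V' W v' w)) = ?c u v v' w"
    if "u \<in> carrier U" "v \<in> carrier V" "v' \<in> carrier V'" "w \<in> carrier W"
    unfolding eq using val that tens_closed[OF UV VW'] tens_closed[OF U V] tens_closed[OF V' W] by simp
qed

section \<open>Chord words\<close>

text \<open>In this form the condition depends on multiplicities alone, so it survives permuting
  letters and deleting all occurrences of a letter.\<close>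

lemma chord_word_iff: "chord_word w \<longleftrightarrow> (\<forall>x. count_list w x \<in> {0, 2})"
  unfolding chord_word_def by (metis count_list_0_iff insert_iff singletonD zero_neq_numeral)

lemma chord_word_cong: "(\<And>x. count_list w x = count_list w' x) \<Longrightarrow> chord_word w = chord_word w'"
  by (simp add: chord_word_iff)

lemma chord_word_append:
  assumes "set u \<inter> set w = {}"
  shows "chord_word (u @ w) \<longleftrightarrow> chord_word u \<and> chord_word w"
proof -
  have "count_list u x = 0 \<or> count_list w x = 0" for x
    using assms by (auto simp: count_list_0_iff)
  then show ?thesis
    unfolding chord_word_iff count_list_append by (metis add_0 add_cancel_left_right insertI1)
qed

lemma chord_word_map:
  assumes "inj_on \<sigma> (set w)"
  shows "chord_word (map \<sigma> w) = chord_word w"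
  using assms by (simp add: chord_word_def count_list_inj_map)

lemma count_list_filter: "count_list (filter Q w) x = (if Q x then count_list w x else 0)"
  by (induction w) auto

lemma chord_word_subword: "chord_word w \<Longrightarrow> chord_word (subword I w)"
  by (simp add: chord_word_iff subword_def count_list_filter)

lemma subword_append: "subword I (u @ w) = subword I u @ subword I w"
  by (simp add: subword_def)

lemma subword_Cons: "subword I (x # w) = (if x \<in> I then x # subword I w else subword I w)"
  by (simp add: subword_def)

lemma subword_Nil: "subword I [] = []"
  by (simp add: subword_def)

lemma set_subword: "set (subword I w) = I \<inter> set w"
  by (auto simp: subword_def)

lemma subword_cong: "(\<And>x. x \<in> set w \<Longrightarrow> x \<in> I \<longleftrightarrow> x \<in> J) \<Longrightarrow> subword I w = subword J w"
  by (simp add: subword_def cong: filter_cong)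

lemma subword_subword: "subword I (subword J w) = subword (I \<inter> J) w"
  by (simp add: subword_def conj_commute)

lemma subword_id: "set w \<subseteq> I \<Longrightarrow> subword I w = w"
  by (simp add: subword_def subset_eq)

lemma subword_map:
  assumes "inj_on \<sigma> (set w)" "I \<subseteq> set w"
  shows "subword (\<sigma> ` I) (map \<sigma> w) = map \<sigma> (subword I w)"
  unfolding subword_def filter_map o_def
  using assms by (intro arg_cong[of _ _ "map \<sigma>"] filter_cong refl) (auto dest: inj_onD)

lemma same_diagram_rotate: "chord_word (u @ w) \<Longrightarrow> same_diagram (u @ w) (w @ u)"
  unfolding same_diagram_def
  by (intro conjI exI[of _ "length u"] exI[of _ id])
    (simp_all add: rotate_append chord_word_iff add.commute)

lemma same_diagram_map:
  assumes "chord_word w" "inj_on \<sigma> (set w)" "\<And>x. x \<in> set w \<Longrightarrow> snd (\<sigma> x) = snd x"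
  shows "same_diagram w (map \<sigma> w)"
  unfolding same_diagram_def using assms
  by (intro conjI exI[of _ 0] exI[of _ \<sigma>]) (simp_all add: chord_word_map)

text \<open>Equality of diagrams is generated by two moves, carrying the first letter to the end and
  relabelling; a function on words descends to diagrams once it respects these.\<close>

lemma same_diagram_invariant:
  assumes "same_diagram w w'"
    and rot: "\<And>x u. chord_word (x # u) \<Longrightarrow> F (u @ [x]) = F (x # u)"
    and rel: "\<And>\<sigma> u. \<lbrakk>chord_word u; inj_on \<sigma> (set u); \<And>x. x \<in> set u \<Longrightarrow> snd (\<sigma> x) = snd x\<rbrakk>
      \<Longrightarrow> F (map \<sigma> u) = F u"
  shows "F w' = F w"
proof -
  from assms(1) obtain n \<sigma> where w: "chord_word w" "inj_on \<sigma> (set w)"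
    "\<And>x. x \<in> set w \<Longrightarrow> snd (\<sigma> x) = snd x" and w': "w' = map \<sigma> (rotate n w)"
    unfolding same_diagram_def by metis
  have rotate: "chord_word (rotate n w) \<and> F (rotate n w) = F w" for n
  proof (induction n)
    case (Suc n)
    show ?case
    proof (cases "rotate n w")
      case (Cons x u)
      then have "rotate (Suc n) w = u @ [x]" by simp
      moreover have "chord_word (u @ [x])"
        using Suc Cons chord_word_cong[of "u @ [x]" "x # u"] by simp
      ultimately show ?thesis using rot[of x u] Suc Cons by simp
    qed (use Suc in simp)
  qed (use w in simp)
  show ?thesis
    unfolding w' using rotate[of n] rel[of "rotate n w" \<sigma>] w by simp
qed

lemma diagram_of_eq: "same_diagram w w' \<Longrightarrow> diagram_of w = diagram_of w'"
  using Quotient3_rel[OF Quotient3_diagram] by blast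

lemma same_diagram_rep: "chord_word w \<Longrightarrow> same_diagram w (rep_diagram (diagram_of w))"
  by (metis Quotient3_rel Quotient3_diagram Quotient3_abs_rep Quotient3_rep_reflp same_diagram_refl)

text \<open>Adding a number larger than every label in \<open>X\<close> to all labels makes a
  representative avoid \<open>X\<close>. This is how two words are brought into the position in
  which the products are specified.\<close>

lemma diagram_obtain_word:
  assumes "finite X"
  obtains w where "chord_word w" "diagram_of w = d" "set w \<inter> X = {}"
proof -
  let ?w = "rep_diagram d"
  have w: "chord_word ?w"
    using Quotient3_rep_reflp[OF Quotient3_diagram] by (auto simp: same_diagram_def)
  define N where "N = Suc (Max (insert 0 (fst ` X)))"
  define \<sigma> where "\<sigma> = (\<lambda>x :: chord. (fst x + N, snd x))"
  have "inj_on \<sigma> (set ?w)" by (auto simp: inj_on_def \<sigma>_def)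
  then have same: "same_diagram ?w (map \<sigma> ?w)"
    using w by (intro same_diagram_map) (simp_all add: \<sigma>_def)
  have "fst x < N" if "x \<in> X" for x
    using that assms Max_ge[of "insert 0 (fst ` X)" "fst x"] by (simp add: N_def less_Suc_eq_le)
  then have "set (map \<sigma> ?w) \<inter> X = {}"
    by (force simp: \<sigma>_def)
  moreover have "diagram_of (map \<sigma> ?w) = d"
    using diagram_of_eq[OF same] Quotient3_abs_rep[OF Quotient3_diagram] by simp
  moreover have "chord_word (map \<sigma> ?w)" using same by (simp add: same_diagram_def)
  ultimately show thesis by (intro that)
qed

lemma black_diagram_of: "chord_word w \<Longrightarrow> black (diagram_of w) = black_word w"
  by (rule black.abs_eq) (rule same_diagram_refl)

lemma black_word_append: "black_word (u @ w) \<longleftrightarrow> black_word u \<and> black_word w"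
  by (auto simp: black_word_def)

lemma black_word_subword: "black_word w \<Longrightarrow> black_word (subword I w)"
  by (auto simp: black_word_def set_subword)

lemma black_word_map: "(\<And>x. x \<in> set w \<Longrightarrow> snd (\<sigma> x) = snd x) \<Longrightarrow> black_word (map \<sigma> w) = black_word w"
  by (simp add: black_word_def)

lemma set_jump_word: "set (jump_word a b c v u x) = insert u (set (a @ [v] @ b @ [v] @ c))"
  by (cases x) auto

lemma count_jump_word:
  "count_list (jump_word a b c v u x) y = (if y = u then 2 else 0) + count_list (a @ [v] @ b @ [v] @ c) y"
  by (cases x) auto

lemma chord_word_jump_word:
  assumes "chord_word (a @ [v] @ b @ [v] @ c)" "u \<notin> set (a @ [v] @ b @ [v] @ c)"
  shows "chord_word (jump_word a b c v u x)"
proof -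
  have "count_list (a @ [v] @ b @ [v] @ c) u = 0"
    using assms(2) by (subst count_list_0_iff)
  then show ?thesis
    using assms(1) unfolding chord_word_iff count_jump_word by auto
qed

lemma map_jump_word:
  "map \<sigma> (jump_word a b c v u x) = jump_word (map \<sigma> a) (map \<sigma> b) (map \<sigma> c) (\<sigma> v) (\<sigma> u) x"
  by (cases x) auto

lemma jump_word_append: "jump_word a b c v u x @ w = jump_word a b (c @ w) v u x"
  by (cases x) auto

text \<open>The label \<open>k\<close> is new with either framing, as it must be: the relation for a
  disorienting \<open>v\<close> contains jumping chords of both framings.\<close>

lemma jump_config_fresh: "jump_config a b c v k \<Longrightarrow> (k, \<phi>) \<notin> set (a @ [v] @ b @ [v] @ c)"
  unfolding jump_config_def by (metis fst_conv image_eqI)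

lemma jump_config_word: "jump_config a b c v k \<Longrightarrow> chord_word (jump_word a b c v (k, \<phi>) x)"
  using jump_config_fresh[of a b c v k \<phi>] by (intro chord_word_jump_word) (simp_all add: jump_config_def)

text \<open>The relation is a property of an arbitrary function on words with values in a space, so
  that it can be stated both for the class maps, where it holds, and for candidates to be lifted,
  where it has to be checked. Adding 1 in \<open>bit\<close> gives the other framing.\<close>

definition four_term ::
  "('k, 'v) module \<Rightarrow> (chord list \<Rightarrow> 'v) \<Rightarrow> chord list \<Rightarrow> chord list \<Rightarrow> chord list \<Rightarrow> chord \<Rightarrow> chord \<Rightarrow> bool"
  where
  "four_term V F a b c v u \<longleftrightarrow>
     F (jump_word a b c v u Before_p) \<ominus>\<^bsub>V\<^esub> F (jump_word a b c v u After_p) =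
     (if snd v = 0
      then F (jump_word a b c v u After_q) \<ominus>\<^bsub>V\<^esub> F (jump_word a b c v u Before_q)
      else F (jump_word a b c v (fst u, snd u + 1) Before_q) \<ominus>\<^bsub>V\<^esub>
        F (jump_word a b c v (fst u, snd u + 1) After_q))"


section \<open>The diagram spaces by generators and relations\<close>

lemma M_presentation:
  assumes "cring K"
  shows "presentation K UNIV (framed_4T_relators K)"
proof -
  interpret F: module K "free_space K UNIV :: ('a, diagram \<Rightarrow> 'a) module"
    by (rule module_free_space[OF assms])
  have "framed_4T_relators K \<subseteq> carrier (free_space K UNIV)"
    unfolding framed_4T_relators_def framed_diagram_space_def Let_def
    by (intro Un_least subsetI; elim CollectE exE conjE; simp add: basis_vec_carrier[OF assms])
  then show ?thesis using assms by (simp add: presentation_def presentation_axioms_def)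
qed

lemma A_presentation:
  assumes "cring K"
  shows "presentation K {d. black d} (ordinary_4T_relators K)"
proof -
  interpret F: module K "free_space K {d. black d}"
    by (rule module_free_space[OF assms])
  have e: "basis_vec K (diagram_of (jump_word a b c v (k, 0) x)) \<in> carrier (free_space K {d. black d})"
    if "jump_config a b c v k" "black_word (a @ [v] @ b @ [v] @ c)" for a b c v k x
    using that black_diagram_of[OF jump_config_word[OF that(1)]]
    by (intro basis_vec_carrier[OF assms]) (auto simp: black_word_def set_jump_word)
  have "ordinary_4T_relators K \<subseteq> carrier (free_space K {d. black d})"
    unfolding ordinary_4T_relators_def black_diagram_space_def Let_def
    by (intro subsetI; elim CollectE exE conjE; simp only: F.M.minus_closed e)
  then show ?thesis using assms by (simp add: presentation_def presentation_axioms_def)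
qed

locale chord_spaces = cring K for K :: "('k, 'm) ring_scheme" (structure)
begin

abbreviation "\<M> \<equiv> M_space K"
abbreviation "\<A> \<equiv> A_space K"
abbreviation "clM \<equiv> M_class K"
abbreviation "clA \<equiv> A_class K"

interpretation PM: presentation K UNIV "framed_4T_relators K"
  by (rule M_presentation[OF is_cring])

interpretation PA: presentation K "{d. black d}" "ordinary_4T_relators K"
  by (rule A_presentation[OF is_cring])

lemma M_space_presented: "\<M> = presented K UNIV (framed_4T_relators K)"
  by (simp add: M_space_def presented_def framed_null_def framed_diagram_space_def)

lemma A_space_presented: "\<A> = presented K {d. black d} (ordinary_4T_relators K)"
  by (simp add: A_space_def presented_def black_null_def black_diagram_space_def)

lemma clM_eq: "clM w = PM.gen (diagram_of w)"
  by (simp add: M_class_def pgen_def framed_null_def framed_diagram_space_def)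

lemma clA_eq: "clA w = PA.gen (diagram_of w)"
  by (simp add: A_class_def pgen_def black_null_def black_diagram_space_def)

lemma module_M: "module K \<M>"
  unfolding M_space_presented by (rule PM.module_presented)

lemma module_A: "module K \<A>"
  unfolding A_space_presented by (rule PA.module_presented)

lemma clM_closed: "clM w \<in> carrier \<M>"
  unfolding M_space_presented clM_eq by (rule PM.gen_closed) simp

lemma clA_closed: "chord_word w \<Longrightarrow> black_word w \<Longrightarrow> clA w \<in> carrier \<A>"
  unfolding A_space_presented clA_eq by (rule PA.gen_closed) (simp add: black_diagram_of)

lemma clM_cong: "same_diagram w w' \<Longrightarrow> clM w = clM w'"
  by (simp add: clM_eq diagram_of_eq[of w w'])

lemma clA_cong: "same_diagram w w' \<Longrightarrow> clA w = clA w'"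
  by (simp add: clA_eq diagram_of_eq[of w w'])

text \<open>The finite set \<open>X\<close> of chords to be avoided is what makes this fit the
  products: the equation need only be checked on words having no chord in common with words already
  fixed.\<close>

lemma M_ext:
  assumes "lin_map K \<M> W f" "lin_map K \<M> W g" and X: "finite X"
    and eq: "\<And>w. \<lbrakk>chord_word w; set w \<inter> X = {}\<rbrakk> \<Longrightarrow> f (clM w) = g (clM w)"
    and v: "v \<in> carrier \<M>"
  shows "f v = g v"
proof (rule PM.lin_map_ext)
  fix d :: diagram
  obtain w where "chord_word w" "diagram_of w = d" "set w \<inter> X = {}"
    using diagram_obtain_word[OF X] .
  then show "f (PM.gen d) = g (PM.gen d)" using eq[of w] by (simp add: clM_eq)
qed (use assms(1,2,5) in \<open>simp_all only: M_space_presented\<close>)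

lemma A_ext:
  assumes "lin_map K \<A> W f" "lin_map K \<A> W g" and X: "finite X"
    and eq: "\<And>w. \<lbrakk>chord_word w; black_word w; set w \<inter> X = {}\<rbrakk> \<Longrightarrow> f (clA w) = g (clA w)"
    and v: "v \<in> carrier \<A>"
  shows "f v = g v"
proof (rule PA.lin_map_ext)
  fix d assume d: "d \<in> {d. black d}"
  obtain w where "chord_word w" "diagram_of w = d" "set w \<inter> X = {}"
    using diagram_obtain_word[OF X] .
  then show "f (PA.gen d) = g (PA.gen d)"
    using eq[of w] d black_diagram_of[of w] by (simp add: clA_eq)
qed (use assms(1,2,5) in \<open>simp_all only: A_space_presented\<close>)

lemma A_induct:
  assumes a: "a \<in> carrier \<A>" and zero: "Pr \<zero>\<^bsub>\<A>\<^esub>"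
    and add: "\<And>a b. \<lbrakk>a \<in> carrier \<A>; b \<in> carrier \<A>; Pr a; Pr b\<rbrakk> \<Longrightarrow> Pr (a \<oplus>\<^bsub>\<A>\<^esub> b)"
    and smult: "\<And>r a. \<lbrakk>r \<in> carrier K; a \<in> carrier \<A>; Pr a\<rbrakk> \<Longrightarrow> Pr (r \<odot>\<^bsub>\<A>\<^esub> a)"
    and gen: "\<And>w. \<lbrakk>chord_word w; black_word w\<rbrakk> \<Longrightarrow> Pr (clA w)"
  shows "Pr a"
  using a[unfolded A_space_presented]
proof (rule PA.presented_induct)
  fix d assume d: "d \<in> {d. black d}"
  obtain w where "chord_word w" "diagram_of w = d" "set w \<inter> {} = {}"
    using diagram_obtain_word[OF finite.emptyI] .
  then show "Pr (PA.gen d)"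
    using gen[of w] d black_diagram_of[of w] by (simp add: clA_eq)
qed (use zero add smult in \<open>simp_all only: A_space_presented\<close>)

lemma M_four_term:
  assumes "jump_config a b c v k"
  shows "four_term \<M> clM a b c v (k, \<phi>)"
proof -
  let ?D = "\<lambda>\<phi> x. basis_vec K (diagram_of (jump_word a b c v (k, \<phi>) x))"
  have D: "?D \<phi> x \<in> carrier (free_space K UNIV)" for \<phi> x
    by (rule basis_vec_carrier[OF is_cring]) simp
  note R = framed_4T_relators_def[of K, unfolded framed_diagram_space_def, unfolded Let_def]
  have cls: "PM.cls (?D \<phi> x) = clM (jump_word a b c v (k, \<phi>) x)" for \<phi> x
    by (simp only: clM_eq PM.cls_basis)
  show ?thesis
  proof (cases "snd v = 0")
    case True
    have "(?D \<phi> Before_p \<ominus>\<^bsub>PM.F\<^esub> ?D \<phi> After_p) \<ominus>\<^bsub>PM.F\<^esub> (?D \<phi> After_q \<ominus>\<^bsub>PM.F\<^esub> ?D \<phi> Before_q)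
        \<in> framed_4T_relators K"
      unfolding R by (rule UnI1, rule CollectI) (use assms True in blast)
    from PM.cls_eq_if_relator[OF this PM.F.minus_closed[OF D D] PM.F.minus_closed[OF D D]]
    show ?thesis
      unfolding four_term_def M_space_presented by (simp only: PM.cls.map_minus[OF D D] cls True if_True simp_thms)
  next
    case False
    then have v: "snd v = 1" by simp
    have "(?D \<phi> Before_p \<ominus>\<^bsub>PM.F\<^esub> ?D \<phi> After_p) \<ominus>\<^bsub>PM.F\<^esub>
        (?D (\<phi> + 1) Before_q \<ominus>\<^bsub>PM.F\<^esub> ?D (\<phi> + 1) After_q) \<in> framed_4T_relators K"
      unfolding R by (rule UnI2, rule CollectI) (use assms v in blast)
    from PM.cls_eq_if_relator[OF this PM.F.minus_closed[OF D D] PM.F.minus_closed[OF D D]]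
    show ?thesis
      unfolding four_term_def M_space_presented
      by (simp only: PM.cls.map_minus[OF D D] cls False if_False fst_conv snd_conv)
  qed
qed

lemma A_four_term:
  assumes "jump_config a b c v k" "black_word (a @ [v] @ b @ [v] @ c)"
  shows "four_term \<A> clA a b c v (k, 0)"
proof -
  let ?D = "\<lambda>x. basis_vec K (diagram_of (jump_word a b c v (k, 0) x))"
  have D: "?D x \<in> carrier (free_space K {d. black d})" for x
    using assms black_diagram_of[OF jump_config_word[OF assms(1)]]
    by (intro basis_vec_carrier[OF is_cring]) (auto simp: black_word_def set_jump_word)
  note R = ordinary_4T_relators_def[of K, unfolded black_diagram_space_def, unfolded Let_def]
  have cls: "PA.cls (?D x) = clA (jump_word a b c v (k, 0) x)" for x
    by (simp only: clA_eq PA.cls_basis)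
  have v: "snd v = 0" using assms(2) by (simp add: black_word_def)
  have "(?D Before_p \<ominus>\<^bsub>PA.F\<^esub> ?D After_p) \<ominus>\<^bsub>PA.F\<^esub> (?D After_q \<ominus>\<^bsub>PA.F\<^esub> ?D Before_q)
      \<in> ordinary_4T_relators K"
    unfolding R by (rule CollectI) (use assms in blast)
  from PA.cls_eq_if_relator[OF this PA.F.minus_closed[OF D D] PA.F.minus_closed[OF D D]]
  show ?thesis
    unfolding four_term_def A_space_presented by (simp only: PA.cls.map_minus[OF D D] cls v if_True simp_thms)
qed

text \<open>The way maps out of \<open>\<M>\<close> are built from functions on words. The value at
  a diagram is taken at its chosen representative; invariance under the two moves makes this agree
  with the value at every other word for the diagram.\<close>

lemma M_lift:
  assumes W: "module K W" and F: "\<And>w. chord_word w \<Longrightarrow> F w \<in> carrier W"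
    and rot: "\<And>x u. chord_word (x # u) \<Longrightarrow> F (u @ [x]) = F (x # u)"
    and rel: "\<And>\<sigma> u. \<lbrakk>chord_word u; inj_on \<sigma> (set u); \<And>x. x \<in> set u \<Longrightarrow> snd (\<sigma> x) = snd x\<rbrakk>
      \<Longrightarrow> F (map \<sigma> u) = F u"
    and 4: "\<And>a b c v k \<phi>. jump_config a b c v k \<Longrightarrow> four_term W F a b c v (k, \<phi>)"
  shows "\<exists>h. lin_map K \<M> W h \<and> (\<forall>w. chord_word w \<longrightarrow> h (clM w) = F w)"
proof -
  have F_rep: "F (rep_diagram (diagram_of w)) = F w" if "chord_word w" for w
    by (rule same_diagram_invariant[OF same_diagram_rep[OF that]]) (fact rot, fact rel)
  have "\<exists>h. lin_map K PM.P W h \<and> (\<forall>d\<in>UNIV. h (PM.gen d) = F (rep_diagram d))"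
  proof (rule PM.lift_presented[OF W])
    show "F (rep_diagram d) \<in> carrier W" for d
      using Quotient3_rep_reflp[OF Quotient3_diagram, of d] by (intro F) (simp add: same_diagram_def)
    fix h r assume h: "lin_map K PM.F W h"
      "\<And>d. d \<in> UNIV \<Longrightarrow> h (basis_vec K d) = F (rep_diagram d)"
      and r: "r \<in> framed_4T_relators K"
    interpret h: lin_map K PM.F W h by (rule h(1))
    have e: "basis_vec K d \<in> carrier PM.F" for d :: diagram
      by (rule basis_vec_carrier[OF is_cring]) simp
    have he: "h (basis_vec K (diagram_of (jump_word a b c v (k, \<phi>) x))) = F (jump_word a b c v (k, \<phi>) x)"
      if "jump_config a b c v k" for a b c v k \<phi> x
      using h(2) F_rep[OF jump_config_word[OF that]] by simp
    note simps = h.map_minus PM.F.minus_closed e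
    from r[unfolded framed_4T_relators_def Let_def framed_diagram_space_def]
    show "h r = \<zero>\<^bsub>W\<^esub>"
    proof (elim UnE CollectE exE conjE)
      fix a b c v k \<phi>
      let ?D = "\<lambda>\<phi> x. basis_vec K (diagram_of (jump_word a b c v (k, \<phi>) x))"
      assume r: "r = (?D \<phi> Before_p \<ominus>\<^bsub>PM.F\<^esub> ?D \<phi> After_p) \<ominus>\<^bsub>PM.F\<^esub> (?D \<phi> After_q \<ominus>\<^bsub>PM.F\<^esub> ?D \<phi> Before_q)"
        and jc: "jump_config a b c v k" and v: "snd v = 0"
      show "h r = \<zero>\<^bsub>W\<^esub>"
        using 4[OF jc, of \<phi>] v unfolding r four_term_def
        by (subst h.map_minus_eq_zero_iff) (simp_all only: simps he[OF jc] if_True simp_thms)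
    next
      fix a b c v k \<phi>
      let ?D = "\<lambda>\<phi> x. basis_vec K (diagram_of (jump_word a b c v (k, \<phi>) x))"
      assume r: "r = (?D \<phi> Before_p \<ominus>\<^bsub>PM.F\<^esub> ?D \<phi> After_p) \<ominus>\<^bsub>PM.F\<^esub>
          (?D (\<phi> + 1) Before_q \<ominus>\<^bsub>PM.F\<^esub> ?D (\<phi> + 1) After_q)"
        and jc: "jump_config a b c v k" and v: "snd v = 1"
      show "h r = \<zero>\<^bsub>W\<^esub>"
        using 4[OF jc, of \<phi>] v unfolding r four_term_def
        by (subst h.map_minus_eq_zero_iff)
          (simp_all only: simps he[OF jc] one_neq_zero if_False fst_conv snd_conv simp_thms)
    qed
  qed
  then obtain h where h: "lin_map K \<M> W h" "\<forall>d. h (PM.gen d) = F (rep_diagram d)"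
    unfolding M_space_presented by auto
  then have "\<forall>w. chord_word w \<longrightarrow> h (clM w) = F w"
    using F_rep by (simp add: clM_eq)
  with h(1) show ?thesis by blast
qed

lemma A_lift:
  assumes W: "module K W" and F: "\<And>w. chord_word w \<Longrightarrow> black_word w \<Longrightarrow> F w \<in> carrier W"
    and rot: "\<And>x u. \<lbrakk>chord_word (x # u); black_word (x # u)\<rbrakk> \<Longrightarrow> F (u @ [x]) = F (x # u)"
    and rel: "\<And>\<sigma> u. \<lbrakk>chord_word u; black_word u; inj_on \<sigma> (set u); \<And>x. x \<in> set u \<Longrightarrow> snd (\<sigma> x) = snd x\<rbrakk>
      \<Longrightarrow> F (map \<sigma> u) = F u"
    and 4: "\<And>a b c v k. \<lbrakk>jump_config a b c v k; black_word (a @ [v] @ b @ [v] @ c)\<rbrakk>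
      \<Longrightarrow> four_term W F a b c v (k, 0)"
  shows "\<exists>h. lin_map K \<A> W h \<and> (\<forall>w. chord_word w \<and> black_word w \<longrightarrow> h (clA w) = F w)"
proof -
  have F_rep: "F (rep_diagram (diagram_of w)) = F w" if "chord_word w" "black_word w" for w
  proof -
    \<comment> \<open>The invariance principle quantifies over all words, whereas \<open>F\<close>
      is controlled on black ones only. \<open>G\<close> forgets \<open>F\<close> elsewhere, and it
      is invariant because blackness is.\<close>
    define G where "G w = (if black_word w then Some (F w) else None)" for w
    have "G (rep_diagram (diagram_of w)) = G w"
    proof (rule same_diagram_invariant[OF same_diagram_rep[OF that(1)]])
      show "G (u @ [x]) = G (x # u)" if "chord_word (x # u)" for x u
        using rot[OF that] by (auto simp: G_def black_word_def)
      show "G (map \<sigma> u) = G u"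
        if "chord_word u" "inj_on \<sigma> (set u)" "\<And>x. x \<in> set u \<Longrightarrow> snd (\<sigma> x) = snd x" for \<sigma> u
        using rel[OF that(1) _ that(2,3)] that(3) by (simp add: G_def black_word_map)
    qed
    then show ?thesis using that(2) by (auto simp: G_def split: if_splits)
  qed
  have "\<exists>h. lin_map K PA.P W h \<and> (\<forall>d\<in>{d. black d}. h (PA.gen d) = F (rep_diagram d))"
  proof (rule PA.lift_presented[OF W])
    fix d assume d: "d \<in> {d. black d}"
    have w: "chord_word (rep_diagram d)"
      using Quotient3_rep_reflp[OF Quotient3_diagram, of d] by (simp add: same_diagram_def)
    moreover have "black_word (rep_diagram d)"
      using d black_diagram_of[OF w] Quotient3_abs_rep[OF Quotient3_diagram] by simp
    ultimately show "F (rep_diagram d) \<in> carrier W" by (rule F)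
  next
    fix h r assume h: "lin_map K PA.F W h"
      "\<And>d. d \<in> {d. black d} \<Longrightarrow> h (basis_vec K d) = F (rep_diagram d)"
      and r: "r \<in> ordinary_4T_relators K"
    interpret h: lin_map K PA.F W h by (rule h(1))
    from r[unfolded ordinary_4T_relators_def Let_def black_diagram_space_def]
    show "h r = \<zero>\<^bsub>W\<^esub>"
    proof (elim CollectE exE conjE)
      fix a b c v k
      let ?J = "jump_word a b c v (k, 0)"
      let ?D = "\<lambda>x. basis_vec K (diagram_of (?J x))"
      assume r: "r = (?D Before_p \<ominus>\<^bsub>PA.F\<^esub> ?D After_p) \<ominus>\<^bsub>PA.F\<^esub> (?D After_q \<ominus>\<^bsub>PA.F\<^esub> ?D Before_q)"
        and jc: "jump_config a b c v k" and bl: "black_word (a @ [v] @ b @ [v] @ c)"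
      have J: "chord_word (?J x)" "black_word (?J x)" for x
        using bl jump_config_word[OF jc] by (auto simp: black_word_def set_jump_word)
      have black: "diagram_of (?J x) \<in> {d. black d}" for x
        using J by (simp add: black_diagram_of)
      have e: "?D x \<in> carrier PA.F" for x
        by (rule basis_vec_carrier[OF is_cring black])
      have he: "h (?D x) = F (?J x)" for x
        using h(2)[OF black] F_rep[OF J] by simp
      have v: "snd v = 0" using bl by (simp add: black_word_def)
      show "h r = \<zero>\<^bsub>W\<^esub>"
        using 4[OF jc bl] unfolding r four_term_def
        by (subst h.map_minus_eq_zero_iff)
          (simp_all only: h.map_minus PA.F.minus_closed e he v if_True simp_thms)
    qed
  qed
  then obtain h where h: "lin_map K \<A> W h" "\<forall>d\<in>{d. black d}. h (PA.gen d) = F (rep_diagram d)"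
    unfolding A_space_presented by (elim exE conjE)
  then have "\<forall>w. chord_word w \<and> black_word w \<longrightarrow> h (clA w) = F w"
    using F_rep by (simp add: clA_eq black_diagram_of)
  with h(1) show ?thesis by blast
qed

end

section \<open>Independence of the cutting point\<close>

text \<open>Reads an oriented 4T-relation with the two endpoints of the passed chord
  interchanged.\<close>

lemma (in abelian_group) minus_eq_minus_swap:
  assumes "a \<in> carrier G" "b \<in> carrier G" "c \<in> carrier G" "d \<in> carrier G" "a \<ominus> b = c \<ominus> d"
  shows "d \<ominus> c = b \<ominus> a"
proof -
  have "\<ominus> (a \<ominus> b) = \<ominus> (c \<ominus> d)" using assms(5) by simp
  then show ?thesis
    using assms(1-4) by (simp add: a_minus_def minus_add minus_minus a_comm)
qed

lemma (in abelian_group) minus_add_minus_zero: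
  assumes "a \<in> carrier G" "b \<in> carrier G" "c \<in> carrier G" "d \<in> carrier G" "a \<ominus> b = d \<ominus> c"
  shows "(a \<ominus> b) \<oplus> (c \<ominus> d) = \<zero>"
proof -
  have "(d \<ominus> c) \<oplus> (c \<ominus> d) = \<zero>"
    using assms(1-4) by (simp add: a_minus_def a_ac r_neg r_neg1 r_neg2)
  then show ?thesis using assms(5) by simp
qed

text \<open>The counting hypothesis says that \<open>w\<close> is, up to order, \<open>w'\<close>
  with \<open>x\<close> added twice. It yields the configuration that remains when a chord is
  regarded as the jumping one.\<close>

lemma chord_word_remove:
  assumes "chord_word w" "\<And>y. count_list w y = (if y = x then 2 else 0) + count_list w' y"
  shows "chord_word w' \<and> x \<notin> set w'"
proof -
  have *: "(if y = x then 2 else 0) + count_list w' y \<in> {0, 2}" for y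
    using assms(1) unfolding chord_word_iff assms(2) by blast
  have "count_list w' y \<in> {0, 2}" for y
    using *[of y] by (cases "y = x") simp_all
  moreover have "count_list w' x = 0" using *[of x] by simp
  ultimately show ?thesis by (simp add: chord_word_iff count_list_0_iff)
qed

lemma nth_eq_twice:
  assumes "v \<notin> set a" "v \<notin> set b" "v \<notin> set c"
  shows "{i. i < length (a @ v # b @ v # c) \<and> (a @ v # b @ v # c) ! i = v} =
    {length a, Suc (length a + length b)}"
proof -
  have "i = length a \<or> i = Suc (length a + length b)"
    if i: "i < length (a @ v # b @ v # c)" "(a @ v # b @ v # c) ! i = v" for i
  proof (rule ccontr)
    assume "\<not> ?thesis"
    then consider "i < length a" | j where "i = Suc (length a + j)" "j < length b"
      | j where "i = Suc (Suc (length a + length b + j))" "j < length c"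
    proof -
      assume *: "\<not> (i = length a \<or> i = Suc (length a + length b))"
      consider "i < length a" | "length a < i" "i < Suc (length a + length b)"
        | "Suc (length a + length b) < i" using * by linarith
      then show ?thesis
      proof cases
        case 2
        then show ?thesis using that(2)[of "i - Suc (length a)"] by simp
      next
        case 3
        then show ?thesis
          using that(3)[of "i - Suc (Suc (length a + length b))"] i(1) by simp
      qed (rule that(1))
    qed
    then show False
      using i(2) assms by cases (auto simp: nth_append)
  qed
  then show ?thesis by (intro subset_antisym) (blast, simp add: nth_append)
qed

lemma split_list_twice:
  assumes "count_list w v = 2"
  obtains a b c where "w = a @ v # b @ v # c" "v \<notin> set a" "v \<notin> set b" "v \<notin> set c"
proof -
  have "v \<in> set w" using assms count_list_0_iff[of w v] by (metis zero_neq_numeral)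
  then obtain a w1 where 1: "w = a @ v # w1" "v \<notin> set a" by (metis split_list_first)
  have "count_list a v = 0" using 1(2) by (simp add: count_list_0_iff)
  then have c1: "count_list w1 v = 1" using assms 1(1) by simp
  then have "v \<in> set w1" using count_list_0_iff[of w1 v] by (metis zero_neq_one)
  then obtain b c where 2: "w1 = b @ v # c" "v \<notin> set b" by (metis split_list_first)
  have "count_list b v = 0" using 2(2) by (simp add: count_list_0_iff)
  then have "count_list c v = 0" using c1 2(1) by simp
  then have "v \<notin> set c" by (simp add: count_list_0_iff)
  with 1 2 show thesis by (intro that[of a b c]) simp_all
qed

context chord_spaces
begin

interpretation M: module K \<M> by (rule module_M)

lemma clM_rotate: "chord_word (q @ p) \<Longrightarrow> clM (p @ q) = clM (q @ p)"
  using clM_cong[OF same_diagram_rotate] by simp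

lemma clM_map:
  "\<lbrakk>chord_word w; inj_on \<sigma> (set w); \<And>x. x \<in> set w \<Longrightarrow> snd (\<sigma> x) = snd x\<rbrakk> \<Longrightarrow> clM (map \<sigma> w) = clM w"
  using clM_cong[OF same_diagram_map] by simp

text \<open>A chord different from all others may still share its label with a chord of the other
  framing, which \<open>jump_config\<close> forbids. Renaming \<open>u\<close> to a fresh label
  bridges this gap.\<close>

lemma M_four_term_oriented:
  assumes w: "chord_word (a @ [v] @ b @ [v] @ c)" and u: "u \<notin> set (a @ [v] @ b @ [v] @ c)"
    and v: "snd v = 0"
  shows "clM (jump_word a b c v u Before_p) \<ominus>\<^bsub>\<M>\<^esub> clM (jump_word a b c v u After_p) =
    clM (jump_word a b c v u After_q) \<ominus>\<^bsub>\<M>\<^esub> clM (jump_word a b c v u Before_q)"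
proof -
  let ?w = "a @ [v] @ b @ [v] @ c"
  obtain k where k: "k \<notin> fst ` set ?w"
    using ex_new_if_finite[OF infinite_UNIV_nat] by (metis finite_imageI List.finite_set)
  define \<sigma> where "\<sigma> = (\<lambda>x. if x = u then (k, snd u) else x)"
  have id: "map \<sigma> y = y" if "set y \<subseteq> set ?w" for y
    using that u by (intro map_idI) (auto simp: \<sigma>_def)
  have \<sigma>v: "\<sigma> v = v" "\<sigma> u = (k, snd u)" using u by (auto simp: \<sigma>_def)
  have inj: "inj_on \<sigma> (insert u (set ?w))"
    using k u by (force simp: inj_on_def \<sigma>_def)
  have eq: "clM (jump_word a b c v (k, snd u) x) = clM (jump_word a b c v u x)" for x
  proof -
    have "clM (map \<sigma> (jump_word a b c v u x)) = clM (jump_word a b c v u x)"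
      by (rule clM_map[OF chord_word_jump_word[OF w u]])
        (use inj in \<open>auto simp only: set_jump_word \<sigma>_def snd_conv split: if_splits\<close>)
    then show ?thesis by (simp add: map_jump_word \<sigma>v id subset_iff)
  qed
  have "jump_config a b c v k" using w k by (simp add: jump_config_def)
  from M_four_term[OF this, of "snd u", unfolded four_term_def] show ?thesis
    by (simp only: eq v if_True simp_thms)
qed

text \<open>The leading \<open>x\<close> is the endpoint that moves; the other endpoint of the same
  chord lies in \<open>a\<close>, \<open>b\<close> or \<open>c\<close> and is the fixed endpoint of
  the jumping chord. Cutting the circle there turns the four words into jump words for
  \<open>v\<close>.\<close>

lemma clM_black_jump:
  assumes w: "chord_word (x # a @ v # b @ v # c)" and xv: "x \<noteq> v" and v: "snd v = 0"
  shows "clM (a @ x # v # b @ v # c) \<ominus>\<^bsub>\<M>\<^esub> clM (a @ v # x # b @ v # c) =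
    clM (a @ v # b @ v # x # c) \<ominus>\<^bsub>\<M>\<^esub> clM (a @ v # b @ x # v # c)"
proof -
  have four: "chord_word (a' @ [v] @ b' @ [v] @ c') \<and> x \<notin> set (a' @ [v] @ b' @ [v] @ c')"
    if "\<And>y. count_list (x # a @ v # b @ v # c) y =
      (if y = x then 2 else 0) + count_list (a' @ [v] @ b' @ [v] @ c') y" for a' b' c'
    by (rule chord_word_remove[OF w that])
  have rot: "clM (p @ q) = clM (jump_word a' b' c' v x y)"
    if "chord_word (a' @ [v] @ b' @ [v] @ c') \<and> x \<notin> set (a' @ [v] @ b' @ [v] @ c')"
      "jump_word a' b' c' v x y = q @ p" for p q a' b' c' y
    using clM_rotate[of q p] chord_word_jump_word[of a' v b' c' x y] that by simp
  \<comment> \<open>The leading letter accounts for one occurrence of \<open>x\<close>, so a second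
    one is among the remaining letters.\<close>
  have "count_list (x # a @ v # b @ v # c) x \<noteq> 1"
    using w unfolding chord_word_iff by (metis empty_iff insert_iff one_eq_numeral_iff semiring_norm(85) zero_neq_one)
  then have "\<not> (count_list a x = 0 \<and> count_list b x = 0 \<and> count_list c x = 0)"
    using xv by auto
  then have "x \<in> set a \<union> set b \<union> set c"
    by (simp only: count_list_0_iff) blast
  then consider "x \<in> set a" | "x \<in> set b" | "x \<in> set c" by blast
  then show ?thesis
  proof cases
    case 1
    then obtain a1 a2 where a: "a = a1 @ x # a2" by (metis split_list)
    have J: "chord_word (a2 @ [v] @ b @ [v] @ (c @ a1)) \<and> x \<notin> set (a2 @ [v] @ b @ [v] @ (c @ a1))"
      by (rule four) (simp add: a)
    note r = rot[OF J, where p = a1]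
    show ?thesis
      using M_four_term_oriented[of a2 v b "c @ a1" x] J v
        r[of Before_p "x # a2 @ x # v # b @ v # c"] r[of After_p "x # a2 @ v # x # b @ v # c"]
        r[of Before_q "x # a2 @ v # b @ x # v # c"] r[of After_q "x # a2 @ v # b @ v # x # c"]
      by (simp add: a)
  next
    case 2
    then obtain b1 b2 where b: "b = b1 @ x # b2" by (metis split_list)
    have J: "chord_word (b2 @ [v] @ (c @ a) @ [v] @ b1) \<and> x \<notin> set (b2 @ [v] @ (c @ a) @ [v] @ b1)"
      by (rule four) (simp add: b)
    note r = rot[OF J]
    \<comment> \<open>If the fixed endpoint lies between the two endpoints of \<open>v\<close>,
      reading from the new cut meets the second \<open>v\<close> first. The roles of
      \<open>p\<close> and \<open>q\<close> are thus exchanged, and so are the two sides of the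
      relation.\<close>
    have "clM (jump_word b2 (c @ a) b1 v x Before_q) \<ominus>\<^bsub>\<M>\<^esub> clM (jump_word b2 (c @ a) b1 v x After_q) =
        clM (jump_word b2 (c @ a) b1 v x After_p) \<ominus>\<^bsub>\<M>\<^esub> clM (jump_word b2 (c @ a) b1 v x Before_p)"
      by (rule M.M.minus_eq_minus_swap[OF clM_closed clM_closed clM_closed clM_closed])
        (rule M_four_term_oriented, use J v in simp_all)
    then show ?thesis
      using r[of Before_q "x # b2 @ v # c" "a @ x # v # b1"] r[of After_q "x # b2 @ v # c" "a @ v # x # b1"]
        r[of After_p "x # b2 @ v # x # c" "a @ v # b1"] r[of Before_p "x # b2 @ x # v # c" "a @ v # b1"]
      by (simp add: b)
  next
    case 3
    then obtain c1 c2 where c: "c = c1 @ x # c2" by (metis split_list)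
    have J: "chord_word ((c2 @ a) @ [v] @ b @ [v] @ c1) \<and> x \<notin> set ((c2 @ a) @ [v] @ b @ [v] @ c1)"
      by (rule four) (simp add: c)
    note r = rot[OF J, where q = "x # c2"]
    show ?thesis
      using M_four_term_oriented[of "c2 @ a" v b c1 x] J v
        r[of Before_p "a @ x # v # b @ v # c1"] r[of After_p "a @ v # x # b @ v # c1"]
        r[of Before_q "a @ v # b @ x # v # c1"] r[of After_q "a @ v # b @ v # x # c1"]
      by (simp add: c)
  qed
qed

text \<open>Moving an endpoint of \<open>x\<close> across all of \<open>c\<close> passes both endpoints of every other chord \<open>v\<close>
  of \<open>c\<close>; by the 4T-relation for \<open>v\<close> these two steps cancel.\<close>

lemma clM_slide:
  assumes w: "chord_word (x # c @ d)"
    and c: "\<And>v. \<lbrakk>v \<in> set c; v \<noteq> x\<rbrakk> \<Longrightarrow> snd v = 0 \<and> v \<notin> set d"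
  shows "clM (x # c @ d) = clM (c @ x # d)"
proof -
  \<comment> \<open>\<open>T i\<close> is the class after \<open>x\<close> has passed
    \<open>i\<close> letters of \<open>c\<close>, and \<open>\<Delta> i\<close> is the change caused
    by passing the next one. The telescoping sum of the changes is regrouped by letters:
    \<open>I v\<close> collects the positions of \<open>v\<close>.\<close>
  define T where "T i = clM (take i c @ x # drop i c @ d)" for i
  define \<Delta> where "\<Delta> i = T i \<ominus>\<^bsub>\<M>\<^esub> T (Suc i)" for i
  define I where "I v = {i. i < length c \<and> c ! i = v}" for v
  have T: "T i \<in> carrier \<M>" for i by (simp add: T_def clM_closed)
  then have \<Delta>: "\<Delta> i \<in> carrier \<M>" for i by (simp add: \<Delta>_def)
  have telescope: "T 0 = (\<Oplus>\<^bsub>\<M>\<^esub>i\<in>{..<n}. \<Delta> i) \<oplus>\<^bsub>\<M>\<^esub> T n" for n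
  proof (induction n)
    case (Suc n)
    have "T n = \<Delta> n \<oplus>\<^bsub>\<M>\<^esub> T (Suc n)"
      using T by (simp add: \<Delta>_def a_minus_def M.M.a_assoc M.M.l_neg)
    then show ?case
      using Suc T \<Delta> by (simp add: lessThan_Suc M.M.a_ac M.M.finsum_closed)
  qed (use T in simp)
  have "(\<Oplus>\<^bsub>\<M>\<^esub>i\<in>{..<length c}. \<Delta> i) = \<zero>\<^bsub>\<M>\<^esub>"
  proof -
    have zero: "(\<Oplus>\<^bsub>\<M>\<^esub>i\<in>I v. \<Delta> i) = \<zero>\<^bsub>\<M>\<^esub>" if "v \<in> set c" for v
    proof (cases "v = x")
      \<comment> \<open>The other endpoint of \<open>x\<close> may itself lie in \<open>c\<close>.
        Passing it exchanges two equal letters and leaves the word as it is.\<close>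
      case True
      have "\<Delta> i = \<zero>\<^bsub>\<M>\<^esub>" if "i \<in> I v" for i
      proof -
        have i: "i < length c" "c ! i = x" using that True by (auto simp: I_def)
        then have "take (Suc i) c = take i c @ [x]" "drop i c = x # drop (Suc i) c"
          by (simp_all add: take_Suc_conv_app_nth flip: Cons_nth_drop_Suc)
        then have "T i = T (Suc i)" by (simp add: T_def)
        then show ?thesis using T by (simp add: \<Delta>_def M.M.minus_eq_zero_iff)
      qed
      then show ?thesis by (rule M.M.add.finprod_one_eqI)
    next
      case False
      \<comment> \<open>Since \<open>v\<close> is absent from \<open>d\<close> and different from
        \<open>x\<close>, both of its endpoints lie in \<open>c\<close>; hence \<open>I v\<close>
        has exactly two elements.\<close>
      then have v: "snd v = 0" "v \<notin> set d" using c that by auto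
      have "count_list (x # c @ d) v \<in> {0, 2}" using w by (simp only: chord_word_iff)
      moreover have "count_list d v = 0" "count_list c v \<noteq> 0" using v that by (simp_all add: count_list_0_iff)
      ultimately have "count_list c v = 2" using False by simp
      then obtain a1 b1 c1 where ceq: "c = a1 @ v # b1 @ v # c1" and notin: "v \<notin> set a1" "v \<notin> set b1" "v \<notin> set c1"
        by (rule split_list_twice)
      have I: "I v = {length a1, Suc (length a1 + length b1)}"
        unfolding I_def ceq using nth_eq_twice[OF notin] .
      have "(\<Oplus>\<^bsub>\<M>\<^esub>i\<in>I v. \<Delta> i) = \<Delta> (length a1) \<oplus>\<^bsub>\<M>\<^esub> \<Delta> (Suc (length a1 + length b1))"
        unfolding I using \<Delta> by simp
      also have "\<dots> = \<zero>\<^bsub>\<M>\<^esub>"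
        unfolding \<Delta>_def
      proof (rule M.M.minus_add_minus_zero[OF T T T T])
        show "T (length a1) \<ominus>\<^bsub>\<M>\<^esub> T (Suc (length a1)) =
            T (Suc (Suc (length a1 + length b1))) \<ominus>\<^bsub>\<M>\<^esub> T (Suc (length a1 + length b1))"
          using clM_black_jump[of x a1 v b1 "c1 @ d"] w v(1) False unfolding T_def ceq by simp
      qed
      finally show ?thesis .
    qed
    have "{..<length c} = (\<Union>v\<in>set c. I v)" by (auto simp: I_def)
    also have "(\<Oplus>\<^bsub>\<M>\<^esub>i\<in>\<dots>. \<Delta> i) = (\<Oplus>\<^bsub>\<M>\<^esub>v\<in>set c. \<Oplus>\<^bsub>\<M>\<^esub>i\<in>I v. \<Delta> i)"
      by (rule M.M.add.finprod_UN_disjoint) (auto simp: I_def pairwise_def disjnt_def \<Delta>)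
    also have "\<dots> = \<zero>\<^bsub>\<M>\<^esub>" using zero by (rule M.M.add.finprod_one_eqI)
    finally show ?thesis .
  qed
  then have "T 0 = T (length c)" using telescope[of "length c"] T by simp
  then show ?thesis by (simp add: T_def)
qed

end

section \<open>Coproduct, projection and product\<close>

lemma (in abelian_group) add_minus_add:
  assumes "a \<in> carrier G" "b \<in> carrier G" "c \<in> carrier G" "d \<in> carrier G"
  shows "(a \<oplus> b) \<ominus> (c \<oplus> d) = (a \<ominus> c) \<oplus> (b \<ominus> d)"
  using assms by (simp add: a_minus_def minus_add a_ac)

lemma (in abelian_group) finsum_minus:
  assumes "f \<in> S \<rightarrow> carrier G" "g \<in> S \<rightarrow> carrier G"
  shows "(\<Oplus>i\<in>S. f i) \<ominus> (\<Oplus>i\<in>S. g i) = (\<Oplus>i\<in>S. f i \<ominus> g i)"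
proof (cases "finite S")
  case True
  then show ?thesis
    using assms
  proof (induction S)
    case (insert x S)
    then show ?case
      by (simp add: Pi_def add_minus_add)
  qed (simp add: a_minus_def)
\<comment> \<open>A sum over an infinite set is zero by convention, and both sides agree.\<close>
qed (simp add: finsum_infinite a_minus_def)

text \<open>Subsets of \<open>insert u T\<close> come in pairs \<open>I\<close>,
  \<open>insert u I\<close>. Applied with \<open>u\<close> the jumping chord, this separates the two
  tensor factors into which that chord can go.\<close>

lemma (in abelian_monoid) finsum_Pow_insert:
  assumes "finite T" "u \<notin> T" and f: "\<And>I. I \<subseteq> insert u T \<Longrightarrow> f I \<in> carrier G"
  shows "(\<Oplus>I\<in>Pow (insert u T). f I) = (\<Oplus>I\<in>Pow T. f I \<oplus> f (insert u I))"
proof -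
  have inj: "inj_on (insert u) (Pow T)" using assms(2) by (auto simp: inj_on_def)
  have "(\<Oplus>I\<in>Pow (insert u T). f I) = (\<Oplus>I\<in>Pow T. f I) \<oplus> (\<Oplus>I\<in>insert u ` Pow T. f I)"
    unfolding Pow_insert using assms by (intro finsum_Un_disjoint) (auto intro!: f)
  also have "(\<Oplus>I\<in>insert u ` Pow T. f I) = (\<Oplus>I\<in>Pow T. f (insert u I))"
    by (rule finsum_reindex) (use inj in \<open>auto intro!: f\<close>)
  also have "(\<Oplus>I\<in>Pow T. f I) \<oplus> \<dots> = (\<Oplus>I\<in>Pow T. f I \<oplus> f (insert u I))"
    by (rule finsum_addf[symmetric]) (auto intro!: f)
  finally show ?thesis .
qed

lemma black_word_jump_word:
  "black_word (jump_word a b c v u x) \<longleftrightarrow> snd u = 0 \<and> black_word (a @ [v] @ b @ [v] @ c)"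
  unfolding black_word_def set_jump_word by (simp only: ball_simps)

lemma subword_jump_word:
  "u \<notin> I \<Longrightarrow> subword I (jump_word a b c v u x) = subword I (a @ [v] @ b @ [v] @ c)"
  by (cases x) (simp_all add: subword_append subword_Cons subword_Nil)

lemma subword_insert: "u \<notin> set w \<Longrightarrow> subword (insert u I) w = subword I w"
  by (rule subword_cong) auto

text \<open>Keeping \<open>v\<close> gives a smaller jump word of the same kind. Deleting
  \<open>v\<close> leaves nothing to jump over, so the places just before and just after one of its
  endpoints become the same.\<close>

lemma subword_insert_jump_word:
  assumes "u \<notin> set (a @ [v] @ b @ [v] @ c)"
  shows "v \<in> I \<Longrightarrow> subword (insert u I) (jump_word a b c v u x) =
      jump_word (subword I a) (subword I b) (subword I c) v u x"
    and "v \<notin> I \<Longrightarrow> subword (insert u I) (jump_word a b c v u Before_p) =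
      subword (insert u I) (jump_word a b c v u After_p)"
    and "v \<notin> I \<Longrightarrow> subword (insert u I) (jump_word a b c v u Before_q) =
      subword (insert u I) (jump_word a b c v u After_q)"
proof -
  have [simp]: "subword (insert u I) a = subword I a" "subword (insert u I) b = subword I b"
    "subword (insert u I) c = subword I c" and uv: "v \<noteq> u"
    using assms by (auto intro: subword_insert)
  show "subword (insert u I) (jump_word a b c v u x) =
      jump_word (subword I a) (subword I b) (subword I c) v u x" if "v \<in> I"
    using that by (cases x) (simp_all add: subword_append subword_Cons subword_Nil)
  show "subword (insert u I) (jump_word a b c v u Before_p) =
      subword (insert u I) (jump_word a b c v u After_p)" if "v \<notin> I"
    using that uv by (simp add: subword_append subword_Cons subword_Nil)
  show "subword (insert u I) (jump_word a b c v u Before_q) =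
      subword (insert u I) (jump_word a b c v u After_q)" if "v \<notin> I"
    using that uv by (simp add: subword_append subword_Cons subword_Nil)
qed

lemma jump_config_subword:
  assumes "jump_config a b c v k" "v \<in> I"
  shows "jump_config (subword I a) (subword I b) (subword I c) v k"
proof -
  let ?w = "a @ [v] @ b @ [v] @ c"
  have eq: "subword I ?w = subword I a @ [v] @ subword I b @ [v] @ subword I c"
    using assms(2) by (simp add: subword_append subword_Cons subword_Nil)
  have w: "chord_word ?w" "k \<notin> fst ` set ?w"
    using assms(1) unfolding jump_config_def by (rule conjunct1, rule conjunct2)
  have "fst ` set (subword I ?w) \<subseteq> fst ` set ?w"
    unfolding set_subword by (rule image_mono) (rule Int_lower2)
  then have "k \<notin> fst ` set (subword I ?w)"
    using w(2) by (rule contra_subsetD)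
  then show ?thesis
    unfolding jump_config_def eq[symmetric] using chord_word_subword[OF w(1)] by (intro conjI)
qed

section \<open>The coproduct of framed diagrams and the projection to black ones\<close>

context chord_spaces
begin

interpretation M: module K \<M> by (rule module_M)

abbreviation "\<M>\<M> \<equiv> tensor_space K \<M> \<M>"
abbreviation "tMM \<equiv> tens K \<M> \<M>"

lemma module_MM: "module K \<M>\<M>"
  by (rule module_tensor_space[OF module_M module_M])

interpretation MM: module K \<M>\<M> by (rule module_MM)

definition cop :: "chord list \<Rightarrow> _" where
  "cop w = (\<Oplus>\<^bsub>\<M>\<M>\<^esub>I\<in>Pow (set w). tMM (clM (subword I w)) (clM (subword (set w - I) w)))"

lemma tMM_closed: "x \<in> carrier \<M> \<Longrightarrow> y \<in> carrier \<M> \<Longrightarrow> tMM x y \<in> carrier \<M>\<M>"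
  by (rule tens_closed[OF module_M module_M])

lemma cop_closed: "cop w \<in> carrier \<M>\<M>"
  unfolding cop_def by (rule MM.M.finsum_closed) (intro Pi_I tMM_closed clM_closed)

lemma cop_rot:
  assumes "chord_word (x # u)"
  shows "cop (u @ [x]) = cop (x # u)"
proof -
  have "clM (subword I (u @ [x])) = clM (subword I (x # u))" for I
    using clM_rotate[of "[x]" "subword I u"] chord_word_subword[OF assms, of I]
    by (simp add: subword_append subword_Cons subword_Nil split: if_splits)
  then show ?thesis by (simp add: cop_def)
qed

lemma cop_map:
  assumes u: "chord_word u" and inj: "inj_on \<sigma> (set u)"
    and snd: "\<And>x. x \<in> set u \<Longrightarrow> snd (\<sigma> x) = snd x"
  shows "cop (map \<sigma> u) = cop u"
proof -
  let ?f = "\<lambda>I. tMM (clM (subword I (map \<sigma> u))) (clM (subword (set (map \<sigma> u) - I) (map \<sigma> u)))"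
  have sub: "clM (subword (\<sigma> ` I) (map \<sigma> u)) = clM (subword I u)" if "I \<subseteq> set u" for I
  proof -
    have "clM (map \<sigma> (subword I u)) = clM (subword I u)"
      using inj snd by (intro clM_map chord_word_subword u) (auto simp: set_subword intro: inj_on_subset)
    then show ?thesis by (simp add: subword_map[OF inj that])
  qed
  have "cop (map \<sigma> u) = (\<Oplus>\<^bsub>\<M>\<M>\<^esub>I\<in>(`) \<sigma> ` Pow (set u). ?f I)"
    unfolding cop_def by (simp only: image_Pow_surj[OF refl] set_map)
  also have "\<dots> = (\<Oplus>\<^bsub>\<M>\<M>\<^esub>I\<in>Pow (set u). ?f (\<sigma> ` I))"
    by (rule MM.M.finsum_reindex) (simp_all add: Pi_def tMM_closed clM_closed inj_on_image_Pow inj)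
  also have "\<dots> = cop u"
    unfolding cop_def
  proof (rule MM.M.finsum_cong'[OF refl])
    fix I assume I: "I \<in> Pow (set u)"
    then have diff: "set (map \<sigma> u) - \<sigma> ` I = \<sigma> ` (set u - I)"
      using inj_on_image_set_diff[OF inj, of "set u" I] by auto
    show "?f (\<sigma> ` I) = tMM (clM (subword I u)) (clM (subword (set u - I) u))"
      unfolding diff using I by (simp only: sub Pow_iff Diff_subset)
  qed (simp add: Pi_def tMM_closed clM_closed)
  finally show ?thesis .
qed

text \<open>A single equation covers every set \<open>I\<close> of kept chords: it is a 4T-relation
  if \<open>v\<close> is kept, and otherwise both sides are differences of equal terms. This
  uniformity lets it be summed over \<open>I\<close>.\<close>

lemma four_term_subword:
  assumes jc: "jump_config a b c v k"
  defines "E \<equiv> \<lambda>\<phi> x I. clM (subword (insert (k, \<phi>) I) (jump_word a b c v (k, \<phi>) x))"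
  shows "E \<phi> Before_p I \<ominus>\<^bsub>\<M>\<^esub> E \<phi> After_p I = (if snd v = 0
    then E \<phi> After_q I \<ominus>\<^bsub>\<M>\<^esub> E \<phi> Before_q I
    else E (\<phi> + 1) Before_q I \<ominus>\<^bsub>\<M>\<^esub> E (\<phi> + 1) After_q I)"
proof (cases "v \<in> I")
  case True
  have "E \<phi> x I = clM (jump_word (subword I a) (subword I b) (subword I c) v (k, \<phi>) x)" for \<phi> x
    using subword_insert_jump_word(1)[OF jump_config_fresh[OF jc] True] by (simp add: E_def)
  then show ?thesis
    using M_four_term[OF jump_config_subword[OF jc True], of \<phi>]
    by (simp only: four_term_def fst_conv snd_conv)
next
  case False
  have "E \<phi> Before_p I = E \<phi> After_p I" "E \<phi> Before_q I = E \<phi> After_q I" for \<phi>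
    using subword_insert_jump_word(2,3)[OF jump_config_fresh[OF jc] False] by (simp_all add: E_def)
  then show ?thesis by (simp add: E_def a_minus_def M.M.r_neg clM_closed)
qed

text \<open>Splitting off the jumping chord exhibits the coproduct of a jump word as the value of the
  additive operator \<open>H\<close> below, which transports the 4T-relation.\<close>

lemma cop_four_term:
  assumes jc: "jump_config a b c v k"
  shows "four_term \<M>\<M> cop a b c v (k, \<phi>)"
proof -
  let ?w = "a @ [v] @ b @ [v] @ c"
  let ?T = "set ?w"
  define E where "E = (\<lambda>\<phi> x I. clM (subword (insert (k, \<phi>) I) (jump_word a b c v (k, \<phi>) x)))"
  define W where "W I = clM (subword I ?w)" for I
  \<comment> \<open>The first summand belongs to the splittings with the jumping chord in the right
    factor, the second to those with it in the left factor; \<open>W\<close> gives the factor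
    without it.\<close>
  define H where "H e = (\<Oplus>\<^bsub>\<M>\<M>\<^esub>I\<in>Pow ?T. tMM (W I) (e (?T - I)) \<oplus>\<^bsub>\<M>\<M>\<^esub> tMM (e I) (W (?T - I)))" for e
  have W: "W I \<in> carrier \<M>" for I by (simp add: W_def clM_closed)
  have E: "E \<phi> x I \<in> carrier \<M>" for \<phi> x I by (simp add: E_def clM_closed)
  have cop: "cop (jump_word a b c v (k, \<phi>) x) = H (E \<phi> x)" for \<phi> x
  proof -
    let ?u = "(k, \<phi>)" and ?j = "jump_word a b c v (k, \<phi>) x"
    have u: "?u \<notin> ?T" by (rule jump_config_fresh[OF jc])
    let ?f = "\<lambda>I. tMM (clM (subword I ?j)) (clM (subword (insert ?u ?T - I) ?j))"
    have "cop ?j = (\<Oplus>\<^bsub>\<M>\<M>\<^esub>I\<in>Pow (insert ?u ?T). ?f I)"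
      unfolding cop_def set_jump_word ..
    also have "\<dots> = (\<Oplus>\<^bsub>\<M>\<M>\<^esub>I\<in>Pow ?T. ?f I \<oplus>\<^bsub>\<M>\<M>\<^esub> ?f (insert ?u I))"
      by (rule MM.M.finsum_Pow_insert[OF List.finite_set u]) (simp add: tMM_closed clM_closed)
    also have "\<dots> = H (E \<phi> x)"
      unfolding H_def
    proof (rule MM.M.finsum_cong'[OF refl])
      fix I assume I: "I \<in> Pow ?T"
      have uI: "?u \<notin> I" using u I by blast
      have 1: "insert ?u ?T - I = insert ?u (?T - I)" "insert ?u ?T - insert ?u I = ?T - I"
        using uI u by auto
      have 2: "subword I ?j = subword I ?w" "subword (?T - I) ?j = subword (?T - I) ?w"
        using uI u by (simp_all only: subword_jump_word DiffE simp_thms Diff_iff)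
      show "?f I \<oplus>\<^bsub>\<M>\<M>\<^esub> ?f (insert ?u I) =
          tMM (W I) (E \<phi> x (?T - I)) \<oplus>\<^bsub>\<M>\<M>\<^esub> tMM (E \<phi> x I) (W (?T - I))"
        unfolding 1 2 W_def E_def ..
    qed (simp add: Pi_def tMM_closed W E)
    finally show ?thesis .
  qed
  have H_minus: "H e \<ominus>\<^bsub>\<M>\<M>\<^esub> H e' = H (\<lambda>I. e I \<ominus>\<^bsub>\<M>\<^esub> e' I)"
    if e: "\<And>I. e I \<in> carrier \<M>" "\<And>I. e' I \<in> carrier \<M>" for e e'
  proof -
    note left = lin_map.map_minus[OF lin_map_tens_left[OF module_M module_M W]]
    note right = lin_map.map_minus[OF lin_map_tens_right[OF module_M module_M W]]
    have "H e \<ominus>\<^bsub>\<M>\<M>\<^esub> H e' = (\<Oplus>\<^bsub>\<M>\<M>\<^esub>I\<in>Pow ?T.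
        (tMM (W I) (e (?T - I)) \<oplus>\<^bsub>\<M>\<M>\<^esub> tMM (e I) (W (?T - I))) \<ominus>\<^bsub>\<M>\<M>\<^esub>
        (tMM (W I) (e' (?T - I)) \<oplus>\<^bsub>\<M>\<M>\<^esub> tMM (e' I) (W (?T - I))))"
      unfolding H_def by (rule MM.M.finsum_minus) (simp_all add: Pi_def tMM_closed W e)
    also have "\<dots> = H (\<lambda>I. e I \<ominus>\<^bsub>\<M>\<^esub> e' I)"
      unfolding H_def
      by (rule MM.M.finsum_cong'[OF refl])
        (simp_all add: Pi_def tMM_closed W e left right MM.M.add_minus_add)
    finally show ?thesis .
  qed
  \<comment> \<open>As an equation between functions of \<open>I\<close> the relation can be fed to
    \<open>H\<close>, which commutes with differences by \<open>H_minus\<close>.\<close>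
  have "(\<lambda>I. E \<phi> Before_p I \<ominus>\<^bsub>\<M>\<^esub> E \<phi> After_p I) = (if snd v = 0
      then (\<lambda>I. E \<phi> After_q I \<ominus>\<^bsub>\<M>\<^esub> E \<phi> Before_q I)
      else (\<lambda>I. E (\<phi> + 1) Before_q I \<ominus>\<^bsub>\<M>\<^esub> E (\<phi> + 1) After_q I))"
    using four_term_subword[OF jc, of \<phi>] unfolding E_def by (cases "snd v = 0") (simp_all only: if_True if_False simp_thms)
  then show ?thesis
    unfolding four_term_def fst_conv snd_conv cop
    by (cases "snd v = 0") (simp_all only: H_minus E if_True if_False simp_thms)
qed

lemma M_comult:
  shows "lin_map K \<M> \<M>\<M> (M_comult K)"
    and "chord_word w \<Longrightarrow> M_comult K (clM w) = cop w"
proof -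
  have "\<exists>h. lin_map K \<M> \<M>\<M> h \<and> (\<forall>w. chord_word w \<longrightarrow> h (clM w) = cop w)"
    by (rule M_lift[OF module_MM]) (rule cop_closed cop_rot cop_map cop_four_term; assumption)+
  then obtain h where h: "lin_map K \<M> \<M>\<M> h" "\<forall>w. chord_word w \<longrightarrow> h (clM w) = cop w"
    by (elim exE conjE)
  have eq: "M_comult K = restrict h (carrier \<M>)"
    unfolding M_comult_def Let_def cop_def[symmetric]
  proof (rule the_linear_eq[OF h(1)])
    show "\<forall>w. chord_word w \<longrightarrow> restrict h (carrier \<M>) (clM w) = cop w"
      using h(2) clM_closed by simp
    show "f x = h x" if "lin_map K \<M> \<M>\<M> f" "\<forall>w. chord_word w \<longrightarrow> f (clM w) = cop w" "x \<in> carrier \<M>" for f x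
      by (rule M_ext[OF that(1) h(1) finite.emptyI _ that(3)]) (simp add: that(2) h(2))
  qed
  show "lin_map K \<M> \<M>\<M> (M_comult K)"
    unfolding eq by (rule lin_map_restrict[OF h(1)])
  show "M_comult K (clM w) = cop w" if "chord_word w"
    unfolding eq using h(2) that clM_closed by simp
qed

text \<open>The projection on the level of words. It replaces \<open>clA\<close> in all later
  formulas, since it has a meaning for every subword of a framed word.\<close>

definition prA :: "chord list \<Rightarrow> _" where
  "prA w = (if black_word w then clA w else \<zero>\<^bsub>\<A>\<^esub>)"

interpretation A: module K \<A> by (rule module_A)

lemma prA_closed: "chord_word w \<Longrightarrow> prA w \<in> carrier \<A>"
  by (simp add: prA_def clA_closed)

lemma prA_black: "black_word w \<Longrightarrow> prA w = clA w"
  by (simp add: prA_def)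

text \<open>If \<open>v\<close> is oriented, the four diagrams carry the same framings and are black
  together or not at all; in the black case the relation is an ordinary one. If \<open>v\<close> is
  disorienting, all four contain it and are sent to zero.\<close>

lemma prA_four_term:
  assumes jc: "jump_config a b c v k"
  shows "four_term \<A> prA a b c v (k, \<phi>)"
proof (cases "black_word (a @ [v] @ b @ [v] @ c) \<and> \<phi> = 0")
  case True
  then have "prA (jump_word a b c v (k, 0) x) = clA (jump_word a b c v (k, 0) x)" for x
    by (intro prA_black) (simp add: black_word_jump_word)
  moreover have "snd v = 0" using True by (simp add: black_word_def)
  ultimately show ?thesis
    using A_four_term[OF jc] True by (simp only: four_term_def fst_conv snd_conv if_True simp_thms)
next
  case False
  have zero: "prA (jump_word a b c v (k, \<psi>) x) = \<zero>\<^bsub>\<A>\<^esub>"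
    if "\<not> black_word (a @ [v] @ b @ [v] @ c) \<or> \<psi> \<noteq> 0" for \<psi> x
    using that by (simp only: prA_def black_word_jump_word snd_conv) auto
  show ?thesis
  proof (cases "snd v = 0")
    case True
    have "prA (jump_word a b c v (k, \<phi>) x) = \<zero>\<^bsub>\<A>\<^esub>" for x
      by (rule zero) (use False in blast)
    then show ?thesis using True by (simp only: four_term_def if_True simp_thms)
  next
    case v: False
    then have "\<not> black_word (a @ [v] @ b @ [v] @ c)" by (simp add: black_word_def)
    then show ?thesis using v zero by (simp only: four_term_def if_False fst_conv snd_conv simp_thms)
  qed
qed

lemma M_Pr:
  shows "lin_map K \<M> \<A> (M_Pr K)"
    and "chord_word w \<Longrightarrow> M_Pr K (clM w) = prA w"
proof -
  have rot: "prA (u @ [x]) = prA (x # u)" if "chord_word (x # u)" for x u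
    using clA_cong[OF same_diagram_rotate[of "[x]" u]] that
    by (simp add: prA_def black_word_def conj_commute)
  have rel: "prA (map \<sigma> u) = prA u"
    if "chord_word u" "inj_on \<sigma> (set u)" "\<And>x. x \<in> set u \<Longrightarrow> snd (\<sigma> x) = snd x" for \<sigma> u
    using clA_cong[OF same_diagram_map[OF that]] that(3) by (simp add: prA_def black_word_map)
  have "\<exists>h. lin_map K \<M> \<A> h \<and> (\<forall>w. chord_word w \<longrightarrow> h (clM w) = prA w)"
    by (rule M_lift[OF module_A]) (rule prA_closed rot rel prA_four_term; assumption)+
  then obtain h where h: "lin_map K \<M> \<A> h" "\<forall>w. chord_word w \<longrightarrow> h (clM w) = prA w"
    by (elim exE conjE)
  have eq: "M_Pr K = restrict h (carrier \<M>)"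
    unfolding M_Pr_def prA_def[symmetric]
  proof (rule the_linear_eq[OF h(1)])
    show "\<forall>w. chord_word w \<longrightarrow> restrict h (carrier \<M>) (clM w) = prA w"
      using h(2) clM_closed by simp
    show "f x = h x" if "lin_map K \<M> \<A> f" "\<forall>w. chord_word w \<longrightarrow> f (clM w) = prA w" "x \<in> carrier \<M>" for f x
      by (rule M_ext[OF that(1) h(1) finite.emptyI _ that(3)]) (simp add: that(2) h(2))
  qed
  show "lin_map K \<M> \<A> (M_Pr K)"
    unfolding eq by (rule lin_map_restrict[OF h(1)])
  show "M_Pr K (clM w) = prA w" if "chord_word w"
    unfolding eq using h(2) that clM_closed by simp
qed

end

text \<open>The product is lifted one word at a time, so it has to be defined on all pairs of words,
  including those that share chords.\<close>

definition even_label :: "chord \<Rightarrow> chord" where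
  "even_label x = (2 * fst x, snd x)"

definition odd_label :: "chord \<Rightarrow> chord" where
  "odd_label x = (Suc (2 * fst x), snd x)"

definition glue :: "chord list \<Rightarrow> chord list \<Rightarrow> chord list" where
  "glue c d = map even_label c @ map odd_label d"

lemma inj_label: "inj even_label" "inj odd_label"
  by (auto simp: inj_def even_label_def odd_label_def prod_eq_iff)

lemma snd_label [simp]: "snd (even_label x) = snd x" "snd (odd_label x) = snd x"
  by (simp_all add: even_label_def odd_label_def)

lemma even_neq_odd_label [simp]: "even_label x \<noteq> odd_label y" "odd_label y \<noteq> even_label x"
proof -
  have "2 * fst x \<noteq> Suc (2 * fst y)" by presburger
  then show "even_label x \<noteq> odd_label y" "odd_label y \<noteq> even_label x"
    by (simp_all add: even_label_def odd_label_def)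
qed

lemma label_disjoint: "set (map even_label c) \<inter> set (map odd_label d) = {}"
  by auto

lemma chord_word_label:
  "chord_word (map even_label c) = chord_word c" "chord_word (map odd_label c) = chord_word c"
  by (simp_all add: chord_word_map inj_on_subset[OF inj_label(1)] inj_on_subset[OF inj_label(2)])

lemma chord_word_glue: "chord_word (glue c d) \<longleftrightarrow> chord_word c \<and> chord_word d"
  unfolding glue_def chord_word_append[OF label_disjoint] chord_word_label ..

text \<open>Gluing another word to a configuration for a 4T-relation gives such a configuration
  again. In the second form the other word comes last, although it is the left factor of the
  product: a jump word has to start with the fixed endpoint of the jumping chord, and a rotation
  restores the order.\<close>

lemma jump_config_glue:
  assumes "jump_config a b c v k" "chord_word d"
  shows "jump_config (map even_label a) (map even_label b) (map even_label c @ map odd_label d)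
      (even_label v) (2 * k)"
    and "jump_config (map odd_label a) (map odd_label b) (map odd_label c @ map even_label d)
      (odd_label v) (Suc (2 * k))"
proof -
  let ?w = "a @ [v] @ b @ [v] @ c"
  have w: "chord_word ?w" "k \<notin> fst ` set ?w"
    using assms(1) unfolding jump_config_def by (rule conjunct1, rule conjunct2)
  have parity: "2 * m \<noteq> Suc (2 * n)" for m n :: nat by presburger
  have "2 * k \<notin> fst ` set (map even_label ?w @ map odd_label d)"
    using w(2) parity by (force simp: even_label_def odd_label_def)
  moreover have "chord_word (map even_label ?w @ map odd_label d)"
    using chord_word_glue[of ?w d] w(1) assms(2) by (simp only: glue_def simp_thms)
  ultimately show "jump_config (map even_label a) (map even_label b) (map even_label c @ map odd_label d)
      (even_label v) (2 * k)"
    unfolding jump_config_def by simp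
  have "Suc (2 * k) \<notin> fst ` set (map odd_label ?w @ map even_label d)"
    using w(2) parity[symmetric] by (force simp: even_label_def odd_label_def)
  moreover have "chord_word (map odd_label ?w @ map even_label d)"
    using w(1) assms(2) label_disjoint[of d ?w]
    by (subst chord_word_append) (simp_all only: chord_word_label Int_commute simp_thms)
  ultimately show "jump_config (map odd_label a) (map odd_label b) (map odd_label c @ map even_label d)
      (odd_label v) (Suc (2 * k))"
    unfolding jump_config_def by simp
qed

section \<open>Gluing as a bilinear map\<close>

context chord_spaces
begin

interpretation M: module K \<M> by (rule module_M)
interpretation A: module K \<A> by (rule module_A)

lemma four_term_transport:
  assumes "\<And>\<psi> x. F (jump_word a b c v (k, \<psi>) x) = clM (jump_word a' b' c' v' (k', \<psi>) x)"
    and "snd v' = snd v" and jc: "jump_config a' b' c' v' k'"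
  shows "four_term \<M> F a b c v (k, \<phi>)"
  using M_four_term[OF jc, of \<phi>] unfolding four_term_def fst_conv snd_conv assms(1,2) .

text \<open>The inclusion of black diagrams, a section of \<open>M_Pr K\<close>. It respects the
  relations because the 4T-relations between black diagrams are among the framed ones.\<close>

lemma A_incl: "\<exists>h. lin_map K \<A> \<M> h \<and> (\<forall>w. chord_word w \<and> black_word w \<longrightarrow> h (clA w) = clM w)"
proof (rule A_lift[OF module_M clM_closed])
  show "clM (u @ [x]) = clM (x # u)" if "chord_word (x # u)" for x u
    using clM_rotate[of "[x]" u] that by simp
  show "clM (map \<sigma> u) = clM u"
    if "chord_word u" "inj_on \<sigma> (set u)" "\<And>x. x \<in> set u \<Longrightarrow> snd (\<sigma> x) = snd x" for \<sigma> u
    by (rule clM_map[OF that])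
  show "four_term \<M> clM a b c v (k, 0)" if "jump_config a b c v k" for a b c v k
    by (rule M_four_term[OF that])
qed

text \<open>Connects \<open>glue\<close> with the specification of the product: for words without
  common chords the separation by parity is only a relabelling of the concatenation.\<close>

lemma clM_glue:
  assumes c: "chord_word c" and d: "chord_word d" and disj: "set c \<inter> set d = {}"
  shows "clM (glue c d) = clM (c @ d)"
proof -
  define \<sigma> where "\<sigma> x = (if x \<in> set c then even_label x else odd_label x)" for x
  have "map \<sigma> c = map even_label c" "map \<sigma> d = map odd_label d"
    using disj by (auto simp: \<sigma>_def)
  then have glue: "map \<sigma> (c @ d) = glue c d" by (simp add: glue_def)
  have "inj_on \<sigma> (set (c @ d))"
    by (auto simp: inj_on_def \<sigma>_def dest: injD[OF inj_label(1)] injD[OF inj_label(2)])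
  then have "clM (map \<sigma> (c @ d)) = clM (c @ d)"
    using c d disj by (intro clM_map) (simp_all add: chord_word_append \<sigma>_def)
  then show ?thesis by (simp only: glue)
qed

lemma clM_glue_map:
  assumes c: "chord_word c" and d: "chord_word d"
    and \<sigma>: "inj_on \<sigma> (set c)" "\<And>x. x \<in> set c \<Longrightarrow> snd (\<sigma> x) = snd x"
    and \<tau>: "inj_on \<tau> (set d)" "\<And>x. x \<in> set d \<Longrightarrow> snd (\<tau> x) = snd x"
  shows "clM (glue (map \<sigma> c) (map \<tau> d)) = clM (glue c d)"
proof -
  \<comment> \<open>Labels from the two words have different parities, so the two relabellings can
    be performed by a single map without interfering.\<close>
  define \<pi> where "\<pi> y = (if y \<in> range even_label then even_label (\<sigma> (the_inv even_label y))
    else odd_label (\<tau> (the_inv odd_label y)))" for y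
  have even: "\<pi> (even_label x) = even_label (\<sigma> x)" for x
    by (simp add: \<pi>_def the_inv_f_f[OF inj_label(1)])
  have odd: "\<pi> (odd_label x) = odd_label (\<tau> x)" for x
    by (auto simp add: \<pi>_def the_inv_f_f[OF inj_label(2)])
  have glue: "map \<pi> (glue c d) = glue (map \<sigma> c) (map \<tau> d)"
    by (simp add: glue_def even odd)
  have "inj_on (\<pi> \<circ> even_label) (set c)" "inj_on (\<pi> \<circ> odd_label) (set d)"
    using comp_inj_on[OF \<sigma>(1) inj_on_subset[OF inj_label(1) subset_UNIV]]
      comp_inj_on[OF \<tau>(1) inj_on_subset[OF inj_label(2) subset_UNIV]]
    by (simp_all add: comp_def even odd)
  then have "inj_on \<pi> (even_label ` set c)" "inj_on \<pi> (odd_label ` set d)"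
    by (simp_all only: inj_on_imageI)
  moreover have "\<pi> ` (even_label ` set c) \<inter> \<pi> ` (odd_label ` set d) = {}"
    by (auto simp: even odd)
  ultimately have "inj_on \<pi> (set (glue c d))"
    unfolding glue_def set_append set_map inj_on_Un by blast
  moreover have "snd (\<pi> y) = snd y" if "y \<in> set (glue c d)" for y
    using that by (auto simp: glue_def even odd \<sigma>(2) \<tau>(2))
  ultimately have "clM (map \<pi> (glue c d)) = clM (glue c d)"
    using c d by (intro clM_map) (simp_all only: chord_word_glue simp_thms)
  then show ?thesis by (simp only: glue)
qed

text \<open>Moving the cutting point of the black word carries its first letter across the rest of
  that word only. The letters crossed are black and absent from the other factor, and the other
  endpoint of the moving chord is one of them, which \<open>clM_slide\<close> permits.\<close>

lemma glue_left:
  assumes d: "chord_word d"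
  shows "\<exists>h. lin_map K \<A> \<M> h \<and> (\<forall>c. chord_word c \<and> black_word c \<longrightarrow> h (clA c) = clM (glue c d))"
proof (rule A_lift[OF module_M clM_closed])
  fix x u assume w: "chord_word (x # u)" and black: "black_word (x # u)"
  have "clM (even_label x # map even_label u @ map odd_label d) =
      clM (map even_label u @ even_label x # map odd_label d)"
  proof (rule clM_slide)
    show "chord_word (even_label x # map even_label u @ map odd_label d)"
      using chord_word_glue[of "x # u" d] w d by (simp add: glue_def)
    show "snd v = 0 \<and> v \<notin> set (map odd_label d)" if "v \<in> set (map even_label u)" for v
      using that black by (auto simp: black_word_def)
  qed
  then show "clM (glue (u @ [x]) d) = clM (glue (x # u) d)" by (simp add: glue_def)
next
  show "clM (glue (map \<sigma> u) d) = clM (glue u d)"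
    if "chord_word u" "inj_on \<sigma> (set u)" "\<And>x. x \<in> set u \<Longrightarrow> snd (\<sigma> x) = snd x" for \<sigma> u
    using clM_glue_map[OF that(1) d that(2,3), of id] by simp
next
  fix a b c v k assume jc: "jump_config a b c v k"
  show "four_term \<M> (\<lambda>c. clM (glue c d)) a b c v (k, 0)"
    by (rule four_term_transport[OF _ _ jump_config_glue(1)[OF jc d]])
      (simp_all add: glue_def map_jump_word jump_word_append even_label_def)
qed

text \<open>Moving the cutting point of \<open>d\<close> carries its first letter to the very end;
  on the circle this amounts to carrying it backwards across all of the black word, whatever the
  framing of the moving chord.\<close>

lemma glue_right:
  assumes c: "chord_word c" and black: "black_word c"
  shows "\<exists>h. lin_map K \<M> \<M> h \<and> (\<forall>d. chord_word d \<longrightarrow> h (clM d) = clM (glue c d))"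
proof (rule M_lift[OF module_M clM_closed])
  fix x u assume w: "chord_word (x # u)"
  let ?c = "map even_label c" and ?u = "map odd_label u" and ?x = "odd_label x"
  have cw: "chord_word (?c @ ?x # ?u)"
    using chord_word_glue[of c "x # u"] c w by (simp add: glue_def)
  then have cw': "chord_word (?x # ?c @ ?u)"
    using chord_word_cong[of "?c @ ?x # ?u" "?x # ?c @ ?u"] by simp
  have "clM (?x # ?c @ ?u) = clM (?c @ ?x # ?u)"
  proof (rule clM_slide[OF cw'])
    show "snd v = 0 \<and> v \<notin> set ?u" if "v \<in> set ?c" for v
      using that black by (auto simp: black_word_def)
  qed
  moreover have "clM (?c @ ?u @ [?x]) = clM (?x # ?c @ ?u)"
    using clM_rotate[of "[?x]" "?c @ ?u"] cw' by simp
  ultimately show "clM (glue c (u @ [x])) = clM (glue c (x # u))" by (simp add: glue_def)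
next
  show "clM (glue c (map \<sigma> u)) = clM (glue c u)"
    if "chord_word u" "inj_on \<sigma> (set u)" "\<And>x. x \<in> set u \<Longrightarrow> snd (\<sigma> x) = snd x" for \<sigma> u
    using clM_glue_map[OF c that(1) _ _ that(2,3), of id] by simp
next
  fix a b e v k \<phi> assume jc: "jump_config a b e v k"
  \<comment> \<open>The glued word starts with the black factor; rotating that factor to the end
    produces a jump word.\<close>
  have "clM (glue c (jump_word a b e v (k, \<psi>) x)) = clM (jump_word (map odd_label a) (map odd_label b)
      (map odd_label e @ map even_label c) (odd_label v) (Suc (2 * k), \<psi>) x)" for \<psi> x
  proof -
    have label: "odd_label (k, \<psi>) = (Suc (2 * k), \<psi>)" by (simp add: odd_label_def)
    let ?j = "map odd_label (jump_word a b e v (k, \<psi>) x)"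
    have "chord_word (?j @ map even_label c)"
      unfolding map_jump_word jump_word_append label
      by (rule jump_config_word[OF jump_config_glue(2)[OF jc c]])
    then have "clM (map even_label c @ ?j) = clM (?j @ map even_label c)" by (rule clM_rotate)
    then show ?thesis unfolding glue_def map_jump_word jump_word_append label .
  qed
  then show "four_term \<M> (\<lambda>d. clM (glue c d)) a b e v (k, \<phi>)"
    by (rule four_term_transport[OF _ _ jump_config_glue(2)[OF jc c]]) simp
qed

text \<open>\<open>glue_left\<close> provides maps \<open>L d\<close> that are linear in
  \<open>\<A>\<close>, but \<open>d\<close> is still a word. For \<open>d \<mapsto> L d a\<close> to
  factor through \<open>\<M>\<close>, the 4T-relations in the second factor are needed for every
  \<open>a\<close>; \<open>glue_right\<close> supplies this for classes of words, and the property
  is inherited by sums and multiples.\<close>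

lemma glue_bilinear:
  "\<exists>\<beta>. bilinear K \<A> \<M> \<M> \<beta> \<and>
    (\<forall>c d. chord_word c \<and> black_word c \<and> chord_word d \<longrightarrow> \<beta> (clA c) (clM d) = clM (glue c d))"
proof -
  have "\<forall>d\<in>Collect chord_word. \<exists>h. lin_map K \<A> \<M> h \<and>
      (\<forall>c. chord_word c \<and> black_word c \<longrightarrow> h (clA c) = clM (glue c d))"
    using glue_left by simp
  then obtain L where L: "\<forall>d\<in>Collect chord_word. lin_map K \<A> \<M> (L d) \<and>
      (\<forall>c. chord_word c \<and> black_word c \<longrightarrow> L d (clA c) = clM (glue c d))"
    by (elim bchoice[THEN exE])
  then have Llin: "lin_map K \<A> \<M> (L d)" if "chord_word d" for d
    using that by simp
  have "\<exists>g. lin_map K \<M> \<M> g \<and> (\<forall>d. chord_word d \<longrightarrow> g (clM d) = L d a)" if a: "a \<in> carrier \<A>" for a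
  proof (rule A_induct[OF a])
    show "\<exists>g. lin_map K \<M> \<M> g \<and> (\<forall>d. chord_word d \<longrightarrow> g (clM d) = L d \<zero>\<^bsub>\<A>\<^esub>)"
      by (intro exI[of _ "\<lambda>x. \<zero>\<^bsub>\<M>\<^esub>"]) (simp add: lin_map_zero module_M lin_map.map_zero[OF Llin])
  next
    fix a a' assume a: "a \<in> carrier \<A>" "a' \<in> carrier \<A>"
      and "\<exists>g. lin_map K \<M> \<M> g \<and> (\<forall>d. chord_word d \<longrightarrow> g (clM d) = L d a)"
        "\<exists>g. lin_map K \<M> \<M> g \<and> (\<forall>d. chord_word d \<longrightarrow> g (clM d) = L d a')"
    then obtain g g' where g: "lin_map K \<M> \<M> g" "\<forall>d. chord_word d \<longrightarrow> g (clM d) = L d a"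
      "lin_map K \<M> \<M> g'" "\<forall>d. chord_word d \<longrightarrow> g' (clM d) = L d a'" by (elim exE conjE)
    show "\<exists>g. lin_map K \<M> \<M> g \<and> (\<forall>d. chord_word d \<longrightarrow> g (clM d) = L d (a \<oplus>\<^bsub>\<A>\<^esub> a'))"
      by (intro exI[of _ "\<lambda>x. g x \<oplus>\<^bsub>\<M>\<^esub> g' x"] conjI lin_map_add g(1,3))
        (simp add: g(2,4) lin_map.add[OF Llin] a)
  next
    fix r a assume a: "r \<in> carrier K" "a \<in> carrier \<A>"
      and "\<exists>g. lin_map K \<M> \<M> g \<and> (\<forall>d. chord_word d \<longrightarrow> g (clM d) = L d a)"
    then obtain g where g: "lin_map K \<M> \<M> g" "\<forall>d. chord_word d \<longrightarrow> g (clM d) = L d a"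
      by (elim exE conjE)
    show "\<exists>g. lin_map K \<M> \<M> g \<and> (\<forall>d. chord_word d \<longrightarrow> g (clM d) = L d (r \<odot>\<^bsub>\<A>\<^esub> a))"
      by (intro exI[of _ "\<lambda>x. r \<odot>\<^bsub>\<M>\<^esub> g x"] conjI lin_map_smult g(1) a(1))
        (simp add: g(2) lin_map.smult[OF Llin] a)
  next
    fix c assume c: "chord_word c" "black_word c"
    obtain g where "lin_map K \<M> \<M> g" "\<forall>d. chord_word d \<longrightarrow> g (clM d) = clM (glue c d)"
      using glue_right[OF c] by (elim exE conjE)
    then show "\<exists>g. lin_map K \<M> \<M> g \<and> (\<forall>d. chord_word d \<longrightarrow> g (clM d) = L d (clA c))"
      using L c by (intro exI[of _ g]) simp
  qed
  then have "\<forall>a\<in>carrier \<A>. \<exists>g. lin_map K \<M> \<M> g \<and> (\<forall>d. chord_word d \<longrightarrow> g (clM d) = L d a)"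
    by (rule ballI)
  \<comment> \<open>The chosen maps are linear in the second argument. Linearity in the first
    follows by comparing two linear maps on classes of words, where the values are those of the
    linear \<open>L d\<close>.\<close>
  then obtain \<beta> where \<beta>: "\<forall>a\<in>carrier \<A>. lin_map K \<M> \<M> (\<beta> a) \<and>
      (\<forall>d. chord_word d \<longrightarrow> \<beta> a (clM d) = L d a)"
    by (elim bchoice[THEN exE])
  have \<beta>lin: "lin_map K \<M> \<M> (\<beta> a)" if "a \<in> carrier \<A>" for a
    using \<beta> that by simp
  have \<beta>val: "\<beta> a (clM d) = L d a" if "a \<in> carrier \<A>" "chord_word d" for a d
    using \<beta> that by simp
  have "lin_map K \<A> \<M> (\<lambda>a. \<beta> a m)" if m: "m \<in> carrier \<M>" for m
  proof (rule lin_map.intro[OF module_A module_M])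
    show "\<beta> a m \<in> carrier \<M>" if "a \<in> carrier \<A>" for a
      by (rule lin_map.closed[OF \<beta>lin[OF that] m])
    show "\<beta> (a \<oplus>\<^bsub>\<A>\<^esub> a') m = \<beta> a m \<oplus>\<^bsub>\<M>\<^esub> \<beta> a' m"
      if a: "a \<in> carrier \<A>" "a' \<in> carrier \<A>" for a a'
      by (rule M_ext[OF \<beta>lin lin_map_add[OF \<beta>lin \<beta>lin] finite.emptyI _ m])
        (simp_all add: a \<beta>val lin_map.add[OF Llin])
    show "\<beta> (r \<odot>\<^bsub>\<A>\<^esub> a) m = r \<odot>\<^bsub>\<M>\<^esub> \<beta> a m" if a: "r \<in> carrier K" "a \<in> carrier \<A>" for r a
      by (rule M_ext[OF \<beta>lin lin_map_smult[OF \<beta>lin a(1)] finite.emptyI _ m])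
        (simp_all add: a \<beta>val lin_map.smult[OF Llin])
  qed
  then have "bilinear K \<A> \<M> \<M> \<beta>"
    unfolding bilinear_def using \<beta>lin by (intro conjI ballI)
  moreover have "\<beta> (clA c) (clM d) = clM (glue c d)"
    if "chord_word c" "black_word c" "chord_word d" for c d
    using that \<beta>val[OF clA_closed] L by simp
  ultimately show ?thesis by (intro exI[of _ \<beta>]) simp
qed

abbreviation "\<A>\<M> \<equiv> tensor_space K \<A> \<M>"
abbreviation "\<A>\<A> \<equiv> tensor_space K \<A> \<A>"
abbreviation "tAM \<equiv> tens K \<A> \<M>"
abbreviation "tAA \<equiv> tens K \<A> \<A>"

text \<open>After the first word \<open>c\<close> has been chosen, the second extensionality step is
  told to avoid its chords. Disjoint pairs of words therefore suffice, which is exactly what the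
  specification of the product offers.\<close>

lemma AM_ext:
  assumes f: "lin_map K \<A>\<M> U f" and g: "lin_map K \<A>\<M> U g"
    and eq: "\<And>c d. \<lbrakk>chord_word c; black_word c; chord_word d; set c \<inter> set d = {}\<rbrakk>
      \<Longrightarrow> f (tAM (clA c) (clM d)) = g (tAM (clA c) (clM d))"
    and t: "t \<in> carrier \<A>\<M>"
  shows "f t = g t"
proof (rule tensor_ext[OF module_A module_M f g _ t])
  fix a m assume a: "a \<in> carrier \<A>" and m: "m \<in> carrier \<M>"
  show "f (tAM a m) = g (tAM a m)"
  proof (rule A_ext[OF lin_map_comp[OF lin_map_tens_right[OF module_A module_M m] f]
        lin_map_comp[OF lin_map_tens_right[OF module_A module_M m] g] finite.emptyI _ a])
    fix c assume c: "chord_word c" "black_word c"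
    note c' = clA_closed[OF c]
    show "f (tAM (clA c) m) = g (tAM (clA c) m)"
      by (rule M_ext[OF lin_map_comp[OF lin_map_tens_left[OF module_A module_M c'] f]
            lin_map_comp[OF lin_map_tens_left[OF module_A module_M c'] g] List.finite_set _ m])
        (rule eq[OF c], assumption, simp only: Int_commute)
  qed
qed

lemma AA_ext:
  assumes f: "lin_map K \<A>\<A> U f" and g: "lin_map K \<A>\<A> U g"
    and eq: "\<And>c d. \<lbrakk>chord_word c; black_word c; chord_word d; black_word d; set c \<inter> set d = {}\<rbrakk>
      \<Longrightarrow> f (tAA (clA c) (clA d)) = g (tAA (clA c) (clA d))"
    and t: "t \<in> carrier \<A>\<A>"
  shows "f t = g t"
proof (rule tensor_ext[OF module_A module_A f g _ t])
  fix a m assume a: "a \<in> carrier \<A>" and m: "m \<in> carrier \<A>"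
  show "f (tAA a m) = g (tAA a m)"
  proof (rule A_ext[OF lin_map_comp[OF lin_map_tens_right[OF module_A module_A m] f]
        lin_map_comp[OF lin_map_tens_right[OF module_A module_A m] g] finite.emptyI _ a])
    fix c assume c: "chord_word c" "black_word c"
    note c' = clA_closed[OF c]
    show "f (tAA (clA c) m) = g (tAA (clA c) m)"
      by (rule A_ext[OF lin_map_comp[OF lin_map_tens_left[OF module_A module_A c'] f]
            lin_map_comp[OF lin_map_tens_left[OF module_A module_A c'] g] List.finite_set _ m])
        (rule eq[OF c], assumption, assumption, simp only: Int_commute)
  qed
qed

lemma M_mult:
  shows "M_mult K \<in> linear_maps K \<A>\<M> \<M>"
    and "lin_map K \<A>\<M> \<M> (M_mult K)"
    and "\<lbrakk>chord_word c; black_word c; chord_word d; set c \<inter> set d = {}\<rbrakk>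
      \<Longrightarrow> M_mult K (tAM (clA c) (clM d)) = clM (c @ d)"
proof -
  obtain \<beta> where \<beta>: "bilinear K \<A> \<M> \<M> \<beta>" "\<forall>c d. chord_word c \<and> black_word c \<and> chord_word d \<longrightarrow>
      \<beta> (clA c) (clM d) = clM (glue c d)"
    using glue_bilinear by (elim exE conjE)
  obtain h where h: "lin_map K \<A>\<M> \<M> h"
    "\<forall>a\<in>carrier \<A>. \<forall>m\<in>carrier \<M>. h (tAM a m) = \<beta> a m"
    using tensor_lift[OF module_A module_M \<beta>(1)] by (elim exE conjE)
  have val: "h (tAM (clA c) (clM d)) = clM (c @ d)"
    if "chord_word c" "black_word c" "chord_word d" "set c \<inter> set d = {}" for c d
    using h(2) \<beta>(2) that clA_closed[of c] clM_closed[of d] clM_glue[of c d] by simp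
  have closed: "tAM (clA c) (clM d) \<in> carrier \<A>\<M>" if "chord_word c" "black_word c" for c d
    by (rule tens_closed[OF module_A module_M clA_closed[OF that] clM_closed])
  have eq: "M_mult K = restrict h (carrier \<A>\<M>)"
    unfolding M_mult_def
  proof (rule the_linear_eq[OF h(1)])
    show "\<forall>c d. chord_word c \<and> black_word c \<and> chord_word d \<and> set c \<inter> set d = {} \<longrightarrow>
        restrict h (carrier \<A>\<M>) (tAM (clA c) (clM d)) = clM (c @ d)"
      using val closed by simp
    show "f t = h t" if "lin_map K \<A>\<M> \<M> f" and f: "\<forall>c d. chord_word c \<and> black_word c \<and> chord_word d \<and>
        set c \<inter> set d = {} \<longrightarrow> f (tAM (clA c) (clM d)) = clM (c @ d)" and "t \<in> carrier \<A>\<M>" for f t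
      by (rule AM_ext[OF that(1) h(1) _ that(3)]) (simp only: f val simp_thms)
  qed
  show "M_mult K \<in> linear_maps K \<A>\<M> \<M>"
    unfolding eq by (rule lin_map.restrict_linear_maps[OF h(1)])
  show "lin_map K \<A>\<M> \<M> (M_mult K)"
    unfolding eq by (rule lin_map_restrict[OF h(1)])
  show "M_mult K (tAM (clA c) (clM d)) = clM (c @ d)"
    if "chord_word c" "black_word c" "chord_word d" "set c \<inter> set d = {}"
    unfolding eq using val[OF that] closed[OF that(1,2)] by simp
qed

end

section \<open>The structure maps on generators\<close>

lemma lin_map_ident: "module K V \<Longrightarrow> lin_map K V V (\<lambda>x. x)"
  by (rule lin_map_cong[OF lin_map_id]) (simp_all add: id_map_def)

lemma (in abelian_monoid) finsum_Pow_Un: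
  assumes "finite S" "finite T" "S \<inter> T = {}" and "\<And>I. I \<subseteq> S \<union> T \<Longrightarrow> f I \<in> carrier G"
  shows "(\<Oplus>I\<in>Pow (S \<union> T). f I) = (\<Oplus>I\<in>Pow S. \<Oplus>J\<in>Pow T. f (I \<union> J))"
  using assms
proof (induction S arbitrary: f)
  case empty
  have "(\<Oplus>J\<in>Pow T. f J) \<in> carrier G"
    using empty.prems(3) by (intro finsum_closed Pi_I) simp
  then show ?case by simp
next
  case (insert x S)
  have x: "x \<notin> S \<union> T" using insert.hyps insert.prems by blast
  have disj: "S \<inter> T = {}" using insert.prems(2) by blast
  have f: "f I \<in> carrier G" if "I \<subseteq> insert x (S \<union> T)" for I
    using insert.prems(3)[of I] that by simp
  have "(\<Oplus>I\<in>Pow (insert x S \<union> T). f I) = (\<Oplus>I\<in>Pow (S \<union> T). f I \<oplus> f (insert x I))"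
    unfolding Un_insert_left
    using insert.hyps insert.prems(1) x f by (intro finsum_Pow_insert) auto
  also have "\<dots> = (\<Oplus>I\<in>Pow S. \<Oplus>J\<in>Pow T. f (I \<union> J) \<oplus> f (insert x (I \<union> J)))"
    using insert.prems(1) disj by (intro insert.IH a_closed f) auto
  also have "\<dots> = (\<Oplus>I\<in>Pow S. (\<Oplus>J\<in>Pow T. f (I \<union> J)) \<oplus> (\<Oplus>J\<in>Pow T. f (insert x I \<union> J)))"
  proof (intro finsum_cong' refl Pi_I)
    fix I assume I: "I \<in> Pow S"
    then have *: "f (I \<union> J) \<in> carrier G" "f (insert x (I \<union> J)) \<in> carrier G" if "J \<in> Pow T" for J
      using that by (auto intro!: f)
    show "(\<Oplus>J\<in>Pow T. f (I \<union> J) \<oplus> f (insert x (I \<union> J))) =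
        (\<Oplus>J\<in>Pow T. f (I \<union> J)) \<oplus> (\<Oplus>J\<in>Pow T. f (insert x I \<union> J))"
      unfolding Un_insert_left by (intro finsum_addf Pi_I *)
    show "(\<Oplus>J\<in>Pow T. f (I \<union> J)) \<oplus> (\<Oplus>J\<in>Pow T. f (insert x I \<union> J)) \<in> carrier G"
      unfolding Un_insert_left by (intro a_closed finsum_closed Pi_I *)
  qed
  also have "\<dots> = (\<Oplus>I\<in>Pow (insert x S). \<Oplus>J\<in>Pow T. f (I \<union> J))"
    by (rule finsum_Pow_insert[OF insert.hyps, symmetric]) (intro finsum_closed Pi_I f; blast)
  finally show ?case .
qed

text \<open>Both sides run over the ordered partitions of \<open>S\<close> into three blocks. On the
  left the first block is split off and the rest is divided; on the right the union of the first two
  blocks is chosen and then divided.\<close>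

lemma (in abelian_monoid) finsum_Pow_coassoc:
  fixes S :: "'c set"
  assumes "finite S" "\<And>I J L. \<lbrakk>I \<subseteq> S; J \<subseteq> S; L \<subseteq> S\<rbrakk> \<Longrightarrow> g I J L \<in> carrier G"
  shows "(\<Oplus>I\<in>Pow S. \<Oplus>J\<in>Pow (S - I). g I J (S - I - J)) =
    (\<Oplus>I\<in>Pow S. \<Oplus>J\<in>Pow I. g J (I - J) (S - I))"
  using assms
proof (induction S arbitrary: g)
  case empty
  then show ?case by simp
next
  case (insert x T)
  note x = \<open>x \<notin> T\<close>
  have g: "g I J L \<in> carrier G" if "I \<subseteq> insert x T" "J \<subseteq> insert x T" "L \<subseteq> insert x T" for I J L
    using insert.prems that by simp
  \<comment> \<open>The new element goes into the third, second or first block. Each choice gives a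
    summand of the same type over \<open>T\<close>, so the induction hypothesis, being general in
    the summand, applies three times.\<close>
  define g1 where "g1 I J L = g I J (insert x L)" for I J L
  define g2 where "g2 I J L = g I (insert x J) L" for I J L
  define g3 where "g3 I J L = g (insert x I) J L" for I J L
  have cl: "g1 I J L \<in> carrier G" "g2 I J L \<in> carrier G" "g3 I J L \<in> carrier G"
    if "I \<subseteq> T" "J \<subseteq> T" "L \<subseteq> T" for I J L
    using that unfolding g1_def g2_def g3_def by (auto intro!: g)
  define l where "l h = (\<Oplus>I\<in>Pow T. \<Oplus>J\<in>Pow (T - I). h I J (T - I - J))" for h :: "'c set \<Rightarrow> 'c set \<Rightarrow> 'c set \<Rightarrow> 'a"
  define r where "r h = (\<Oplus>I\<in>Pow T. \<Oplus>J\<in>Pow I. h J (I - J) (T - I))" for h :: "'c set \<Rightarrow> 'c set \<Rightarrow> 'c set \<Rightarrow> 'a"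
  have IH: "l g1 = r g1" "l g2 = r g2" "l g3 = r g3"
    unfolding l_def r_def using cl by (intro insert.IH; simp)+
  have lcl: "(\<Oplus>J\<in>Pow (T - I). h I J (T - I - J)) \<in> carrier G"
    if "I \<subseteq> T" "h = g1 \<or> h = g2 \<or> h = g3" for h I
    using that cl by (intro finsum_closed Pi_I) (auto simp: subset_iff)
  have rcl: "(\<Oplus>J\<in>Pow I. h J (I - J) (T - I)) \<in> carrier G"
    if "I \<subseteq> T" "h = g1 \<or> h = g2 \<or> h = g3" for h I
    using that cl by (intro finsum_closed Pi_I) (auto simp: subset_iff)
  have "(\<Oplus>I\<in>Pow (insert x T). \<Oplus>J\<in>Pow (insert x T - I). g I J (insert x T - I - J)) =
      (\<Oplus>I\<in>Pow T. (\<Oplus>J\<in>Pow (insert x T - I). g I J (insert x T - I - J)) \<oplus>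
        (\<Oplus>J\<in>Pow (insert x T - insert x I). g (insert x I) J (insert x T - insert x I - J)))"
    by (rule finsum_Pow_insert[OF insert.hyps]) (intro finsum_closed Pi_I g; blast)
  also have "\<dots> = (\<Oplus>I\<in>Pow T. ((\<Oplus>J\<in>Pow (T - I). g1 I J (T - I - J)) \<oplus>
      (\<Oplus>J\<in>Pow (T - I). g2 I J (T - I - J))) \<oplus> (\<Oplus>J\<in>Pow (T - I). g3 I J (T - I - J)))"
  proof (rule finsum_cong'[OF refl])
    fix I assume "I \<in> Pow T"
    then have I: "I \<subseteq> T" "x \<notin> I" "x \<notin> T - I" and fin: "finite (T - I)"
      using x insert.hyps(1) by auto
    have 1: "insert x T - I = insert x (T - I)" "insert x T - insert x I = T - I" using I(2) x by auto
    have "(\<Oplus>J\<in>Pow (insert x (T - I)). g I J (insert x (T - I) - J)) =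
        (\<Oplus>J\<in>Pow (T - I). g I J (insert x (T - I) - J) \<oplus> g I (insert x J) (insert x (T - I) - insert x J))"
      by (rule finsum_Pow_insert[OF fin I(3)]) (intro g, use I in auto)
    also have "\<dots> = (\<Oplus>J\<in>Pow (T - I). g1 I J (T - I - J) \<oplus> g2 I J (T - I - J))"
    proof (rule finsum_cong'[OF refl])
      fix J assume "J \<in> Pow (T - I)"
      then have "insert x (T - I) - J = insert x (T - I - J)"
        "insert x (T - I) - insert x J = T - I - J" using I(3) by auto
      then show "g I J (insert x (T - I) - J) \<oplus> g I (insert x J) (insert x (T - I) - insert x J) =
          g1 I J (T - I - J) \<oplus> g2 I J (T - I - J)" by (simp only: g1_def g2_def)
    qed (use I(1) in \<open>auto intro!: cl\<close>)
    also have "\<dots> = (\<Oplus>J\<in>Pow (T - I). g1 I J (T - I - J)) \<oplus> (\<Oplus>J\<in>Pow (T - I). g2 I J (T - I - J))"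
      by (rule finsum_addf) (use I(1) in \<open>auto intro!: cl\<close>)
    finally show "(\<Oplus>J\<in>Pow (insert x T - I). g I J (insert x T - I - J)) \<oplus>
        (\<Oplus>J\<in>Pow (insert x T - insert x I). g (insert x I) J (insert x T - insert x I - J)) =
      ((\<Oplus>J\<in>Pow (T - I). g1 I J (T - I - J)) \<oplus> (\<Oplus>J\<in>Pow (T - I). g2 I J (T - I - J))) \<oplus>
        (\<Oplus>J\<in>Pow (T - I). g3 I J (T - I - J))"
      unfolding 1 g3_def by (simp only:)
  qed (intro Pi_I a_closed lcl; blast)
  also have "\<dots> = l g1 \<oplus> l g2 \<oplus> l g3"
    unfolding l_def by (subst finsum_addf, (intro Pi_I a_closed lcl; blast)+)+ simp
  finally have L: "(\<Oplus>I\<in>Pow (insert x T). \<Oplus>J\<in>Pow (insert x T - I). g I J (insert x T - I - J)) =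
      l g1 \<oplus> l g2 \<oplus> l g3" .
  have "(\<Oplus>I\<in>Pow (insert x T). \<Oplus>J\<in>Pow I. g J (I - J) (insert x T - I)) =
      (\<Oplus>I\<in>Pow T. (\<Oplus>J\<in>Pow I. g J (I - J) (insert x T - I)) \<oplus>
        (\<Oplus>J\<in>Pow (insert x I). g J (insert x I - J) (insert x T - insert x I)))"
    by (rule finsum_Pow_insert[OF insert.hyps]) (intro finsum_closed Pi_I g; blast)
  also have "\<dots> = (\<Oplus>I\<in>Pow T. (\<Oplus>J\<in>Pow I. g1 J (I - J) (T - I)) \<oplus>
      ((\<Oplus>J\<in>Pow I. g2 J (I - J) (T - I)) \<oplus> (\<Oplus>J\<in>Pow I. g3 J (I - J) (T - I))))"
  proof (rule finsum_cong'[OF refl])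
    fix I assume "I \<in> Pow T"
    then have I: "I \<subseteq> T" "x \<notin> I" and fin: "finite I"
      using x insert.hyps(1) by (auto intro: finite_subset)
    have 1: "insert x T - I = insert x (T - I)" "insert x T - insert x I = T - I" using I(2) x by auto
    have "(\<Oplus>J\<in>Pow (insert x I). g J (insert x I - J) (T - I)) =
        (\<Oplus>J\<in>Pow I. g J (insert x I - J) (T - I) \<oplus> g (insert x J) (insert x I - insert x J) (T - I))"
      by (rule finsum_Pow_insert[OF fin I(2)]) (intro g, use I in auto)
    also have "\<dots> = (\<Oplus>J\<in>Pow I. g2 J (I - J) (T - I) \<oplus> g3 J (I - J) (T - I))"
    proof (rule finsum_cong'[OF refl])
      fix J assume "J \<in> Pow I"
      then have "insert x I - J = insert x (I - J)" "insert x I - insert x J = I - J" using I(2) by auto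
      then show "g J (insert x I - J) (T - I) \<oplus> g (insert x J) (insert x I - insert x J) (T - I) =
          g2 J (I - J) (T - I) \<oplus> g3 J (I - J) (T - I)" by (simp only: g2_def g3_def)
    qed (use I(1) in \<open>auto intro!: cl\<close>)
    also have "\<dots> = (\<Oplus>J\<in>Pow I. g2 J (I - J) (T - I)) \<oplus> (\<Oplus>J\<in>Pow I. g3 J (I - J) (T - I))"
      by (rule finsum_addf) (use I(1) in \<open>auto intro!: cl\<close>)
    finally show "(\<Oplus>J\<in>Pow I. g J (I - J) (insert x T - I)) \<oplus>
        (\<Oplus>J\<in>Pow (insert x I). g J (insert x I - J) (insert x T - insert x I)) =
      (\<Oplus>J\<in>Pow I. g1 J (I - J) (T - I)) \<oplus>
        ((\<Oplus>J\<in>Pow I. g2 J (I - J) (T - I)) \<oplus> (\<Oplus>J\<in>Pow I. g3 J (I - J) (T - I)))"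
      unfolding 1 g1_def by (simp only:)
  qed (intro Pi_I a_closed rcl; blast)
  also have "\<dots> = r g1 \<oplus> (r g2 \<oplus> r g3)"
    unfolding r_def by (subst finsum_addf, (intro Pi_I a_closed rcl; blast)+)+ simp
  also have "\<dots> = r g1 \<oplus> r g2 \<oplus> r g3"
    unfolding r_def by (intro a_assoc[symmetric] finsum_closed Pi_I rcl; blast)
  finally show ?case unfolding L IH by (simp only:)
qed

section \<open>Values of the structure maps on words\<close>

context chord_spaces
begin

interpretation M: module K \<M> by (rule module_M)
interpretation A: module K \<A> by (rule module_A)

lemma module_AM: "module K \<A>\<M>"
  by (rule module_tensor_space[OF module_A module_M])

lemma module_AA: "module K \<A>\<A>"
  by (rule module_tensor_space[OF module_A module_A])

interpretation AM: module K \<A>\<M> by (rule module_AM)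
interpretation AA: module K \<A>\<A> by (rule module_AA)

lemmas tAM_closed = tens_closed[OF module_A module_M]
lemmas tAA_closed = tens_closed[OF module_A module_A]

lemma prA_subword_closed: "chord_word w \<Longrightarrow> prA (subword I w) \<in> carrier \<A>"
  by (intro prA_closed chord_word_subword)

lemma prA_eq_zero: "\<not> black_word w \<Longrightarrow> prA w = \<zero>\<^bsub>\<A>\<^esub>"
  by (simp add: prA_def)

lemma id_map_apply: "x \<in> carrier V \<Longrightarrow> id_map V x = x"
  by (simp add: id_map_def)

text \<open>Obtained by including the second factor into \<open>\<M>\<close>, acting there and
  projecting back. The value formula has \<open>prA d\<close> in the second place because the
  coaction produces subwords that need not be black; for those both sides vanish.\<close>

lemma A_mult:
  shows "lin_map K \<A>\<A> \<A> (A_mult K)"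
    and "\<lbrakk>chord_word c; black_word c; chord_word d; set c \<inter> set d = {}\<rbrakk>
      \<Longrightarrow> A_mult K (tAA (clA c) (prA d)) = prA (c @ d)"
proof -
  obtain j where j: "lin_map K \<A> \<M> j" "\<forall>w. chord_word w \<and> black_word w \<longrightarrow> j (clA w) = clM w"
    using A_incl by (elim exE conjE)
  let ?T = "tensor_map K \<A> \<A> \<A> \<M> (id_map \<A>) j"
  note T = tensor_map[OF lin_map_id[OF module_A] j(1)]
  define h where "h t = M_Pr K (M_mult K (?T t))" for t
  have h: "lin_map K \<A>\<A> \<A> h"
    unfolding h_def by (rule lin_map_comp[OF lin_map_comp[OF T(1) M_mult(2)] M_Pr(1)])
  have val: "h (tAA (clA c) (clA d)) = clA (c @ d)"
    if "chord_word c" "black_word c" "chord_word d" "black_word d" "set c \<inter> set d = {}" for c d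
  proof -
    have "?T (tAA (clA c) (clA d)) = tAM (clA c) (clM d)"
      using T(2)[OF clA_closed[OF that(1,2)] clA_closed[OF that(3,4)]] j(2) that(3,4)
      by (simp add: id_map_apply clA_closed[OF that(1,2)])
    moreover have "prA (c @ d) = clA (c @ d)"
      using that by (intro prA_black) (simp add: black_word_append)
    ultimately show ?thesis
      using that by (simp add: h_def M_mult(3) M_Pr(2) chord_word_append)
  qed
  have closed: "tAA (clA c) (clA d) \<in> carrier \<A>\<A>"
    if "chord_word c" "black_word c" "chord_word d" "black_word d" for c d
    by (rule tAA_closed[OF clA_closed[OF that(1,2)] clA_closed[OF that(3,4)]])
  have eq: "A_mult K = restrict h (carrier \<A>\<A>)"
    unfolding A_mult_def
  proof (rule the_linear_eq[OF h])
    show "\<forall>c d. chord_word c \<and> black_word c \<and> chord_word d \<and> black_word d \<and> set c \<inter> set d = {} \<longrightarrow>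
        restrict h (carrier \<A>\<A>) (tAA (clA c) (clA d)) = clA (c @ d)"
      using val closed by simp
    show "f t = h t" if "lin_map K \<A>\<A> \<A> f" and f: "\<forall>c d. chord_word c \<and> black_word c \<and>
        chord_word d \<and> black_word d \<and> set c \<inter> set d = {} \<longrightarrow> f (tAA (clA c) (clA d)) = clA (c @ d)"
      and "t \<in> carrier \<A>\<A>" for f t
      by (rule AA_ext[OF that(1) h _ that(3)]) (simp only: f val simp_thms)
  qed
  show lin: "lin_map K \<A>\<A> \<A> (A_mult K)"
    unfolding eq by (rule lin_map_restrict[OF h])
  show "A_mult K (tAA (clA c) (prA d)) = prA (c @ d)"
    if w: "chord_word c" "black_word c" "chord_word d" "set c \<inter> set d = {}"
  proof (cases "black_word d")
    case True
    then have "black_word (c @ d)" using w(2) by (simp add: black_word_append)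
    with True show ?thesis
      unfolding eq using val closed w by (simp add: prA_black)
  next
    case False
    then have "\<not> black_word (c @ d)" by (simp add: black_word_append)
    with False show ?thesis
      using lin_map.map_zero[OF lin] lin_map.map_zero[OF lin_map_tens_left[OF module_A module_A clA_closed[OF w(1,2)]]]
      by (simp add: prA_eq_zero)
  qed
qed

definition copA :: "chord list \<Rightarrow> _" where
  "copA w = (\<Oplus>\<^bsub>\<A>\<A>\<^esub>I\<in>Pow (set w). tAA (prA (subword I w)) (prA (subword (set w - I) w)))"

text \<open>The reason why every summand of \<open>copA w\<close> vanishes when \<open>w\<close> is
  not black: a disorienting chord ends up in one of the two factors.\<close>

lemma black_subwords:
  assumes "I \<subseteq> set w" "black_word (subword I w)" "black_word (subword (set w - I) w)"
  shows "black_word w"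
  using assms unfolding black_word_def set_subword by blast

text \<open>The map is the coproduct of \<open>\<M>\<close> between the inclusion and two copies of
  the projection. The value formula, valid for all framed words, expresses that the projection is
  compatible with the coproducts; coassociativity of the coaction depends on this.\<close>

lemma A_comult:
  shows "lin_map K \<A> \<A>\<A> (A_comult K)"
    and "chord_word w \<Longrightarrow> A_comult K (prA w) = copA w"
proof -
  obtain j where j: "lin_map K \<A> \<M> j" "\<forall>w. chord_word w \<and> black_word w \<longrightarrow> j (clA w) = clM w"
    using A_incl by (elim exE conjE)
  let ?T = "tensor_map K \<M> \<A> \<M> \<A> (M_Pr K) (M_Pr K)"
  note T = tensor_map[OF M_Pr(1) M_Pr(1)]
  define h where "h a = ?T (M_comult K (j a))" for a
  have h: "lin_map K \<A> \<A>\<A> h"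
    unfolding h_def by (rule lin_map_comp[OF lin_map_comp[OF j(1) M_comult(1)] T(1)])
  have T_cop: "?T (cop w) = copA w" if w: "chord_word w" for w
  proof -
    have "?T (cop w) = (\<Oplus>\<^bsub>\<A>\<A>\<^esub>I\<in>Pow (set w). ?T (tMM (clM (subword I w)) (clM (subword (set w - I) w))))"
      unfolding cop_def by (rule lin_map.map_finsum[OF T(1)]) (simp_all add: Pi_def tMM_closed clM_closed)
    also have "\<dots> = copA w"
      unfolding copA_def
      by (rule AA.M.finsum_cong'[OF refl])
        (simp_all add: Pi_def tAA_closed prA_subword_closed w T(2) clM_closed M_Pr(2) chord_word_subword)
    finally show ?thesis .
  qed
  have val: "h (clA w) = copA w" if "chord_word w" "black_word w" for w
    using j(2) that by (simp add: h_def M_comult(2) T_cop)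
  have spec: "copA w = (\<Oplus>\<^bsub>\<A>\<A>\<^esub>I\<in>Pow (set w). tAA (clA (subword I w)) (clA (subword (set w - I) w)))"
    if "black_word w" for w
    unfolding copA_def by (simp add: prA_black black_word_subword[OF that])
  have eq: "A_comult K = restrict h (carrier \<A>)"
    unfolding A_comult_def Let_def
  proof (rule the_linear_eq[OF h])
    show "\<forall>w. chord_word w \<and> black_word w \<longrightarrow> restrict h (carrier \<A>) (clA w) =
        (\<Oplus>\<^bsub>\<A>\<A>\<^esub>I\<in>Pow (set w). tAA (clA (subword I w)) (clA (subword (set w - I) w)))"
      using val clA_closed spec by simp
    show "f a = h a" if "lin_map K \<A> \<A>\<A> f" and f: "\<forall>w. chord_word w \<and> black_word w \<longrightarrow> f (clA w) =
        (\<Oplus>\<^bsub>\<A>\<A>\<^esub>I\<in>Pow (set w). tAA (clA (subword I w)) (clA (subword (set w - I) w)))"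
      and "a \<in> carrier \<A>" for f a
      by (rule A_ext[OF that(1) h finite.emptyI _ that(3)]) (simp only: f val spec simp_thms)
  qed
  show lin: "lin_map K \<A> \<A>\<A> (A_comult K)"
    unfolding eq by (rule lin_map_restrict[OF h])
  show "A_comult K (prA w) = copA w" if w: "chord_word w"
  proof (cases "black_word w")
    case True
    then show ?thesis
      unfolding eq using val w clA_closed by (simp add: prA_black)
  next
    case False
    have "tAA (prA (subword I w)) (prA (subword (set w - I) w)) = \<zero>\<^bsub>\<A>\<A>\<^esub>" if "I \<in> Pow (set w)" for I
    proof -
      have "\<not> black_word (subword I w) \<or> \<not> black_word (subword (set w - I) w)"
        using black_subwords[of I w] False that by blast
      then show ?thesis
      proof
        assume "\<not> black_word (subword I w)"
        then show ?thesis
          using lin_map.map_zero[OF lin_map_tens_right[OF module_A module_A prA_subword_closed[OF w]]]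
          by (simp add: prA_eq_zero)
      next
        assume "\<not> black_word (subword (set w - I) w)"
        then show ?thesis
          using lin_map.map_zero[OF lin_map_tens_left[OF module_A module_A prA_subword_closed[OF w]]]
          by (simp add: prA_eq_zero)
      qed
    qed
    then have "copA w = \<zero>\<^bsub>\<A>\<A>\<^esub>"
      unfolding copA_def by (rule AA.M.add.finprod_one_eqI)
    then show ?thesis
      using lin_map.map_zero[OF lin] False by (simp add: prA_eq_zero)
  qed
qed

lemma A_counit:
  shows "lin_map K \<A> (ground_space K) (A_counit K)"
    and "chord_word w \<Longrightarrow> A_counit K (prA w) = (if w = [] then \<one> else \<zero>)"
proof -
  let ?G = "ground_space K"
  let ?F = "\<lambda>w :: chord list. if w = [] then \<one> else \<zero>"
  have G: "module K ?G" by (rule module_ground_space[OF is_cring])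
  have G_simps: "carrier ?G = carrier K" "\<zero>\<^bsub>?G\<^esub> = \<zero>" by (simp_all add: ground_space_def)
  have "\<exists>h. lin_map K \<A> ?G h \<and> (\<forall>w. chord_word w \<and> black_word w \<longrightarrow> h (clA w) = ?F w)"
  proof (rule A_lift[OF G])
    show "?F w \<in> carrier ?G" for w :: "chord list" by (simp add: G_simps)
    \<comment> \<open>No diagram in a 4T-relation is empty, so the relation holds trivially for the
      counit.\<close>
    have "jump_word a b c v u x \<noteq> []" for a b c v u x by (cases x) simp_all
    then show "four_term ?G ?F a b c v (k, 0)" if "black_word (a @ [v] @ b @ [v] @ c)" for a b c v k
      using that by (simp only: four_term_def if_False black_word_def) simp
  qed simp_all
  then obtain h where h: "lin_map K \<A> ?G h" "\<forall>w. chord_word w \<and> black_word w \<longrightarrow> h (clA w) = ?F w"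
    by (elim exE conjE)
  have eq: "A_counit K = restrict h (carrier \<A>)"
    unfolding A_counit_def
  proof (rule the_linear_eq[OF h(1)])
    show "\<forall>w. chord_word w \<and> black_word w \<longrightarrow> restrict h (carrier \<A>) (clA w) = ?F w"
      using h(2) clA_closed by simp
    show "f a = h a" if "lin_map K \<A> ?G f" and f: "\<forall>w. chord_word w \<and> black_word w \<longrightarrow> f (clA w) = ?F w"
      and "a \<in> carrier \<A>" for f a
      by (rule A_ext[OF that(1) h(1) finite.emptyI _ that(3)]) (simp only: f h(2) simp_thms)
  qed
  show lin: "lin_map K \<A> ?G (A_counit K)"
    unfolding eq by (rule lin_map_restrict[OF h(1)])
  show "A_counit K (prA w) = ?F w" if w: "chord_word w"
  proof (cases "black_word w")
    case True
    then show ?thesis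
      unfolding eq using h(2) w clA_closed by (simp add: prA_black)
  next
    case False
    then have "w \<noteq> []" by (auto simp: black_word_def)
    then show ?thesis
      using lin_map.map_zero[OF lin] False by (simp add: prA_eq_zero G_simps)
  qed
qed

definition coact :: "chord list \<Rightarrow> _" where
  "coact w = (\<Oplus>\<^bsub>\<A>\<M>\<^esub>I\<in>Pow (set w). tAM (prA (subword I w)) (clM (subword (set w - I) w)))"

lemma M_coaction:
  shows "M_coaction K \<in> linear_maps K \<M> \<A>\<M>"
    and "lin_map K \<M> \<A>\<M> (M_coaction K)"
    and "chord_word w \<Longrightarrow> M_coaction K (clM w) = coact w"
proof -
  let ?T = "tensor_map K \<M> \<A> \<M> \<M> (M_Pr K) (id_map \<M>)"
  note T = tensor_map[OF M_Pr(1) lin_map_id[OF module_M]]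
  have h: "lin_map K \<M> \<A>\<M> (\<lambda>x. ?T (M_comult K x))"
    by (rule lin_map_comp[OF M_comult(1) T(1)])
  have eq: "M_coaction K = restrict (\<lambda>x. ?T (M_comult K x)) (carrier \<M>)"
    by (simp add: M_coaction_def compose_def Let_def)
  show "M_coaction K \<in> linear_maps K \<M> \<A>\<M>"
    unfolding eq by (rule lin_map.restrict_linear_maps[OF h])
  show "lin_map K \<M> \<A>\<M> (M_coaction K)"
    unfolding eq by (rule lin_map_restrict[OF h])
  show "M_coaction K (clM w) = coact w" if w: "chord_word w"
  proof -
    have "?T (cop w) = (\<Oplus>\<^bsub>\<A>\<M>\<^esub>I\<in>Pow (set w). ?T (tMM (clM (subword I w)) (clM (subword (set w - I) w))))"
      unfolding cop_def by (rule lin_map.map_finsum[OF T(1)]) (simp_all add: Pi_def tMM_closed clM_closed)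
    also have "\<dots> = coact w"
      unfolding coact_def
      by (rule AM.M.finsum_cong'[OF refl])
        (simp_all add: Pi_def tAM_closed prA_subword_closed w T(2) clM_closed M_Pr(2)
          chord_word_subword id_map_apply)
    finally show ?thesis
      unfolding eq using w clM_closed by (simp add: M_comult(2))
  qed
qed

text \<open>Associativity of the action is associativity of concatenation. The three arguments are
  replaced by words one after the other, each avoiding the chords of those already chosen, so that
  every product in the equation is covered by its specification.\<close>

lemma left_module: "left_module_structure K (A_hopf K) \<M> (M_mult K)"
proof -
  have unit: "M_mult K (tAM (clA []) v) = v" if v: "v \<in> carrier \<M>" for v
  proof (rule M_ext[OF _ lin_map_ident[OF module_M] finite.emptyI _ v])
    have nil: "chord_word []" "black_word []" by (simp_all add: chord_word_def black_word_def)
    show "lin_map K \<M> \<M> (\<lambda>v. M_mult K (tAM (clA []) v))"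
      by (rule lin_map_comp[OF lin_map_tens_left[OF module_A module_M clA_closed[OF nil]] M_mult(2)])
    show "M_mult K (tAM (clA []) (clM w)) = clM w" if "chord_word w" for w
      using M_mult(3)[OF nil that] by simp
  qed
  note tens_lin = lin_map_tens_left[OF module_A module_M] lin_map_tens_right[OF module_A module_M]
    lin_map_tens_left[OF module_A module_A] lin_map_tens_right[OF module_A module_A]
  have act_closed: "M_mult K (tAM a v) \<in> carrier \<M>" if "a \<in> carrier \<A>" "v \<in> carrier \<M>" for a v
    by (rule lin_map.closed[OF M_mult(2) tAM_closed[OF that]])
  have mult_closed: "A_mult K (tAA a b) \<in> carrier \<A>" if "a \<in> carrier \<A>" "b \<in> carrier \<A>" for a b
    by (rule lin_map.closed[OF A_mult(1) tAA_closed[OF that]])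
  have assoc: "M_mult K (tAM (A_mult K (tAA a b)) v) = M_mult K (tAM a (M_mult K (tAM b v)))"
    if a: "a \<in> carrier \<A>" and b: "b \<in> carrier \<A>" and v: "v \<in> carrier \<M>" for a b v
  proof (rule A_ext[OF _ _ finite.emptyI _ a])
    show "lin_map K \<A> \<M> (\<lambda>a. M_mult K (tAM (A_mult K (tAA a b)) v))"
      by (rule lin_map_comp[OF lin_map_comp[OF lin_map_comp[OF tens_lin(4)[OF b] A_mult(1)]
            tens_lin(2)[OF v]] M_mult(2)])
    show "lin_map K \<A> \<M> (\<lambda>a. M_mult K (tAM a (M_mult K (tAM b v))))"
      by (rule lin_map_comp[OF tens_lin(2)[OF act_closed[OF b v]] M_mult(2)])
    fix c assume c: "chord_word c" "black_word c"
    note cA = clA_closed[OF c]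
    show "M_mult K (tAM (A_mult K (tAA (clA c) b)) v) = M_mult K (tAM (clA c) (M_mult K (tAM b v)))"
    proof (rule A_ext[OF _ _ List.finite_set[of c] _ b])
      show "lin_map K \<A> \<M> (\<lambda>b. M_mult K (tAM (A_mult K (tAA (clA c) b)) v))"
        by (rule lin_map_comp[OF lin_map_comp[OF lin_map_comp[OF tens_lin(3)[OF cA] A_mult(1)]
              tens_lin(2)[OF v]] M_mult(2)])
      show "lin_map K \<A> \<M> (\<lambda>b. M_mult K (tAM (clA c) (M_mult K (tAM b v))))"
        by (rule lin_map_comp[OF lin_map_comp[OF lin_map_comp[OF tens_lin(2)[OF v] M_mult(2)]
              tens_lin(1)[OF cA]] M_mult(2)])
      fix d assume d: "chord_word d" "black_word d" and cd: "set d \<inter> set c = {}"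
      note dA = clA_closed[OF d]
      have mult: "A_mult K (tAA (clA c) (clA d)) = clA (c @ d)"
        using A_mult(2)[OF c d(1)] c d cd by (simp add: prA_black black_word_append Int_commute)
      have cw: "chord_word (c @ d)" "black_word (c @ d)"
        using c d cd by (simp_all add: chord_word_append black_word_append Int_commute)
      show "M_mult K (tAM (A_mult K (tAA (clA c) (clA d))) v) =
          M_mult K (tAM (clA c) (M_mult K (tAM (clA d) v)))"
        unfolding mult
      proof (rule M_ext[OF _ _ List.finite_set[of "c @ d"] _ v])
        show "lin_map K \<M> \<M> (\<lambda>v. M_mult K (tAM (clA (c @ d)) v))"
          by (rule lin_map_comp[OF tens_lin(1)[OF clA_closed[OF cw]] M_mult(2)])
        show "lin_map K \<M> \<M> (\<lambda>v. M_mult K (tAM (clA c) (M_mult K (tAM (clA d) v))))"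
          by (rule lin_map_comp[OF lin_map_comp[OF lin_map_comp[OF tens_lin(1)[OF dA] M_mult(2)]
                tens_lin(1)[OF cA]] M_mult(2)])
        fix w assume w: "chord_word w" and disj: "set w \<inter> set (c @ d) = {}"
        have disj': "set (c @ d) \<inter> set w = {}" "set d \<inter> set w = {}" "set c \<inter> set (d @ w) = {}"
          using disj cd by auto
        have dw: "chord_word (d @ w)" using d w disj' by (simp add: chord_word_append)
        show "M_mult K (tAM (clA (c @ d)) (clM w)) = M_mult K (tAM (clA c) (M_mult K (tAM (clA d) (clM w))))"
          by (simp only: M_mult(3)[OF cw w disj'(1)] M_mult(3)[OF d w disj'(2)]
              M_mult(3)[OF c dw disj'(3)] append_assoc)
      qed
    qed
  qed
  show ?thesis
    unfolding left_module_structure_def A_hopf_def Let_def hopf_structure.simps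
    using module_M M_mult(1) unit assoc by (intro conjI ballI)
qed

end

section \<open>The Hopf module\<close>

context chord_spaces
begin

interpretation M: module K \<M> by (rule module_M)
interpretation A: module K \<A> by (rule module_A)
interpretation AM: module K \<A>\<M> by (rule module_AM)

abbreviation "\<A>\<A>\<M> \<equiv> tensor_space K \<A> \<A>\<M>"
abbreviation "tAAM \<equiv> tens K \<A> \<A>\<M>"

lemma module_AAM: "module K \<A>\<A>\<M>"
  by (rule module_tensor_space[OF module_A module_AM])

interpretation AAM: module K \<A>\<A>\<M> by (rule module_AAM)

lemmas tAAM_closed = tens_closed[OF module_A module_AM]

text \<open>Expresses the coaction of a subword through subsets of the chords of the original word,
  so that iterated splittings can be indexed by subsets of one fixed set;
  \<open>copA_subword\<close> does the same for the coproduct.\<close>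

lemma coact_subword:
  assumes "chord_word w" "I \<subseteq> set w"
  shows "coact (subword I w) = (\<Oplus>\<^bsub>\<A>\<M>\<^esub>J\<in>Pow I. tAM (prA (subword J w)) (clM (subword (I - J) w)))"
proof -
  have set: "set (subword I w) = I" using assms(2) by (auto simp: set_subword)
  show ?thesis
    unfolding coact_def set subword_subword
  proof (rule AM.M.finsum_cong'[OF refl])
    fix J assume "J \<in> Pow I"
    then have "J \<inter> I = J" "(I - J) \<inter> I = I - J" by auto
    then show "tAM (prA (subword (J \<inter> I) w)) (clM (subword ((I - J) \<inter> I) w)) =
        tAM (prA (subword J w)) (clM (subword (I - J) w))" by (simp only:)
  qed (simp add: Pi_def tAM_closed prA_subword_closed clM_closed assms(1))
qed

lemma copA_subword:
  assumes "chord_word w" "I \<subseteq> set w"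
  shows "copA (subword I w) =
    (\<Oplus>\<^bsub>\<A>\<A>\<^esub>J\<in>Pow I. tAA (prA (subword J w)) (prA (subword (I - J) w)))"
proof -
  interpret AA: module K \<A>\<A> by (rule module_AA)
  have set: "set (subword I w) = I" using assms(2) by (auto simp: set_subword)
  show ?thesis
    unfolding copA_def set subword_subword
  proof (rule AA.M.finsum_cong'[OF refl])
    fix J assume "J \<in> Pow I"
    then have "J \<inter> I = J" "(I - J) \<inter> I = I - J" by auto
    then show "tAA (prA (subword (J \<inter> I) w)) (prA (subword ((I - J) \<inter> I) w)) =
        tAA (prA (subword J w)) (prA (subword (I - J) w))" by (simp only:)
  qed (simp add: Pi_def tAA_closed prA_subword_closed assms(1))
qed

text \<open>Both sides expand into the terms \<open>?g I J L\<close> for ordered decompositions of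
  the chords into three parts: the left side divides the right tensor factor once more, the right
  side the left one. \<open>finsum_Pow_coassoc\<close> identifies the two double sums.\<close>

lemma coact_coassoc:
  assumes w: "chord_word w"
  shows "tensor_map K \<A> \<A> \<M> \<A>\<M> (id_map \<A>) (M_coaction K) (coact w) =
    tensor_assoc K \<A> \<A> \<M> (tensor_map K \<A> \<A>\<A> \<M> \<M> (A_comult K) (id_map \<M>) (coact w))"
proof -
  let ?S = "set w"
  let ?p = "\<lambda>I. prA (subword I w)" and ?m = "\<lambda>I. clM (subword I w)"
  let ?g = "\<lambda>I J L. tAAM (?p I) (tAM (?p J) (?m L))"
  let ?T = "tensor_map K \<A> \<A> \<M> \<A>\<M> (id_map \<A>) (M_coaction K)"
  let ?D = "tensor_map K \<A> \<A>\<A> \<M> \<M> (A_comult K) (id_map \<M>)"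
  let ?R = "\<lambda>t. tensor_assoc K \<A> \<A> \<M> (?D t)"
  note T = tensor_map[OF lin_map_id[OF module_A] M_coaction(2)]
  note D = tensor_map[OF A_comult(1) lin_map_id[OF module_M]]
  note assoc = tensor_assoc[OF module_A module_A module_M]
  have R: "lin_map K \<A>\<M> \<A>\<A>\<M> ?R" by (rule lin_map_comp[OF D(1) assoc(1)])
  have p: "?p I \<in> carrier \<A>" for I by (rule prA_subword_closed[OF w])
  note closed = p clM_closed tAM_closed tAA_closed tAAM_closed
  have T_term: "?T (tAM (?p I) (?m (?S - I))) = (\<Oplus>\<^bsub>\<A>\<A>\<M>\<^esub>J\<in>Pow (?S - I). ?g I J (?S - I - J))"
    if I: "I \<subseteq> ?S" for I
  proof -
    have "?T (tAM (?p I) (?m (?S - I))) = tAAM (?p I) (coact (subword (?S - I) w))"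
      by (simp add: T(2) closed id_map_apply M_coaction(3) chord_word_subword w)
    also have "\<dots> = (\<Oplus>\<^bsub>\<A>\<A>\<M>\<^esub>J\<in>Pow (?S - I). ?g I J (?S - I - J))"
      unfolding coact_subword[OF w Diff_subset]
      by (rule lin_map.map_finsum[OF lin_map_tens_left[OF module_A module_AM p]])
        (simp_all add: Pi_def closed)
    finally show ?thesis .
  qed
  have R_term: "?R (tAM (?p I) (?m (?S - I))) = (\<Oplus>\<^bsub>\<A>\<A>\<M>\<^esub>J\<in>Pow I. ?g J (I - J) (?S - I))"
    if I: "I \<subseteq> ?S" for I
  proof -
    have "?R (tAM (?p I) (?m (?S - I))) =
        tensor_assoc K \<A> \<A> \<M> (tens K \<A>\<A> \<M> (copA (subword I w)) (?m (?S - I)))"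
      by (simp add: D(2) closed id_map_apply A_comult(2) chord_word_subword w)
    also have "\<dots> = (\<Oplus>\<^bsub>\<A>\<A>\<M>\<^esub>J\<in>Pow I.
        tensor_assoc K \<A> \<A> \<M> (tens K \<A>\<A> \<M> (tAA (?p J) (?p (I - J))) (?m (?S - I))))"
      unfolding copA_subword[OF w I]
      by (rule lin_map.map_finsum[OF lin_map_comp[OF lin_map_tens_right[OF module_AA module_M clM_closed] assoc(1)]])
        (simp_all add: Pi_def closed finite_subset[OF I])
    also have "\<dots> = (\<Oplus>\<^bsub>\<A>\<A>\<M>\<^esub>J\<in>Pow I. ?g J (I - J) (?S - I))"
      by (simp only: assoc(2) p clM_closed)
    finally show ?thesis .
  qed
  have "?T (coact w) = (\<Oplus>\<^bsub>\<A>\<A>\<M>\<^esub>I\<in>Pow ?S. ?T (tAM (?p I) (?m (?S - I))))"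
    unfolding coact_def by (rule lin_map.map_finsum[OF T(1)]) (simp_all add: Pi_def closed)
  also have "\<dots> = (\<Oplus>\<^bsub>\<A>\<A>\<M>\<^esub>I\<in>Pow ?S. \<Oplus>\<^bsub>\<A>\<A>\<M>\<^esub>J\<in>Pow (?S - I). ?g I J (?S - I - J))"
    by (rule AAM.M.finsum_cong'[OF refl]) (simp_all add: T_term Pi_def closed AAM.M.finsum_closed)
  also have "\<dots> = (\<Oplus>\<^bsub>\<A>\<A>\<M>\<^esub>I\<in>Pow ?S. \<Oplus>\<^bsub>\<A>\<A>\<M>\<^esub>J\<in>Pow I. ?g J (I - J) (?S - I))"
    by (rule AAM.M.finsum_Pow_coassoc) (simp_all add: closed)
  also have "\<dots> = (\<Oplus>\<^bsub>\<A>\<A>\<M>\<^esub>I\<in>Pow ?S. ?R (tAM (?p I) (?m (?S - I))))"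
    by (rule AAM.M.finsum_cong'[OF refl, symmetric])
      (simp_all add: R_term Pi_def closed lin_map.closed[OF R])
  also have "\<dots> = ?R (coact w)"
    unfolding coact_def by (rule lin_map.map_finsum[OF R, symmetric]) (simp_all add: Pi_def closed)
  finally show ?thesis .
qed

text \<open>The counit kills every splitting except the one that puts no chord into the left
  factor.\<close>

lemma coact_counit:
  assumes w: "chord_word w"
  shows "tensor_lunit K \<M> (tensor_map K \<A> (ground_space K) \<M> \<M> (A_counit K) (id_map \<M>) (coact w)) = clM w"
proof -
  let ?T = "tensor_map K \<A> (ground_space K) \<M> \<M> (A_counit K) (id_map \<M>)"
  let ?p = "\<lambda>I. prA (subword I w)" and ?m = "\<lambda>I. clM (subword (set w - I) w)"
  note T = tensor_map[OF A_counit(1) lin_map_id[OF module_M]]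
  note lunit = tensor_lunit[OF module_M]
  have p: "?p I \<in> carrier \<A>" for I by (rule prA_subword_closed[OF w])
  have summand: "tensor_lunit K \<M> (?T (tAM (?p I) (?m I))) = (if {} = I then ?m I else \<zero>\<^bsub>\<M>\<^esub>)"
    if "I \<in> Pow (set w)" for I
  proof -
    \<comment> \<open>The inclusion of \<open>I\<close> in the chords of \<open>w\<close> matters
      here: each chord in \<open>I\<close> leaves its letters in the subword.\<close>
    have "subword I w = [] \<longleftrightarrow> {} = I"
      using that set_subword[of I w] by (metis Int_absorb2 PowD set_empty)
    then show ?thesis
      by (simp add: T(2) p clM_closed id_map_apply A_counit(2) chord_word_subword w lunit(2))
  qed
  have "tensor_lunit K \<M> (?T (coact w)) = (\<Oplus>\<^bsub>\<M>\<^esub>I\<in>Pow (set w). tensor_lunit K \<M> (?T (tAM (?p I) (?m I))))"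
    unfolding coact_def
    by (rule lin_map.map_finsum[OF lin_map_comp[OF T(1) lunit(1)]]) (simp_all add: Pi_def tAM_closed p clM_closed)
  also have "\<dots> = (\<Oplus>\<^bsub>\<M>\<^esub>I\<in>Pow (set w). if {} = I then ?m I else \<zero>\<^bsub>\<M>\<^esub>)"
    by (rule M.M.finsum_cong'[OF refl]) (simp_all add: summand Pi_def clM_closed)
  also have "\<dots> = ?m {}"
    by (rule M.M.finsum_singleton) (simp_all add: Pi_def clM_closed)
  also have "\<dots> = clM w" by (simp add: subword_id)
  finally show ?thesis .
qed

lemma left_comodule: "left_comodule_structure K (A_hopf K) \<M> (M_coaction K)"
proof -
  have coassoc: "tensor_map K \<A> \<A> \<M> \<A>\<M> (id_map \<A>) (M_coaction K) (M_coaction K v) =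
      tensor_assoc K \<A> \<A> \<M> (tensor_map K \<A> \<A>\<A> \<M> \<M> (A_comult K) (id_map \<M>) (M_coaction K v))"
    if v: "v \<in> carrier \<M>" for v
  proof (rule M_ext[OF _ _ finite.emptyI _ v])
    show "lin_map K \<M> \<A>\<A>\<M> (\<lambda>v. tensor_map K \<A> \<A> \<M> \<A>\<M> (id_map \<A>) (M_coaction K) (M_coaction K v))"
      by (rule lin_map_comp[OF M_coaction(2) tensor_map(1)[OF lin_map_id[OF module_A] M_coaction(2)]])
    show "lin_map K \<M> \<A>\<A>\<M> (\<lambda>v. tensor_assoc K \<A> \<A> \<M>
        (tensor_map K \<A> \<A>\<A> \<M> \<M> (A_comult K) (id_map \<M>) (M_coaction K v)))"
      by (rule lin_map_comp[OF lin_map_comp[OF M_coaction(2)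
            tensor_map(1)[OF A_comult(1) lin_map_id[OF module_M]]] tensor_assoc(1)[OF module_A module_A module_M]])
  qed (simp only: M_coaction(3) coact_coassoc)
  have counit: "tensor_lunit K \<M> (tensor_map K \<A> (ground_space K) \<M> \<M> (A_counit K) (id_map \<M>) (M_coaction K v)) = v"
    if v: "v \<in> carrier \<M>" for v
  proof (rule M_ext[OF _ lin_map_ident[OF module_M] finite.emptyI _ v])
    show "lin_map K \<M> \<M> (\<lambda>v. tensor_lunit K \<M>
        (tensor_map K \<A> (ground_space K) \<M> \<M> (A_counit K) (id_map \<M>) (M_coaction K v)))"
      by (rule lin_map_comp[OF lin_map_comp[OF M_coaction(2)
            tensor_map(1)[OF A_counit(1) lin_map_id[OF module_M]]] tensor_lunit(1)[OF module_M]])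
  qed (simp only: M_coaction(3) coact_counit)
  show ?thesis
    unfolding left_comodule_structure_def A_hopf_def Let_def hopf_structure.simps
    using module_M M_coaction(1) coassoc counit by (intro conjI ballI)
qed

text \<open>Splitting the chords of the glued word means splitting those of each factor. The sum
  over subsets of \<open>d\<close> is placed outside because the diagonal action meets
  \<open>coact d\<close> first and expands the coproduct of \<open>c\<close> inside each of its
  terms.\<close>

lemma coact_append:
  assumes c: "chord_word c" "black_word c" and d: "chord_word d" and disj: "set c \<inter> set d = {}"
  shows "coact (c @ d) = (\<Oplus>\<^bsub>\<A>\<M>\<^esub>J\<in>Pow (set d). \<Oplus>\<^bsub>\<A>\<M>\<^esub>I\<in>Pow (set c).
    tAM (prA (subword I c @ subword J d)) (clM (subword (set c - I) c @ subword (set d - J) d)))"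
proof -
  let ?w = "c @ d"
  let ?f = "\<lambda>I. tAM (prA (subword I ?w)) (clM (subword (set ?w - I) ?w))"
  let ?g = "\<lambda>J I. tAM (prA (subword I c @ subword J d)) (clM (subword (set c - I) c @ subword (set d - J) d))"
  have w: "chord_word ?w" using c(1) d disj by (simp add: chord_word_append)
  have f: "?f I \<in> carrier \<A>\<M>" for I
    by (intro tAM_closed clM_closed prA_subword_closed w)
  have fg: "?f (J \<union> I) = ?g J I" if "J \<in> Pow (set d)" "I \<in> Pow (set c)" for I J
  proof -
    have "subword (J \<union> I) c = subword I c" "subword (J \<union> I) d = subword J d"
      "subword (set ?w - (J \<union> I)) c = subword (set c - I) c"
      "subword (set ?w - (J \<union> I)) d = subword (set d - J) d"
      using that disj by (auto intro!: subword_cong)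
    then show ?thesis by (simp only: subword_append)
  qed
  have "coact ?w = (\<Oplus>\<^bsub>\<A>\<M>\<^esub>I\<in>Pow (set d \<union> set c). ?f I)"
    unfolding coact_def by (simp only: set_append Un_commute)
  also have "\<dots> = (\<Oplus>\<^bsub>\<A>\<M>\<^esub>J\<in>Pow (set d). \<Oplus>\<^bsub>\<A>\<M>\<^esub>I\<in>Pow (set c). ?f (J \<union> I))"
    by (rule AM.M.finsum_Pow_Un) (use disj f in \<open>simp_all add: Int_commute\<close>)
  also have "\<dots> = (\<Oplus>\<^bsub>\<A>\<M>\<^esub>J\<in>Pow (set d). \<Oplus>\<^bsub>\<A>\<M>\<^esub>I\<in>Pow (set c). ?g J I)"
  proof (rule AM.M.finsum_cong'[OF refl])
    have g: "?g J I \<in> carrier \<A>\<M>" if "J \<in> Pow (set d)" "I \<in> Pow (set c)" for I J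
      unfolding fg[OF that, symmetric] by (rule f)
    show "(\<lambda>J. \<Oplus>\<^bsub>\<A>\<M>\<^esub>I\<in>Pow (set c). ?g J I) \<in> Pow (set d) \<rightarrow> carrier \<A>\<M>"
      by (intro Pi_I AM.M.finsum_closed g)
    show "(\<Oplus>\<^bsub>\<A>\<M>\<^esub>I\<in>Pow (set c). ?f (J \<union> I)) = (\<Oplus>\<^bsub>\<A>\<M>\<^esub>I\<in>Pow (set c). ?g J I)"
      if "J \<in> Pow (set d)" for J
      by (rule AM.M.finsum_cong'[OF refl Pi_I[OF g[OF that]] fg[OF that]])
  qed
  finally show ?thesis .
qed

lemma diagonal_action_eq:
  "diagonal_action K (A_hopf K) \<M> (M_mult K) t =
    tensor_map K \<A>\<A> \<A> \<A>\<M> \<M> (A_mult K) (M_mult K) (tensor_middle_swap K \<A> \<A> \<A> \<M>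
      (tensor_map K \<A> \<A>\<A> \<A>\<M> \<A>\<M> (A_comult K) (id_map \<A>\<M>) t))"
  by (simp add: diagonal_action_def A_hopf_def Let_def)

lemma lin_map_diagonal_action:
  "lin_map K \<A>\<A>\<M> \<A>\<M> (diagonal_action K (A_hopf K) \<M> (M_mult K))"
  unfolding diagonal_action_eq
  by (rule lin_map_comp[OF lin_map_comp[OF tensor_map(1)[OF A_comult(1) lin_map_id[OF module_AM]]
        tensor_middle_swap(1)[OF module_A module_A module_A module_M]] tensor_map(1)[OF A_mult(1) M_mult(2)]])

text \<open>The compatibility of action and coaction on words. The coproduct of \<open>c\<close>
  hands \<open>subword I c\<close> to the left factor and its complement to the right one, where
  they are glued to the two parts of \<open>d\<close>; the results are the terms of
  \<open>coact_append\<close>.\<close>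

lemma coaction_action:
  assumes c: "chord_word c" "black_word c" and d: "chord_word d" and disj: "set c \<inter> set d = {}"
  shows "diagonal_action K (A_hopf K) \<M> (M_mult K) (tAAM (clA c) (coact d)) = coact (c @ d)"
proof -
  let ?D = "diagonal_action K (A_hopf K) \<M> (M_mult K)"
  let ?P = "tensor_map K \<A>\<A> \<A> \<A>\<M> \<M> (A_mult K) (M_mult K)"
  let ?Q = "tensor_middle_swap K \<A> \<A> \<A> \<M>"
  let ?p = "\<lambda>J. prA (subword J d)" and ?m = "\<lambda>J. clM (subword (set d - J) d)"
  let ?g = "\<lambda>J I. tAM (prA (subword I c @ subword J d)) (clM (subword (set c - I) c @ subword (set d - J) d))"
  note P = tensor_map[OF A_mult(1) M_mult(2)]
  note Q = tensor_middle_swap[OF module_A module_A module_A module_M]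
  have p: "?p J \<in> carrier \<A>" for J by (rule prA_subword_closed[OF d])
  have cI: "clA (subword I c) \<in> carrier \<A>" for I
    by (intro clA_closed chord_word_subword black_word_subword c)
  have sub_disj: "set (subword I c) \<inter> set (subword J d) = {}" for I J
    using disj by (auto simp: set_subword)
  have act: "?P (?Q (tens K \<A>\<A> \<A>\<M> (tAA (prA (subword I c)) (prA (subword (set c - I) c))) (tAM (?p J) (?m J)))) =
      ?g J I" for I J
  \<comment> \<open>Subwords of \<open>c\<close> are black, so their \<open>prA\<close> is an
    ordinary class. A subword of \<open>d\<close> need not be black, which is why the product in
    \<open>\<A>\<close> is evaluated at \<open>prA\<close> in its second argument.\<close>
  proof -
    have pr: "prA (subword I c) = clA (subword I c)" for I
      by (intro prA_black black_word_subword c)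
    have "?Q (tens K \<A>\<A> \<A>\<M> (tAA (prA (subword I c)) (prA (subword (set c - I) c))) (tAM (?p J) (?m J))) =
        tens K \<A>\<A> \<A>\<M> (tAA (clA (subword I c)) (?p J)) (tAM (clA (subword (set c - I) c)) (?m J))"
      unfolding pr by (rule Q(2)[OF cI cI p clM_closed])
    then show ?thesis
      by (simp only: P(2) tAA_closed tAM_closed cI p clM_closed
          A_mult(2) M_mult(3) chord_word_subword black_word_subword c d sub_disj)
  qed
  have g: "?g J I \<in> carrier \<A>\<M>" for I J
    by (intro tAM_closed clM_closed prA_closed)
      (simp add: chord_word_append[OF sub_disj] chord_word_subword c(1) d)
  have D_term: "?D (tAAM (clA c) (tAM (?p J) (?m J))) = (\<Oplus>\<^bsub>\<A>\<M>\<^esub>I\<in>Pow (set c). ?g J I)" for J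
  proof -
    have t: "tAM (?p J) (?m J) \<in> carrier \<A>\<M>" by (intro tAM_closed p clM_closed)
    have "?D (tAAM (clA c) (tAM (?p J) (?m J))) = ?P (?Q (tens K \<A>\<A> \<A>\<M> (copA c) (tAM (?p J) (?m J))))"
      unfolding diagonal_action_eq
      using A_comult(2)[OF c(1)] c
      by (simp add: tensor_map(2)[OF A_comult(1) lin_map_id[OF module_AM]] clA_closed t id_map_apply prA_black)
    also have "\<dots> = (\<Oplus>\<^bsub>\<A>\<M>\<^esub>I\<in>Pow (set c). ?P (?Q (tens K \<A>\<A> \<A>\<M>
        (tAA (prA (subword I c)) (prA (subword (set c - I) c))) (tAM (?p J) (?m J)))))"
      unfolding copA_def
      by (rule lin_map.map_finsum[OF lin_map_comp[OF lin_map_comp[OF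
              lin_map_tens_right[OF module_AA module_AM t] Q(1)] P(1)]])
        (simp_all add: Pi_def tAA_closed prA_subword_closed c(1))
    finally show ?thesis by (simp only: act)
  qed
  have "?D (tAAM (clA c) (coact d)) = (\<Oplus>\<^bsub>\<A>\<M>\<^esub>J\<in>Pow (set d). ?D (tAAM (clA c) (tAM (?p J) (?m J))))"
    unfolding coact_def
    by (rule lin_map.map_finsum[OF lin_map_comp[OF
            lin_map_tens_left[OF module_A module_AM clA_closed[OF c]] lin_map_diagonal_action]])
      (simp_all add: Pi_def tAM_closed p clM_closed)
  also have "\<dots> = coact (c @ d)"
    unfolding coact_append[OF c d disj] by (simp only: D_term)
  finally show ?thesis .
qed

lemma coaction_equivariant:
  assumes h: "h \<in> carrier \<A>" and v: "v \<in> carrier \<M>"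
  shows "M_coaction K (M_mult K (tAM h v)) =
    diagonal_action K (A_hopf K) \<M> (M_mult K) (tAAM h (M_coaction K v))"
proof (rule A_ext[OF _ _ finite.emptyI _ h])
  let ?D = "diagonal_action K (A_hopf K) \<M> (M_mult K)"
  show "lin_map K \<A> \<A>\<M> (\<lambda>h. M_coaction K (M_mult K (tAM h v)))"
    by (rule lin_map_comp[OF lin_map_comp[OF lin_map_tens_right[OF module_A module_M v] M_mult(2)] M_coaction(2)])
  show "lin_map K \<A> \<A>\<M> (\<lambda>h. ?D (tAAM h (M_coaction K v)))"
    by (rule lin_map_comp[OF lin_map_tens_right[OF module_A module_AM lin_map.closed[OF M_coaction(2) v]]
          lin_map_diagonal_action])
  fix c assume c: "chord_word c" "black_word c"
  note cA = clA_closed[OF c]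
  show "M_coaction K (M_mult K (tAM (clA c) v)) = ?D (tAAM (clA c) (M_coaction K v))"
  \<comment> \<open>The word for \<open>v\<close> is chosen to avoid the chords of \<open>c\<close>,
    so that the action is given by concatenation.\<close>
  proof (rule M_ext[OF _ _ List.finite_set[of c] _ v])
    show "lin_map K \<M> \<A>\<M> (\<lambda>v. M_coaction K (M_mult K (tAM (clA c) v)))"
      by (rule lin_map_comp[OF lin_map_comp[OF lin_map_tens_left[OF module_A module_M cA] M_mult(2)] M_coaction(2)])
    show "lin_map K \<M> \<A>\<M> (\<lambda>v. ?D (tAAM (clA c) (M_coaction K v)))"
      by (rule lin_map_comp[OF lin_map_comp[OF M_coaction(2) lin_map_tens_left[OF module_A module_AM cA]]
            lin_map_diagonal_action])
    fix d assume d: "chord_word d" and "set d \<inter> set c = {}"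
    then have disj: "set c \<inter> set d = {}" by blast
    have "chord_word (c @ d)" using c d disj by (simp add: chord_word_append)
    then show "M_coaction K (M_mult K (tAM (clA c) (clM d))) = ?D (tAAM (clA c) (M_coaction K (clM d)))"
      by (simp only: M_mult(3)[OF c d disj] M_coaction(3) d coaction_action[OF c d disj])
  qed
qed

end

theorem theorem1p3:
  fixes K :: "('k, 'm) ring_scheme"
  assumes "field K"
    and char_0: "\<And>n::nat. n > 0 \<Longrightarrow> [n] \<cdot>\<^bsub>K\<^esub> \<one>\<^bsub>K\<^esub> \<noteq> \<zero>\<^bsub>K\<^esub>"
  shows "left_hopf_module K (A_hopf K) (M_space K) (M_mult K) (M_coaction K)"
proof -
  interpret field K by fact
  interpret chord_spaces K by (rule chord_spaces.intro[OF is_cring])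
  have "hspace (A_hopf K) = A_space K" by (simp add: A_hopf_def)
  then show ?thesis
    unfolding left_hopf_module_def Let_def
    using left_module left_comodule coaction_equivariant by (simp only:) blast
qed

end
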